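(* Let $N\ge5$ and let $0\le\mu\in L^1(\mathbb{R}^N)$ be the density of a probability measure $d\mu=\mu(x)\,dx$. Put $U:=\frac14\left|\frac{\nabla\mu}{\mu}\right|^2-\frac12\frac{\Delta\mu}{\mu}$ and assume: (1) $\sqrt\mu\in H^1_{\rm loc}(\mathbb{R}^N)$ and $\Delta\mu\in L^1_{\rm loc}(\mathbb{R}^N)$; (2) there exists $R_0>0$ such that $|x|^2U(x)\le\frac14\frac{1}{|\log|x||^2}$ for all $x\in B_{R_0}$; (3) $U$ is bounded from above in $\mathbb{R}^N\setminus B_R$ for every $R>0$. Let $C_0=\left(\frac{N-2}{2}\right)^2$ and $Lu=\Delta u+\frac{\nabla\mu}{\mu}\cdot\nabla u$. Then there exists a constant $C_1>0$ (independent of $u$ and $\varepsilon$ below) such that: (i) for any $\varepsilon>0$ and any $u\in C_c^\infty(\mathbb{R}^N)$, $$\left((C_0-1)^2-\varepsilon\right)\int_{\mathbb{R}^N}\frac{|u(x)|^2}{|x|^4}\,d\mu\le\int_{\mathbb{R}^N}|Lu(x)|^2\,d\mu+\frac{\left((C_0-1)C_1\right)^2}{\varepsilon}\int_{\mathbb{R}^N}|u(x)|^2\,d\mu;$$ (ii) for any $u\in C_c^\infty(\mathbb{R}^N)$, $$(C_0-1)^2\int_{\mathbb{R}^N}\frac{|u(x)|^2}{|x|^4}\,d\mu\le\int_{\mathbb{R}^N}|Lu(x)|^2\,d\mu+\frac{2(C_0-1)C_1}{C_0}\int_{\mathbb{R}^N}|\nabla u(x)|^2\,d\mu+\frac{2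(C_0-1)C_1^2}{C_0}\int_{\mathbb{R}^N}|u(x)|^2\,d\mu.$$
   Context: $B_R$ is the open ball of radius $R$ centred at $0$ in $\mathbb{R}^N$. *)

theory Defs
  imports "HOL-Analysis.Analysis" "HOL-Probability.Probability_Measure"
begin

section \<open>Classical derivatives and test functions\<close>

definition partial_deriv :: "'n \<Rightarrow> (real^'n \<Rightarrow> real) \<Rightarrow> real^'n \<Rightarrow> real" where
  "partial_deriv i f x = frechet_derivative f (at x) (axis i 1)"

definition grad :: "(real^'n \<Rightarrow> real) \<Rightarrow> real^'n \<Rightarrow> real^'n" where
  "grad f x = (\<chi> i. partial_deriv i f x)"

definition laplacian :: "(real^'n \<Rightarrow> real) \<Rightarrow> real^'n \<Rightarrow> real" where
  "laplacian f x = (\<Sum>i\<in>UNIV. partial_deriv i (partial_deriv i f) x)"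

primrec Ck :: "nat \<Rightarrow> (real^'n \<Rightarrow> real) \<Rightarrow> bool" where
  "Ck 0 f \<longleftrightarrow> continuous_on UNIV f"
| "Ck (Suc k) f \<longleftrightarrow> (\<forall>x. f differentiable (at x)) \<and> (\<forall>i. Ck k (partial_deriv i f))"

definition Cc_infty :: "(real^'n \<Rightarrow> real) set" where
  "Cc_infty = {u. (\<forall>k. Ck k u) \<and> compact (closure (support_on UNIV u))}"

section \<open>Local Lebesgue spaces and weak derivatives\<close>

definition L1_loc :: "(real^'n \<Rightarrow> 'b::euclidean_space) set" where
  "L1_loc = {f. \<forall>K. compact K \<longrightarrow> f absolutely_integrable_on K}"

definition L2_loc :: "(real^'n \<Rightarrow> 'b::euclidean_space) set" where
  "L2_loc = {f. f \<in> borel_measurable lebesgue \<and>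
     (\<forall>K. compact K \<longrightarrow> (\<lambda>x. (norm (f x))\<^sup>2) absolutely_integrable_on K)}"

definition has_weak_grad :: "(real^'n \<Rightarrow> real) \<Rightarrow> (real^'n \<Rightarrow> real^'n) \<Rightarrow> bool" where
  "has_weak_grad f G \<longleftrightarrow> f \<in> L1_loc \<and> G \<in> L1_loc \<and>
     (\<forall>\<phi>\<in>Cc_infty. \<forall>i. (LINT x|lebesgue. f x * partial_deriv i \<phi> x)
                      = - (LINT x|lebesgue. G x $ i * \<phi> x))"

definition has_weak_laplacian :: "(real^'n \<Rightarrow> real) \<Rightarrow> (real^'n \<Rightarrow> real) \<Rightarrow> bool" where
  "has_weak_laplacian f g \<longleftrightarrow> f \<in> L1_loc \<and> g \<in> L1_loc \<and>
     (\<forall>\<phi>\<in>Cc_infty. (LINT x|lebesgue. f x * laplacian \<phi> x) = (LINT x|lebesgue. g x * \<phi> x))"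

definition H1_loc :: "(real^'n \<Rightarrow> real) set" where
  "H1_loc = {f. f \<in> L2_loc \<and> (\<exists>G. has_weak_grad f G \<and> G \<in> L2_loc)}"

text \<open>Weak derivatives are unique only up to null sets, so the next two constants
  denote an unspecified representative (and carry no information if the weak
  derivative does not exist as a locally integrable function).  Everything below
  depends on them only through statements that hold almost everywhere or through integrals.\<close>

definition weak_grad :: "(real^'n \<Rightarrow> real) \<Rightarrow> real^'n \<Rightarrow> real^'n" where
  "weak_grad f = (SOME G. has_weak_grad f G)"

definition weak_laplacian :: "(real^'n \<Rightarrow> real) \<Rightarrow> real^'n \<Rightarrow> real" where
  "weak_laplacian f = (SOME g. has_weak_laplacian f g)"

section \<open>The potential and the Kolmogorov operator of a density\<close>

definition density_measure :: "(real^'n \<Rightarrow> real) \<Rightarrow> (real^'n) measure" where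
  "density_measure \<mu> = density lebesgue (\<lambda>x. ennreal (\<mu> x))"

text \<open>By the convention that division by zero gives zero, the quotients below vanish
  where \<open>\<mu>\<close> does; a bound from above on \<open>potential \<mu>\<close> by a nonnegative
  quantity is therefore a condition on the set where \<open>\<mu>\<close> is nonzero only.\<close>

definition log_grad :: "(real^'n \<Rightarrow> real) \<Rightarrow> real^'n \<Rightarrow> real^'n" where
  "log_grad \<mu> x = weak_grad \<mu> x /\<^sub>R \<mu> x"

definition potential :: "(real^'n \<Rightarrow> real) \<Rightarrow> real^'n \<Rightarrow> real" where
  "potential \<mu> x = 1/4 * (norm (log_grad \<mu> x))\<^sup>2 - 1/2 * (weak_laplacian \<mu> x / \<mu> x)"

definition kolmogorov :: "(real^'n \<Rightarrow> real) \<Rightarrow> (real^'n \<Rightarrow> real) \<Rightarrow> real^'n \<Rightarrow> real" where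
  "kolmogorov \<mu> u x = laplacian u x + log_grad \<mu> x \<bullet> grad u x"

end

theory Submission
  imports Defs
begin

text \<open>Write \<open>\<phi> = \<surd>\<mu>\<close>.  For a smooth vector field \<open>F\<close> and a test function \<open>v\<close>, expanding
  \<open>0 \<le> \<integral> \<mu> \<bar>\<nabla>v + v \<nabla>\<mu> / (2\<mu>) + v F\<bar>\<^sup>2\<close> and integrating by parts yields
  \<open>\<integral> (div F - \<bar>F\<bar>\<^sup>2) v\<^sup>2 d\<mu> \<le> \<integral> \<bar>\<nabla>v\<bar>\<^sup>2 d\<mu> + \<integral> U v\<^sup>2 d\<mu>\<close>.  With \<open>F = - \<nabla>\<psi> / \<psi>\<close> for a regularisation of
  \<open>\<psi> = \<bar>x\<bar>\<^bsup>-(N-2)/2\<^esup> (log (1 / \<bar>x\<bar>))\<^bsup>1/2\<^esup>\<close> the left side exceeds \<open>C\<^sub>0 / \<bar>x\<bar>\<^sup>2\<close> by a logarithmic term that absorbs \<open>U\<close>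
  near \<open>0\<close>, which is the weighted Hardy inequality
  \<open>C\<^sub>0 \<integral> v\<^sup>2 / \<bar>x\<bar>\<^sup>2 d\<mu> \<le> \<integral> \<bar>\<nabla>v\<bar>\<^sup>2 d\<mu> + C\<^sub>1 \<integral> v\<^sup>2 d\<mu>\<close>.  For \<open>v = u / \<bar>x\<bar>\<close> the gradient term equals
  \<open>- \<integral> u Lu / \<bar>x\<bar>\<^sup>2 d\<mu> + \<integral> u\<^sup>2 / \<bar>x\<bar>\<^sup>4 d\<mu>\<close>, and Young's inequality gives both estimates.

  Two facts about the weak derivatives of \<open>\<mu>\<close> are needed: \<open>\<nabla>\<mu> = 2 \<phi> \<nabla>\<phi>\<close> almost everywhere, which also makes
  \<open>\<bar>\<nabla>\<mu>\<bar>\<^sup>2 / \<mu>\<close> locally integrable, and \<open>\<Delta>\<mu> \<ge> 0\<close> almost everywhere on \<open>{\<mu> = 0}\<close>, where \<open>U\<close> is \<open>0\<close> by convention.\<close>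

section \<open>Smooth functions and test functions\<close>

text \<open>The constant 1/4 in hypothesis (2) is a threshold. With s = |x|^2 it reads U <= 1/(s (ln
  s)^2), and up to a bounded error this is what the factor (log (1/|x|))^(1/2) of psi adds to
  C_0/|x|^2. All bounded errors go into C_1.

  The obstacle is the origin: psi, u/|x| and u/|x|^2 are singular there, while weak derivatives can
  only be tested with smooth functions. So |x|^2 becomes |x|^2 + delta in all of them. The errors
  have a favourable sign, and Fatou's lemma removes delta and proves integrability of the singular
  terms at the same time.

  Both estimates come from one inequality, with integrals over dmu and k = C_0 - 1: k^2 int
  u^2/|x|^4 <= int |Lu|^2 + 2 k C_1 int u^2/|x|^2. Here k > 0 because N >= 5. For (i) the last
  integral is interpolated between the weights |x|^-4 and 1; for (ii) it is bounded by Hardy's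
  inequality for u itself.

  The facts on weak derivatives are obtained from double integrals of a(x) b(y) k_t(x - y), whose
  limit as t -> 0 is known for pairs in L^1 and L^infinity and for pairs in L^2.\<close>

definition smooth :: "(real^'n \<Rightarrow> real) \<Rightarrow> bool" where
  "smooth f \<longleftrightarrow> (\<forall>k. Ck k f)"

lemma partial_deriv_eqI:
  "(f has_derivative f') (at x) \<Longrightarrow> partial_deriv i f x = f' (axis i 1)"
  unfolding partial_deriv_def by (metis frechet_derivative_at)

lemma partial_deriv_const: "partial_deriv i (\<lambda>x. c) = (\<lambda>x. 0)"
  by (rule ext, subst partial_deriv_eqI[OF has_derivative_const]) simp

lemma partial_deriv_add:
  assumes "f differentiable (at x)" "g differentiable (at x)"
  shows "partial_deriv i (\<lambda>x. f x + g x) x = partial_deriv i f x + partial_deriv i g x"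
proof -
  have "((\<lambda>x. f x + g x) has_derivative
      (\<lambda>h. frechet_derivative f (at x) h + frechet_derivative g (at x) h)) (at x)"
    using assms by (intro has_derivative_add) (auto simp: frechet_derivative_works)
  from partial_deriv_eqI[OF this] show ?thesis
    by (simp add: partial_deriv_def)
qed

lemma partial_deriv_mult:
  assumes "f differentiable (at x)" "g differentiable (at x)"
  shows "partial_deriv i (\<lambda>x. f x * g x) x = partial_deriv i f x * g x + f x * partial_deriv i g x"
proof -
  have "((\<lambda>x. f x * g x) has_derivative
      (\<lambda>h. f x * frechet_derivative g (at x) h + frechet_derivative f (at x) h * g x)) (at x)"
    using assms by (intro has_derivative_mult) (auto simp: frechet_derivative_works)
  from partial_deriv_eqI[OF this] show ?thesis
    by (simp add: partial_deriv_def)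
qed

lemma partial_deriv_comp:
  assumes "f differentiable (at x)" "(h has_real_derivative h') (at (f x))"
  shows "partial_deriv i (\<lambda>x. h (f x)) x = h' * partial_deriv i f x"
proof -
  have "((\<lambda>x. h (f x)) has_derivative (\<lambda>y. h' * frechet_derivative f (at x) y)) (at x)"
    using has_derivative_compose[of f "frechet_derivative f (at x)" x UNIV h "(*) h'"] assms
    by (auto simp: frechet_derivative_works has_field_derivative_def)
  from partial_deriv_eqI[OF this] show ?thesis
    by (simp add: partial_deriv_def)
qed

lemma partial_deriv_coord: "partial_deriv i (\<lambda>x. x $ j) x = (if i = j then 1 else 0)"
proof -
  have "((\<lambda>x. x $ j) has_derivative (\<lambda>x. x $ j)) (at x)"
    by (rule bounded_linear.has_derivative[OF bounded_linear_vec_nth]) auto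
  from partial_deriv_eqI[OF this] show ?thesis by (simp add: axis_def)
qed

lemma Ck_SucD: "Ck (Suc k) f \<Longrightarrow> Ck k f"
proof (induction k arbitrary: f)
  case 0
  then show ?case
    by (auto intro!: continuous_at_imp_continuous_on differentiable_imp_continuous_within)
qed auto

lemma Ck_const: "Ck k (\<lambda>x. c)"
proof (induction k arbitrary: c)
  case (Suc k) then show ?case by (simp add: partial_deriv_const)
qed simp

lemma Ck_add: "Ck k f \<Longrightarrow> Ck k g \<Longrightarrow> Ck k (\<lambda>x. f x + g x)"
proof (induction k arbitrary: f g)
  case 0 then show ?case by (auto intro: continuous_intros)
next
  case (Suc k)
  have "partial_deriv i (\<lambda>x. f x + g x) = (\<lambda>x. partial_deriv i f x + partial_deriv i g x)" for i
    using Suc.prems by (intro ext partial_deriv_add) auto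
  with Suc show ?case by (auto intro: differentiable_add)
qed

lemma Ck_mult: "Ck k f \<Longrightarrow> Ck k g \<Longrightarrow> Ck k (\<lambda>x. f x * g x)"
proof (induction k arbitrary: f g)
  case 0 then show ?case by (auto intro: continuous_intros)
next
  case (Suc k)
  have "partial_deriv i (\<lambda>x. f x * g x) = (\<lambda>x. partial_deriv i f x * g x + f x * partial_deriv i g x)" for i
    using Suc.prems by (intro ext partial_deriv_mult) auto
  moreover have "Ck k f" "Ck k g" using Suc.prems Ck_SucD by blast+
  ultimately show ?case using Suc by (auto intro: differentiable_mult Ck_add)
qed

section \<open>Composition with smooth functions of one real variable\<close>

definition smooth1 :: "real set \<Rightarrow> (real \<Rightarrow> real) \<Rightarrow> bool" where
  "smooth1 S h \<longleftrightarrow> (\<exists>D. D 0 = h \<and> (\<forall>n. \<forall>x\<in>S. (D n has_real_derivative D (Suc n) x) (at x)))"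

text \<open>The induction on k has to run over all derivatives \<open>D n\<close> at once, since the
  chain rule turns \<open>D n\<close> into \<open>D (Suc n)\<close>. The set S admits outer
  functions such as \<open>ln\<close>, which are smooth on the positive reals only.\<close>

lemma Ck_comp:
  assumes "smooth f" "\<And>x. f x \<in> S" "\<forall>n. \<forall>x\<in>S. (D n has_real_derivative D (Suc n) x) (at x)"
  shows "Ck k (\<lambda>x. D n (f x))"
proof (induction k arbitrary: n)
  case 0
  have "f differentiable (at x)" for x using assms(1) unfolding smooth_def by (metis Ck.simps(2))
  then have "isCont f x" for x by (simp add: differentiable_imp_continuous_within)
  moreover have "isCont (D n) (f x)" for x using assms by (meson DERIV_isCont)
  ultimately have "isCont (\<lambda>x. D n (f x)) x" for x by (rule isCont_o2)
  then show ?case by (simp add: continuous_at_imp_continuous_on)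
next
  case (Suc k)
  have df: "f differentiable (at x)" for x using assms(1) unfolding smooth_def by (metis Ck.simps(2))
  have *: "(D n has_real_derivative D (Suc n) (f x)) (at (f x))" for x using assms by blast
  have "partial_deriv i (\<lambda>x. D n (f x)) = (\<lambda>x. D (Suc n) (f x) * partial_deriv i f x)" for i
    using partial_deriv_comp[OF df *] by blast
  moreover have "Ck k (partial_deriv i f)" for i
    using assms(1) unfolding smooth_def by (metis Ck.simps(2))
  moreover have "(\<lambda>x. D n (f x)) differentiable (at x)" for x
    using differentiable_compose[of "D n" f x UNIV] df * real_differentiable_def by blast
  ultimately show ?case using Suc.IH by (auto intro: Ck_mult)
qed

lemma smooth_const[simp, intro]: "smooth (\<lambda>x. c)"
  by (simp add: smooth_def Ck_const)

lemma smooth_add[intro]: "smooth f \<Longrightarrow> smooth g \<Longrightarrow> smooth (\<lambda>x. f x + g x)"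
  by (simp add: smooth_def Ck_add)

lemma smooth_mult[intro]: "smooth f \<Longrightarrow> smooth g \<Longrightarrow> smooth (\<lambda>x. f x * g x)"
  by (simp add: smooth_def Ck_mult)

lemma smooth_diff[intro]: "smooth f \<Longrightarrow> smooth g \<Longrightarrow> smooth (\<lambda>x. f x - g x)"
  using smooth_add[of f "\<lambda>x. (-1) * g x"] smooth_mult[of "\<lambda>x. -1" g] by simp

lemma smooth_power[intro]: "smooth f \<Longrightarrow> smooth (\<lambda>x. f x ^ n)"
  by (induction n) auto

lemma smooth_sum[intro]: "(\<And>i. i \<in> A \<Longrightarrow> smooth (f i)) \<Longrightarrow> smooth (\<lambda>x. \<Sum>i\<in>A. f i x)"
  by (induction A rule: infinite_finite_induct) auto

lemma smooth_coord[simp, intro]: "smooth (\<lambda>x::real^'n. x $ j)"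
  unfolding smooth_def
proof
  fix k
  have "partial_deriv i (\<lambda>x::real^'n. x $ j) = (\<lambda>x. if i = j then 1 else 0)" for i
    by (rule ext) (rule partial_deriv_coord)
  moreover have "(\<lambda>x::real^'n. x $ j) differentiable (at x)" for x
    using bounded_linear_imp_differentiable[OF bounded_linear_vec_nth] .
  ultimately show "Ck k (\<lambda>x::real^'n. x $ j)"
    by (cases k) (auto intro!: continuous_intros Ck_const simp: if_distrib)
qed

lemma smooth_comp: "smooth1 S h \<Longrightarrow> smooth f \<Longrightarrow> (\<And>x. f x \<in> S) \<Longrightarrow> smooth (\<lambda>x. h (f x))"
  using Ck_comp[of f S _ _ 0] unfolding smooth1_def smooth_def by metis

lemma smooth_partial_deriv[intro]: "smooth f \<Longrightarrow> smooth (partial_deriv i f)"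
  unfolding smooth_def by (metis Ck.simps(2))

lemma smooth_differentiable: "smooth f \<Longrightarrow> f differentiable (at x)"
  unfolding smooth_def by (metis Ck.simps(2))

lemma smooth_continuous: "smooth f \<Longrightarrow> continuous_on UNIV f"
  unfolding smooth_def by (metis Ck.simps(1))

lemma smooth_normsq[intro]: "smooth (\<lambda>x. (norm (x - y))\<^sup>2)"
proof -
  have "(\<lambda>x. (norm (x - y))\<^sup>2) = (\<lambda>x. \<Sum>i\<in>UNIV. (x $ i - y $ i)\<^sup>2)"
    by (rule ext) (simp add: norm_vec_def L2_set_def sum_nonneg)
  moreover have "smooth (\<lambda>x. \<Sum>i\<in>UNIV. (x $ i - y $ i)\<^sup>2)"
    by (intro smooth_sum smooth_power smooth_diff smooth_coord smooth_const)
  ultimately show ?thesis by simp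
qed

lemma partial_deriv_normsq: "partial_deriv i (\<lambda>x. (norm (x - y))\<^sup>2) x = 2 * (x $ i - y $ i)"
proof -
  have "((\<lambda>x. (x - y) \<bullet> (x - y)) has_derivative (\<lambda>h. 2 * (h \<bullet> (x - y)))) (at x)"
    by (auto intro!: derivative_eq_intros simp: inner_commute)
  from partial_deriv_eqI[OF this] show ?thesis
    by (simp add: power2_norm_eq_inner inner_axis' )
qed

lemma smooth1_powr: "smooth1 {0<..} (\<lambda>s. s powr a)"
  unfolding smooth1_def
proof (intro exI conjI allI ballI)
  let ?D = "\<lambda>n s. (\<Prod>i<n. a - real i) * s powr (a - real n)"
  show "?D 0 = (\<lambda>s. s powr a)" by simp
  fix n and x :: real assume "x \<in> {0<..}"
  then show "(?D n has_real_derivative ?D (Suc n) x) (at x)"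
    by (auto intro!: derivative_eq_intros simp: algebra_simps)
qed

lemma smooth1_ln: "smooth1 {0<..} ln"
proof -
  obtain D where D: "D 0 = (\<lambda>s::real. s powr (-1))"
    "\<forall>n. \<forall>x\<in>{0<..}. (D n has_real_derivative D (Suc n) x) (at x)"
    using smooth1_powr[of "-1"] unfolding smooth1_def by blast
  have "(case_nat ln D n has_real_derivative case_nat ln D (Suc n) x) (at x)" if "x \<in> {0<..}" for n x
    using that D by (cases n) (auto intro!: derivative_eq_intros simp: powr_minus_divide)
  then show ?thesis unfolding smooth1_def by (intro exI[of _ "case_nat ln D"]) auto
qed

lemma smooth_inverse: "smooth f \<Longrightarrow> (\<And>x. f x > 0) \<Longrightarrow> smooth (\<lambda>x. inverse (f x))"
  using smooth_comp[OF smooth1_powr[of "-1"], of f] by (simp add: powr_minus less_imp_le)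

lemma smooth_divide: "smooth f \<Longrightarrow> smooth g \<Longrightarrow> (\<And>x. g x > 0) \<Longrightarrow> smooth (\<lambda>x. f x / g x)"
  using smooth_mult[OF _ smooth_inverse, of f g] by (simp add: divide_inverse)

lemma smooth_ln: "smooth f \<Longrightarrow> (\<And>x. f x > 0) \<Longrightarrow> smooth (\<lambda>x. ln (f x))"
  using smooth_comp[OF smooth1_ln, of f] by simp

section \<open>A smooth bump profile\<close>

definition flat_exp :: "real poly \<Rightarrow> real \<Rightarrow> real" where
  "flat_exp p t = (if t > 0 then poly p (1/t) * exp (- (1/t)) else 0)"

lemma poly_exp_at_top: "((\<lambda>x::real. poly p x * exp (- x)) \<longlongrightarrow> 0) at_top"
proof -
  have "((\<lambda>x::real. \<Sum>i\<le>degree p. coeff p i * (x ^ i / exp x)) \<longlongrightarrow> (\<Sum>i\<le>degree p. coeff p i * 0)) at_top"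
    by (intro tendsto_intros tendsto_power_div_exp_0)
  then show ?thesis
    by (simp add: poly_altdef sum_distrib_right exp_minus divide_inverse mult.assoc)
qed

text \<open>In the variable x = 1/t one has d/dt = - x^2 d/dx, so p(x) exp (-x) becomes x^2 (p -
  p')(x) exp (-x). The family is closed under differentiation, and smoothness at 0 is reduced to a
  single difference quotient.\<close>

lemma flat_exp_has_derivative:
  "(flat_exp p has_real_derivative flat_exp (monom 1 2 * (p - pderiv p)) t) (at t)"
proof -
  consider "t > 0" | "t < 0" | "t = 0" by linarith
  then show ?thesis
  proof cases
    case 1
    have "((\<lambda>t. poly p (1/t) * exp (- (1/t))) has_real_derivative
        flat_exp (monom 1 2 * (p - pderiv p)) t) (at t)"
      using 1 by (auto intro!: derivative_eq_intros DERIV_chain2[OF poly_DERIV]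
          simp: flat_exp_def poly_monom field_simps power2_eq_square)
    moreover have "\<forall>\<^sub>F s in nhds t. poly p (1/s) * exp (- (1/s)) = flat_exp p s"
      using eventually_nhds_in_open[of "{0<..}" t] 1
      by (auto elim!: eventually_mono simp: flat_exp_def)
    ultimately show ?thesis by (subst (asm) DERIV_cong_ev[OF refl _ refl])
  next
    case 2
    have "(flat_exp p has_real_derivative 0) (at t)"
      by (rule has_field_derivative_transform_within_open[where f="\<lambda>_. 0" and S="{..<0}"])
        (use 2 in \<open>auto simp: flat_exp_def\<close>)
    then show ?thesis
      using 2 by (simp add: flat_exp_def)
  next
    case 3
    have "((\<lambda>s. flat_exp p s / s) \<longlongrightarrow> 0) (at_right 0)"
    proof -
      have "filterlim (\<lambda>s::real. 1/s) at_top (at_right 0)"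
        using filterlim_inverse_at_top_right by (simp add: inverse_eq_divide)
      \<comment> \<open>With x = 1/s the difference quotient at 0 is x p(x) exp (-x), and
        \<open>pCons 0 p\<close> is the polynomial x p(x).\<close>
      from filterlim_compose[OF poly_exp_at_top[of "pCons 0 p"] this]
      have "((\<lambda>s. (1/s) * poly p (1/s) * exp (- (1/s))) \<longlongrightarrow> 0) (at_right 0)" by simp
      moreover have "\<forall>\<^sub>F s in at_right 0. (1/s) * poly p (1/s) * exp (- (1/s)) = flat_exp p s / s"
        by (auto simp: eventually_at_filter flat_exp_def)
      ultimately show ?thesis by (rule Lim_transform_eventually)
    qed
    moreover have "((\<lambda>s. flat_exp p s / s) \<longlongrightarrow> 0) (at_left 0)"
      by (rule tendsto_eventually) (auto simp: eventually_at_filter flat_exp_def)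
    ultimately have "((\<lambda>s. flat_exp p s / s) \<longlongrightarrow> 0) (at 0)"
      by (simp add: filterlim_split_at_real)
    then show ?thesis using 3 by (simp add: DERIV_def flat_exp_def)
  qed
qed

text \<open>\<open>bump n\<close> is the \<open>n\<close>-th derivative of \<open>s \<mapsto> exp (-1 / (1 - s))\<close>, continued by \<open>0\<close> for \<open>s \<ge> 1\<close>.\<close>

definition bump :: "nat \<Rightarrow> real \<Rightarrow> real" where
  "bump n s = (-1) ^ n * flat_exp (((\<lambda>p. monom 1 2 * (p - pderiv p)) ^^ n) 1) (1 - s)"

lemma bump_has_derivative: "(bump n has_real_derivative bump (Suc n) s) (at s)"
proof -
  have *: "((\<lambda>s. (1::real) - s) has_real_derivative -1) (at s)"
    by (auto intro!: derivative_eq_intros)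
  show ?thesis unfolding bump_def
    using DERIV_cmult[OF DERIV_chain2[OF flat_exp_has_derivative *], of "(-1) ^ n"] by simp
qed

lemma bump_DERIV [derivative_intros]:
  "(f has_real_derivative f') (at x within S) \<Longrightarrow>
   ((\<lambda>x. bump n (f x)) has_real_derivative (bump (Suc n) (f x) * f')) (at x within S)"
  using DERIV_chain2[OF bump_has_derivative] .

lemma smooth1_bump: "smooth1 UNIV (bump n)"
  unfolding smooth1_def
  by (rule exI[of _ "\<lambda>k. bump (k + n)"]) (auto simp: bump_has_derivative)

lemma smooth_bump: "smooth f \<Longrightarrow> smooth (\<lambda>x. bump n (f x))"
  by (rule smooth_comp[OF smooth1_bump]) auto

lemma bump_eq_0: "s \<ge> 1 \<Longrightarrow> bump n s = 0"
  by (simp add: bump_def flat_exp_def)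

lemma bump_0: "bump 0 s = (if s < 1 then exp (- (1 / (1 - s))) else 0)"
  by (simp add: bump_def flat_exp_def)

lemma bump_0_nonneg: "bump 0 s \<ge> 0"
  by (simp add: bump_0)

lemma bump_1_nonpos: "bump 1 s \<le> 0"
  by (simp add: bump_def flat_exp_def poly_monom)

lemma continuous_on_bump [continuous_intros]:
  assumes "continuous_on S f" shows "continuous_on S (\<lambda>x. bump n (f x))"
proof -
  have "continuous_on UNIV (bump n)"
    using DERIV_isCont[OF bump_has_derivative] by (auto intro: continuous_at_imp_continuous_on)
  from continuous_on_compose2[OF this assms] show ?thesis by auto
qed

section \<open>Test functions\<close>

lemma Cc_infty_iff: "u \<in> Cc_infty \<longleftrightarrow> smooth u \<and> (\<exists>R. \<forall>x. norm x > R \<longrightarrow> u x = 0)"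
proof -
  have "compact (closure (support_on UNIV u)) \<longleftrightarrow> bounded (support_on UNIV u)"
    by (simp add: compact_closure)
  also have "\<dots> \<longleftrightarrow> (\<exists>R. \<forall>x. norm x > R \<longrightarrow> u x = 0)"
    unfolding bounded_iff support_on_def by (auto simp: not_le) (meson not_le)+
  finally show ?thesis by (auto simp: Cc_infty_def smooth_def)
qed

lemma Cc_infty_smooth: "u \<in> Cc_infty \<Longrightarrow> smooth u"
  by (simp add: Cc_infty_iff)

lemma Cc_infty_mult: "u \<in> Cc_infty \<Longrightarrow> smooth g \<Longrightarrow> (\<lambda>x. u x * g x) \<in> Cc_infty"
  unfolding Cc_infty_iff by (metis mult_zero_left smooth_mult)

lemma partial_deriv_eq_0:
  assumes "open S" "x \<in> S" "\<And>y. y \<in> S \<Longrightarrow> u y = 0"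
  shows "partial_deriv i u x = 0"
proof -
  have "(u has_derivative (\<lambda>h. 0)) (at x)"
    by (rule has_derivative_transform_within_open[OF has_derivative_const assms(1,2)]) (simp add: assms(3))
  from partial_deriv_eqI[OF this] show ?thesis .
qed

lemma Cc_infty_partial_deriv:
  assumes "u \<in> Cc_infty" shows "partial_deriv i u \<in> Cc_infty"
proof -
  obtain R where R: "\<And>x. norm x > R \<Longrightarrow> u x = 0" using assms by (auto simp: Cc_infty_iff)
  have "open {x::real^'a. norm x > R}" by (intro open_Collect_less continuous_intros)
  then have "partial_deriv i u x = 0" if "norm x > R" for x
    using partial_deriv_eq_0[of "{x. norm x > R}" x u] R that by auto
  then show ?thesis using assms by (auto simp: Cc_infty_iff)
qed

lemma Cc_infty_bounded_support:
  assumes "u \<in> Cc_infty"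
  obtains R where "R > 0" "\<And>x. norm x > R \<Longrightarrow> u x = 0"
proof -
  obtain R where R: "\<And>x. norm x > R \<Longrightarrow> u x = 0" using assms by (auto simp: Cc_infty_iff)
  show ?thesis by (rule that[of "max R 1"]) (auto intro: R)
qed

section \<open>Mollifiers\<close>

lemma emeasure_cball_less_top: "emeasure lborel (cball (x::'a::euclidean_space) r) < top"
  using emeasure_bounded_finite[OF bounded_cball, of x r] by (simp add: infinity_ennreal_def)

text \<open>The functions involved are only Lebesgue measurable, so Fubini's theorem is wanted for
  the completed measure.\<close>

lemma sigma_finite_lebesgue: "sigma_finite_measure (lebesgue :: 'a::euclidean_space measure)"
proof
  have "(\<Union>n. cball (0::'a) (real n)) = UNIV"
    by (auto simp: real_arch_simple)
  then show "\<exists>A::'a set set. countable A \<and> A \<subseteq> sets lebesgue \<and> \<Union> A = space lebesgue \<and> (\<forall>a\<in>A. emeasure lebesgue a \<noteq> \<infinity>)"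
    by (intro exI[of _ "range (\<lambda>n. cball 0 (real n))"]) (auto simp: less_imp_neq[OF emeasure_cball_less_top])
qed

interpretation lebesgue: sigma_finite_measure lebesgue
  by (rule sigma_finite_lebesgue)

interpretation leb2: pair_sigma_finite lebesgue lebesgue ..

lemma borel_measurable_lebesgueI:
  "f \<in> borel_measurable borel \<Longrightarrow> f \<in> borel_measurable lebesgue"
  by (rule measurable_completion) (simp only: measurable_lborel2)

text \<open>Kernels are kept Borel: composed with the difference of two points, a function that is
  only Lebesgue measurable may fail to be measurable for the product sigma-algebra, which is not
  completed.\<close>

lemma borel_measurable_lebesgue_pair_diff:
  assumes "k \<in> borel_measurable borel"
  shows "(\<lambda>z. k (fst z - snd z)) \<in> borel_measurable (lebesgue \<Otimes>\<^sub>M (lebesgue :: 'a::euclidean_space measure))"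
proof -
  have "(\<lambda>x. x) \<in> lebesgue \<rightarrow>\<^sub>M (borel :: 'a measure)"
    by (rule measurable_completion) simp
  from borel_measurable_diff[OF measurable_compose[OF measurable_fst this] measurable_compose[OF measurable_snd this]]
  have "(\<lambda>z. fst z - snd z) \<in> borel_measurable (lebesgue \<Otimes>\<^sub>M (lebesgue :: 'a measure))" .
  from measurable_compose[OF this assms] show ?thesis .
qed

lemma integrable_cmult_bounded:
  fixes f g :: "_ \<Rightarrow> real"
  assumes "integrable M f" "g \<in> borel_measurable M" "\<And>x. \<bar>g x\<bar> \<le> B"
  shows "integrable M (\<lambda>x. g x * f x)"
proof (rule Bochner_Integration.integrable_bound[of M "\<lambda>x. B * f x"])
  show "AE x in M. norm (g x * f x) \<le> norm (B * f x)"
  proof (rule AE_I2)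
    fix x show "norm (g x * f x) \<le> norm (B * f x)"
      using assms(3)[of x] by (auto simp: abs_mult intro!: mult_right_mono)
  qed
qed (use assms in auto)

lemma lborel_integral_affine:
  fixes f :: "'a::euclidean_space \<Rightarrow> real"
  assumes f: "f \<in> borel_measurable borel" and c: "c \<noteq> 0"
  shows "integrable lborel f \<longleftrightarrow> integrable lborel (\<lambda>x. f (t + c *\<^sub>R x))"
    and "integral\<^sup>L lborel f = \<bar>c\<bar> ^ DIM('a) * (LINT x|lborel. f (t + c *\<^sub>R x))"
proof -
  let ?D = "density (distr lborel borel (\<lambda>x. t + c *\<^sub>R x)) (\<lambda>_. ennreal (\<bar>c\<bar> ^ DIM('a)))"
  have eq: "lborel = ?D" using lborel_affine[OF c, of t] by (simp add: ennreal_power)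
  have m: "(\<lambda>x. t + c *\<^sub>R x) \<in> lborel \<rightarrow>\<^sub>M borel" by measurable
  have "integrable lborel f \<longleftrightarrow> integrable ?D f" using eq by metis
  also have "\<dots> \<longleftrightarrow> integrable (distr lborel borel (\<lambda>x. t + c *\<^sub>R x)) (\<lambda>x. \<bar>c\<bar> ^ DIM('a) *\<^sub>R f x)"
    using f by (intro integrable_density) auto
  also have "\<dots> \<longleftrightarrow> integrable lborel (\<lambda>x. \<bar>c\<bar> ^ DIM('a) *\<^sub>R f (t + c *\<^sub>R x))"
    using f m by (intro integrable_distr_eq) auto
  also have "\<dots> \<longleftrightarrow> integrable lborel (\<lambda>x. f (t + c *\<^sub>R x))" using c by simp
  finally show "integrable lborel f \<longleftrightarrow> integrable lborel (\<lambda>x. f (t + c *\<^sub>R x))" .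
  have "integral\<^sup>L lborel f = integral\<^sup>L ?D f" using eq by metis
  also have "\<dots> = (LINT x|distr lborel borel (\<lambda>x. t + c *\<^sub>R x). \<bar>c\<bar> ^ DIM('a) *\<^sub>R f x)"
    using f by (intro integral_density) auto
  also have "\<dots> = (LINT x|lborel. \<bar>c\<bar> ^ DIM('a) *\<^sub>R f (t + c *\<^sub>R x))"
    using f m by (intro integral_distr) auto
  finally show "integral\<^sup>L lborel f = \<bar>c\<bar> ^ DIM('a) * (LINT x|lborel. f (t + c *\<^sub>R x))"
    by simp
qed

lemma integrable_bounded_support:
  fixes f :: "'a::euclidean_space \<Rightarrow> real"
  assumes "f \<in> borel_measurable lebesgue" "\<And>x. \<bar>f x\<bar> \<le> B" "\<And>x. norm x > R \<Longrightarrow> f x = 0"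
  shows "integrable lebesgue f"
proof (rule Bochner_Integration.integrable_bound[of lebesgue "\<lambda>x. B * indicator (cball 0 R) x"])
  show "integrable lebesgue (\<lambda>x. B * indicator (cball (0::'a) R) x)"
    by (intro integrable_mult_right integrable_real_indicator) (auto simp: emeasure_cball_less_top)
  show "AE x in lebesgue. norm (f x) \<le> norm (B * indicator (cball 0 R) x)"
  proof (rule AE_I2)
    fix x show "norm (f x) \<le> norm (B * indicator (cball 0 R) x)"
      using assms(2)[of x] assms(3)[of x] by (auto simp: indicator_def)
  qed
qed (use assms in auto)

text \<open>For an indicator, the set is squeezed between a closed and an open one and a Urysohn
  function is taken; sums and dominated limits follow by the triangle inequality. Boundedness of the
  approximant is recorded because convergence of its averages uses it.\<close>

lemma integrable_continuous_approx:
  fixes f :: "'a::euclidean_space \<Rightarrow> real"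
  assumes "integrable lebesgue f"
  shows "\<forall>e>0. \<exists>g. continuous_on UNIV g \<and> (\<exists>B. \<forall>x. \<bar>g x\<bar> \<le> B) \<and> integrable lebesgue g \<and>
           (LINT x|lebesgue. \<bar>f x - g x\<bar>) < e"
  using assms
proof (induction rule: integrable_induct)
  case (base A c)
  show ?case
  proof (intro allI impI)
    fix e :: real assume e: "e > 0"
    \<comment> \<open>The denominator contains \<bar>c\<bar> + 1 so that c = 0 is covered; the
      factor 2 is for the two sets A - C and U - A.\<close>
    define d where "d = e / (2 * (\<bar>c\<bar> + 1))"
    have d: "d > 0" "\<bar>c\<bar> * (2 * d) < e"
    proof -
      show "d > 0" using e by (simp add: d_def add_nonneg_pos)
      have "\<bar>c\<bar> * (2 * d) = e * (\<bar>c\<bar> / (\<bar>c\<bar> + 1))" by (simp add: d_def field_simps)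
      also have "\<dots> < e * 1" using e by (intro mult_strict_left_mono) (auto simp: field_simps)
      finally show "\<bar>c\<bar> * (2 * d) < e" by simp
    qed
    obtain C where C: "closed C" "C \<subseteq> A" "A - C \<in> lmeasurable" "emeasure lebesgue (A - C) < ennreal d"
      using sets_lebesgue_inner_closed[OF base(1) d(1)] by metis
    obtain U where U: "open U" "A \<subseteq> U" "U - A \<in> lmeasurable" "emeasure lebesgue (U - A) < ennreal d"
      using sets_lebesgue_outer_open[OF base(1) d(1)] by metis
    obtain h :: "'a \<Rightarrow> real" where h: "continuous_on UNIV h" "\<And>x. h x \<in> closed_segment 1 0"
      "\<And>x. x \<in> C \<Longrightarrow> h x = 1" "\<And>x. x \<in> -U \<Longrightarrow> h x = 0"
      by (rule Urysohn[of C "-U" "1::real" 0]) (use C U in auto)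
    have h01: "0 \<le> h x" "h x \<le> 1" for x using h(2)[of x] by (auto simp: closed_segment_eq_real_ivl)
    have hm: "h \<in> borel_measurable lebesgue"
      by (intro borel_measurable_lebesgueI borel_measurable_continuous_onI h)
    have AC: "integrable lebesgue (indicator (A - C) :: 'a \<Rightarrow> real)" "measure lebesgue (A - C) < d"
      using C d(1) by (auto simp: fmeasurable_def measure_def enn2real_less_iff)
    have UA: "integrable lebesgue (indicator (U - A) :: 'a \<Rightarrow> real)" "measure lebesgue (U - A) < d"
      using U d(1) by (auto simp: fmeasurable_def measure_def enn2real_less_iff)
    have iA: "integrable lebesgue (indicator A :: 'a \<Rightarrow> real)" using base by auto
    have pt: "\<bar>indicator A x - h x\<bar> \<le> indicator (A - C) x + indicator (U - A) x" for x
      using h01[of x] h(3,4)[of x] C(2) U(2) by (auto simp: indicator_def)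
    have hb: "\<bar>h x\<bar> \<le> indicator A x + (indicator (A - C) x + indicator (U - A) x)" for x
      using h01[of x] h(3,4)[of x] C(2) U(2) by (auto simp: indicator_def)
    have ih: "integrable lebesgue h"
      by (rule Bochner_Integration.integrable_bound[of lebesgue "\<lambda>x. indicator A x + (indicator (A - C) x + indicator (U - A) x)"])
        (use iA AC UA hm in \<open>auto intro!: AE_I2 hb\<close>)
    have "(LINT x|lebesgue. \<bar>indicator A x *\<^sub>R c - c * h x\<bar>) \<le>
        (LINT x|lebesgue. \<bar>c\<bar> * (indicator (A - C) x + indicator (U - A) x))"
    proof (rule integral_mono)
      fix x
      have "\<bar>indicator A x *\<^sub>R c - c * h x\<bar> = \<bar>c\<bar> * \<bar>indicator A x - h x\<bar>"
        by (simp flip: abs_mult add: algebra_simps)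
      then show "\<bar>indicator A x *\<^sub>R c - c * h x\<bar> \<le> \<bar>c\<bar> * (indicator (A - C) x + indicator (U - A) x)"
        using pt[of x] by (simp add: mult_left_mono)
    qed (use AC UA iA ih in auto)
    also have "\<dots> = \<bar>c\<bar> * (measure lebesgue (A - C) + measure lebesgue (U - A))"
      using AC UA by (simp add: measure_restricted)
    also have "\<dots> \<le> \<bar>c\<bar> * (2 * d)" using AC UA by (intro mult_left_mono) auto
    also note d(2)
    finally have "(LINT x|lebesgue. \<bar>indicator A x *\<^sub>R c - c * h x\<bar>) < e" .
    moreover have "\<bar>c * h x\<bar> \<le> \<bar>c\<bar>" for x using h01[of x] by (simp add: abs_mult mult_left_le)
    ultimately show "\<exists>g. continuous_on UNIV g \<and> (\<exists>B. \<forall>x. \<bar>g x\<bar> \<le> B) \<and> integrable lebesgue g \<and>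
           (LINT x|lebesgue. \<bar>indicator A x *\<^sub>R c - g x\<bar>) < e"
      by (intro exI[of _ "\<lambda>x. c * h x"] conjI) (use ih h(1) in \<open>auto intro!: continuous_intros\<close>)
  qed
next
  case (add f f')
  show ?case
  proof (intro allI impI)
    fix e :: real assume "e > 0"
    then have e2: "e / 2 > 0" by simp
    obtain g where g: "continuous_on UNIV g" "\<exists>B. \<forall>x. \<bar>g x\<bar> \<le> B" "integrable lebesgue g"
      "(LINT x|lebesgue. \<bar>f x - g x\<bar>) < e / 2" using add.IH(1) e2 by blast
    obtain g' where g': "continuous_on UNIV g'" "\<exists>B. \<forall>x. \<bar>g' x\<bar> \<le> B" "integrable lebesgue g'"
      "(LINT x|lebesgue. \<bar>f' x - g' x\<bar>) < e / 2" using add.IH(2) e2 by blast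
    have "(LINT x|lebesgue. \<bar>f x + f' x - (g x + g' x)\<bar>) \<le>
      (LINT x|lebesgue. \<bar>f x - g x\<bar> + \<bar>f' x - g' x\<bar>)"
      by (rule integral_mono) (use g g' add in auto)
    also have "\<dots> = (LINT x|lebesgue. \<bar>f x - g x\<bar>) + (LINT x|lebesgue. \<bar>f' x - g' x\<bar>)"
      by (rule Bochner_Integration.integral_add) (use g g' add in auto)
    also have "\<dots> < e" using g g' by simp
    finally have *: "(LINT x|lebesgue. \<bar>f x + f' x - (g x + g' x)\<bar>) < e" .
    obtain B B' where "\<And>x. \<bar>g x\<bar> \<le> B" "\<And>x. \<bar>g' x\<bar> \<le> B'" using g g' by blast
    then have "\<bar>g x + g' x\<bar> \<le> B + B'" for x by (meson abs_triangle_ineq add_mono order_trans)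
    with * g g' show "\<exists>g. continuous_on UNIV g \<and> (\<exists>B. \<forall>x. \<bar>g x\<bar> \<le> B) \<and> integrable lebesgue g \<and>
           (LINT x|lebesgue. \<bar>f x + f' x - g x\<bar>) < e"
      by (intro exI[of _ "\<lambda>x. g x + g' x"] conjI) (auto intro!: continuous_intros)
  qed
next
  case (lim f s)
  show ?case
  proof (intro allI impI)
    fix e :: real assume "e > 0"
    then have e2: "e / 2 > 0" by simp
    have "(\<lambda>i. LINT x|lebesgue. \<bar>f x - s i x\<bar>) \<longlonglongrightarrow> (LINT x|lebesgue. \<bar>f x - f x\<bar>)"
    \<comment> \<open>The approximants of \<open>integrable_induct\<close> are bounded by twice
      \<bar>f\<bar>, hence the factor 3 for the difference.\<close>
    proof (rule integral_dominated_convergence[of _ _ _ "\<lambda>x. 3 * norm (f x)"])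
      show "AE x in lebesgue. (\<lambda>i. \<bar>f x - s i x\<bar>) \<longlonglongrightarrow> \<bar>f x - f x\<bar>"
        using lim by (intro AE_I2 tendsto_intros) auto
      show "AE x in lebesgue. norm \<bar>f x - s i x\<bar> \<le> 3 * norm (f x)" for i
      proof (rule AE_I2)
        fix x show "norm \<bar>f x - s i x\<bar> \<le> 3 * norm (f x)"
          using lim(3)[of x i] by auto
      qed
    qed (use lim in auto)
    then have "(\<lambda>i. LINT x|lebesgue. \<bar>f x - s i x\<bar>) \<longlonglongrightarrow> 0" by simp
    then obtain i where i: "(LINT x|lebesgue. \<bar>f x - s i x\<bar>) < e / 2"
      using e2 order_tendstoD(2)[of _ 0 sequentially "e/2"] by (auto simp: eventually_sequentially)
    obtain g where g: "continuous_on UNIV g" "\<exists>B. \<forall>x. \<bar>g x\<bar> \<le> B" "integrable lebesgue g"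
      "(LINT x|lebesgue. \<bar>s i x - g x\<bar>) < e / 2" using lim.IH e2 by blast
    have "(LINT x|lebesgue. \<bar>f x - g x\<bar>) \<le> (LINT x|lebesgue. \<bar>f x - s i x\<bar> + \<bar>s i x - g x\<bar>)"
      by (rule integral_mono) (use g lim in auto)
    also have "\<dots> = (LINT x|lebesgue. \<bar>f x - s i x\<bar>) + (LINT x|lebesgue. \<bar>s i x - g x\<bar>)"
      by (rule Bochner_Integration.integral_add) (use g lim in auto)
    also have "\<dots> < e" using g i by simp
    finally show "\<exists>g. continuous_on UNIV g \<and> (\<exists>B. \<forall>x. \<bar>g x\<bar> \<le> B) \<and> integrable lebesgue g \<and>
           (LINT x|lebesgue. \<bar>f x - g x\<bar>) < e" using g by blast
  qed
qed

text \<open>The approximating sequence may change with e. Both density arguments, in L^1 and in L^2,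
  end with this lemma.\<close>

lemma tendsto_of_approx:
  fixes f :: "nat \<Rightarrow> real"
  assumes "\<And>e. e > 0 \<Longrightarrow> \<exists>g M. g \<longlonglongrightarrow> M \<and> (\<forall>\<^sub>F n in sequentially. \<bar>f n - g n\<bar> \<le> e) \<and> \<bar>L - M\<bar> \<le> e"
  shows "f \<longlonglongrightarrow> L"
proof (rule tendstoI)
  fix e :: real assume "e > 0"
  then obtain g M where g: "g \<longlonglongrightarrow> M" "\<forall>\<^sub>F n in sequentially. \<bar>f n - g n\<bar> \<le> e/4" "\<bar>L - M\<bar> \<le> e/4"
    using assms[of "e/4"] by auto
  have "\<forall>\<^sub>F n in sequentially. dist (g n) M < e/4"
    using tendstoD[OF g(1), of "e/4"] \<open>e > 0\<close> by simp
  with g(2) show "\<forall>\<^sub>F n in sequentially. dist (f n) L < e"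
  proof eventually_elim
    case (elim n)
    then show ?case using g(3) \<open>e > 0\<close> unfolding dist_real_def by arith
  qed
qed

text \<open>The free weight replaces the Cauchy-Schwarz inequality for integrals, so that no square
  roots of integrals occur. With l = \<epsilon> it also yields part (i) of the theorem.\<close>

lemma AM_GM_weighted:
  fixes x y l :: real
  assumes "l > 0" shows "\<bar>x * y\<bar> \<le> (l * x\<^sup>2 + y\<^sup>2 / l) / 2"
proof -
  have "0 \<le> (l * \<bar>x\<bar> - \<bar>y\<bar>)\<^sup>2 / l" using assms by simp
  also have "\<dots> = l * x\<^sup>2 + y\<^sup>2 / l - 2 * \<bar>x * y\<bar>"
    using assms by (simp add: power2_eq_square field_simps abs_mult)
  finally show ?thesis by simp
qed

section \<open>Double integrals against a shrinking kernel\<close>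

locale mollifier =
  fixes k :: "real^'n \<Rightarrow> real"
  assumes cont: "continuous_on UNIV k" and nonneg: "k z \<ge> 0" and supp: "norm z \<ge> 1 \<Longrightarrow> k z = 0"
begin

text \<open>Kernels are not normalised, so this factor appears in every limit. Two kernels are
  needed, the bump and minus its radial derivative profile; positivity of the mass is shown for the
  bump.\<close>

definition mass :: real where "mass = (LINT z|lebesgue. k z)"

definition scaled :: "real \<Rightarrow> real^'n \<Rightarrow> real" where
  "scaled t z = k (z /\<^sub>R t) / t ^ CARD('n)"

lemma k_borel: "k \<in> borel_measurable borel"
  using cont by (rule borel_measurable_continuous_onI)

lemma k_bounded: "\<exists>B. \<forall>z. \<bar>k z\<bar> \<le> B"
proof -
  have "compact (k ` cball 0 1)"
    using cont by (intro compact_continuous_image) (auto intro: continuous_on_subset)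
  then obtain B where B: "\<And>z. z \<in> cball 0 1 \<Longrightarrow> \<bar>k z\<bar> \<le> B"
    by (force dest: compact_imp_bounded simp: bounded_iff)
  have "\<bar>k z\<bar> \<le> B" for z
    using B[of z] B[of 0] supp[of z] by (cases "norm z \<le> 1") auto
  then show ?thesis by blast
qed

lemma k_integrable: "integrable lborel k"
proof -
  obtain B where "\<forall>z. \<bar>k z\<bar> \<le> B" using k_bounded by blast
  then have "integrable lebesgue k"
    by (intro integrable_bounded_support[of k B 1] borel_measurable_lebesgueI k_borel) (auto simp: supp)
  then show ?thesis using k_borel by (simp add: integrable_completion)
qed

lemma mass_lborel: "mass = (LINT z|lborel. k z)"
  unfolding mass_def using k_borel by (simp add: integral_completion)

lemma mass_nonneg: "mass \<ge> 0"
  unfolding mass_def by (rule Bochner_Integration.integral_nonneg) (rule nonneg)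

lemma scaled_nonneg: "t > 0 \<Longrightarrow> scaled t z \<ge> 0"
  by (simp add: scaled_def nonneg)

lemma scaled_supp: "t > 0 \<Longrightarrow> norm z \<ge> t \<Longrightarrow> scaled t z = 0"
  by (simp add: scaled_def supp field_simps)

lemma scaled_continuous: "continuous_on UNIV (scaled t)"
  unfolding scaled_def divide_inverse
  by (intro continuous_intros continuous_on_compose2[OF cont]) auto

lemma scaled_borel: "scaled t \<in> borel_measurable borel"
  by (rule borel_measurable_continuous_onI) (rule scaled_continuous)

lemma scaled_translate:
  assumes "t > 0"
  shows "integrable lebesgue (\<lambda>y. scaled t (x - y))" "(LINT y|lebesgue. scaled t (x - y)) = mass"
    and "integrable lebesgue (\<lambda>y. scaled t (y - x))" "(LINT y|lebesgue. scaled t (y - x)) = mass"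
proof -
  have *: "(\<lambda>y. scaled t (x - y)) \<in> borel_measurable borel" "(\<lambda>y. scaled t (y - x)) \<in> borel_measurable borel"
    by (rule measurable_compose[OF _ scaled_borel], simp)+
  have eq: "scaled t (x - (x + (- t) *\<^sub>R z)) = k z / t ^ CARD('n)" 
    "scaled t (x + t *\<^sub>R z - x) = k z / t ^ CARD('n)" for z
    using assms by (simp_all add: scaled_def)
  have t: "-t \<noteq> 0" "t \<noteq> 0" using assms by auto
  show "integrable lebesgue (\<lambda>y. scaled t (x - y))"
    using lborel_integral_affine(1)[OF *(1) t(1), of x] k_integrable
    by (subst integrable_completion) (simp_all only: eq * measurable_lborel2, simp)
  show "(LINT y|lebesgue. scaled t (x - y)) = mass"
    using lborel_integral_affine(2)[OF *(1) t(1), of x] assms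
    by (subst integral_completion) (simp_all only: eq * measurable_lborel2, simp add: mass_lborel)
  show "integrable lebesgue (\<lambda>y. scaled t (y - x))"
    using lborel_integral_affine(1)[OF *(2) t(2), of x] k_integrable
    by (subst integrable_completion) (simp_all only: eq * measurable_lborel2, simp)
  show "(LINT y|lebesgue. scaled t (y - x)) = mass"
    using lborel_integral_affine(2)[OF *(2) t(2), of x] assms
    by (subst integral_completion) (simp_all only: eq * measurable_lborel2, simp add: mass_lborel)
qed

lemma pair_scaled_borel [measurable]:
  "(\<lambda>z. scaled t (fst z - snd z)) \<in> borel_measurable (lebesgue \<Otimes>\<^sub>M lebesgue)"
  by (rule borel_measurable_lebesgue_pair_diff) (rule scaled_borel)

lemma pair_fst_integrable:
  assumes t: "t > 0" and f: "integrable lebesgue f"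
  shows "integrable (lebesgue \<Otimes>\<^sub>M lebesgue) (\<lambda>z. f (fst z) * scaled t (fst z - snd z))"
    and "(LINT z|(lebesgue \<Otimes>\<^sub>M lebesgue). f (fst z) * scaled t (fst z - snd z)) = mass * (LINT x|lebesgue. f x)"
proof -
  have fm: "(\<lambda>z. f (fst z)) \<in> borel_measurable (lebesgue \<Otimes>\<^sub>M lebesgue)"
    using f by (intro measurable_compose[OF measurable_fst]) auto
  show *: "integrable (lebesgue \<Otimes>\<^sub>M lebesgue) (\<lambda>z. f (fst z) * scaled t (fst z - snd z))"
  proof (rule leb2.Fubini_integrable)
    show "(\<lambda>z. f (fst z) * scaled t (fst z - snd z)) \<in> borel_measurable (lebesgue \<Otimes>\<^sub>M lebesgue)"
      using fm by measurable
    have "(LINT y|lebesgue. norm (f x * scaled t (x - y))) = \<bar>f x\<bar> * mass" for x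
      using scaled_translate(2)[OF t, of x] scaled_nonneg[OF t] by (simp add: abs_mult)
    then show "integrable lebesgue (\<lambda>x. LINT y|lebesgue. norm (f (fst (x, y)) * scaled t (fst (x, y) - snd (x, y))))"
      using f by simp
    show "AE x in lebesgue. integrable lebesgue (\<lambda>y. f (fst (x, y)) * scaled t (fst (x, y) - snd (x, y)))"
      using scaled_translate(1)[OF t] by simp
  qed
  from leb2.integral_fst'[OF this] scaled_translate(2)[OF t]
  show "(LINT z|(lebesgue \<Otimes>\<^sub>M lebesgue). f (fst z) * scaled t (fst z - snd z)) = mass * (LINT x|lebesgue. f x)"
    by (simp add: mult.commute)
qed

lemma pair_snd_integrable:
  assumes t: "t > 0" and f: "integrable lebesgue f"
  shows "integrable (lebesgue \<Otimes>\<^sub>M lebesgue) (\<lambda>z. f (snd z) * scaled t (fst z - snd z))"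
    and "(LINT z|(lebesgue \<Otimes>\<^sub>M lebesgue). f (snd z) * scaled t (fst z - snd z)) = mass * (LINT x|lebesgue. f x)"
proof -
  have fm: "(\<lambda>z. f (fst z)) \<in> borel_measurable (lebesgue \<Otimes>\<^sub>M lebesgue)"
    using f by (intro measurable_compose[OF measurable_fst]) auto
  have m: "(\<lambda>z. scaled t (snd z - fst z)) \<in> borel_measurable (lebesgue \<Otimes>\<^sub>M lebesgue)"
    using borel_measurable_lebesgue_pair_diff[of "\<lambda>z. scaled t (- z)"]
      measurable_compose[OF _ scaled_borel, of uminus borel t] by simp
  \<comment> \<open>\<open>Fubini_integrable\<close> integrates the second variable first, so the
    variables are exchanged here and swapped back at the end.\<close>
  have *: "integrable (lebesgue \<Otimes>\<^sub>M lebesgue) (\<lambda>z. f (fst z) * scaled t (snd z - fst z))"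
  proof (rule leb2.Fubini_integrable)
    show "(\<lambda>z. f (fst z) * scaled t (snd z - fst z)) \<in> borel_measurable (lebesgue \<Otimes>\<^sub>M lebesgue)"
      using fm m by (rule borel_measurable_times)
    have "(LINT y|lebesgue. norm (f x * scaled t (y - x))) = \<bar>f x\<bar> * mass" for x
      using scaled_translate(4)[OF t, of x] scaled_nonneg[OF t] by (simp add: abs_mult)
    then show "integrable lebesgue (\<lambda>x. LINT y|lebesgue. norm (f (fst (x, y)) * scaled t (snd (x, y) - fst (x, y))))"
      using f by simp
    show "AE x in lebesgue. integrable lebesgue (\<lambda>y. f (fst (x, y)) * scaled t (snd (x, y) - fst (x, y)))"
      using scaled_translate(3)[OF t] by simp
  qed
  from leb2.integral_fst'[OF this] scaled_translate(4)[OF t]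
  have "(LINT z|(lebesgue \<Otimes>\<^sub>M lebesgue). f (fst z) * scaled t (snd z - fst z)) = mass * (LINT x|lebesgue. f x)"
    by (simp add: mult.commute)
  then show "(LINT z|(lebesgue \<Otimes>\<^sub>M lebesgue). f (snd z) * scaled t (fst z - snd z)) = mass * (LINT x|lebesgue. f x)"
    using * leb2.integral_product_swap[of "\<lambda>z. f (fst z) * scaled t (snd z - fst z)"]
    by (simp add: case_prod_unfold)
  show "integrable (lebesgue \<Otimes>\<^sub>M lebesgue) (\<lambda>z. f (snd z) * scaled t (fst z - snd z))"
    using leb2.integrable_product_swap[OF *] by (simp add: case_prod_unfold)
qed

text \<open>This is the pairing of a with the convolution of b and the scaled kernel, written over
  pairs: no regularity of the convolution enters, and either variable can be integrated
  first.\<close>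

definition bilin :: "real \<Rightarrow> (real^'n \<Rightarrow> real) \<Rightarrow> (real^'n \<Rightarrow> real) \<Rightarrow> real" where
  "bilin t a b = (LINT z|(lebesgue \<Otimes>\<^sub>M lebesgue). a (fst z) * b (snd z) * scaled t (fst z - snd z))"

lemma bilin_borel:
  assumes "a \<in> borel_measurable lebesgue" "b \<in> borel_measurable lebesgue"
  shows "(\<lambda>z. a (fst z) * b (snd z) * scaled t (fst z - snd z)) \<in> borel_measurable (lebesgue \<Otimes>\<^sub>M lebesgue)"
  by (intro borel_measurable_times pair_scaled_borel measurable_compose[OF measurable_fst assms(1)]
      measurable_compose[OF measurable_snd assms(2)])

text \<open>The point is that the bound does not depend on t and therefore survives the limit t ->
  0. The same holds for the L^2 version below.\<close>

lemma bilin_integrable_L1: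
  assumes t: "t > 0" and a: "a \<in> borel_measurable lebesgue" "\<And>x. \<bar>a x\<bar> \<le> A" and b: "integrable lebesgue b"
  shows "integrable (lebesgue \<Otimes>\<^sub>M lebesgue) (\<lambda>z. a (fst z) * b (snd z) * scaled t (fst z - snd z))"
    and "\<bar>bilin t a b\<bar> \<le> A * mass * (LINT x|lebesgue. \<bar>b x\<bar>)"
proof -
  have A: "A \<ge> 0" using a(2)[of 0] by simp
  have bd: "\<bar>a (fst z) * b (snd z) * scaled t (fst z - snd z)\<bar> \<le> A * (\<bar>b (snd z)\<bar> * scaled t (fst z - snd z))" for z
    using scaled_nonneg[OF t, of "fst z - snd z"] a(2)[of "fst z"]
    by (auto simp: abs_mult mult.assoc intro!: mult_right_mono)
  have i: "integrable (lebesgue \<Otimes>\<^sub>M lebesgue) (\<lambda>z. A * (\<bar>b (snd z)\<bar> * scaled t (fst z - snd z)))"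
    by (intro integrable_mult_right pair_snd_integrable[OF t] integrable_abs b)
  show *: "integrable (lebesgue \<Otimes>\<^sub>M lebesgue) (\<lambda>z. a (fst z) * b (snd z) * scaled t (fst z - snd z))"
    by (rule Bochner_Integration.integrable_bound[OF i bilin_borel])
      (use a b bd A scaled_nonneg[OF t] in \<open>auto simp: abs_mult\<close>)
  have "\<bar>bilin t a b\<bar> \<le> (LINT z|(lebesgue \<Otimes>\<^sub>M lebesgue). \<bar>a (fst z) * b (snd z) * scaled t (fst z - snd z)\<bar>)"
    unfolding bilin_def by (rule integral_abs_bound)
  also have "\<dots> \<le> (LINT z|(lebesgue \<Otimes>\<^sub>M lebesgue). A * (\<bar>b (snd z)\<bar> * scaled t (fst z - snd z)))"
    by (rule integral_mono) (use * i bd in auto)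
  also have "\<dots> = A * mass * (LINT x|lebesgue. \<bar>b x\<bar>)"
    using pair_snd_integrable(2)[OF t integrable_abs[OF b]] by simp
  finally show "\<bar>bilin t a b\<bar> \<le> A * mass * (LINT x|lebesgue. \<bar>b x\<bar>)" .
qed

lemma bilin_integrable_L2:
  assumes t: "t > 0" and a: "a \<in> borel_measurable lebesgue" "integrable lebesgue (\<lambda>x. (a x)\<^sup>2)"
    and b: "b \<in> borel_measurable lebesgue" "integrable lebesgue (\<lambda>x. (b x)\<^sup>2)" and l: "l > 0"
  shows "integrable (lebesgue \<Otimes>\<^sub>M lebesgue) (\<lambda>z. a (fst z) * b (snd z) * scaled t (fst z - snd z))"
    and "\<bar>bilin t a b\<bar> \<le> mass * (l * (LINT x|lebesgue. (a x)\<^sup>2) + (LINT x|lebesgue. (b x)\<^sup>2) / l) / 2"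
proof -
  let ?w = "\<lambda>z. (l/2) * ((a (fst z))\<^sup>2 * scaled t (fst z - snd z)) + (1/(2*l)) * ((b (snd z))\<^sup>2 * scaled t (fst z - snd z))"
  have bd: "\<bar>a (fst z) * b (snd z) * scaled t (fst z - snd z)\<bar> \<le> ?w z" for z
  proof -
    have "\<bar>a (fst z) * b (snd z) * scaled t (fst z - snd z)\<bar> = \<bar>a (fst z) * b (snd z)\<bar> * scaled t (fst z - snd z)"
      using scaled_nonneg[OF t, of "fst z - snd z"] by (simp add: abs_mult)
    also have "\<dots> \<le> ((l * (a (fst z))\<^sup>2 + (b (snd z))\<^sup>2 / l) / 2) * scaled t (fst z - snd z)"
      by (intro mult_right_mono AM_GM_weighted l scaled_nonneg t)
    also have "\<dots> = ?w z" using l by (simp add: field_simps)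
    finally show ?thesis .
  qed
  have i: "integrable (lebesgue \<Otimes>\<^sub>M lebesgue) ?w"
    by (intro Bochner_Integration.integrable_add integrable_mult_right pair_snd_integrable[OF t] pair_fst_integrable[OF t] a b)
  show *: "integrable (lebesgue \<Otimes>\<^sub>M lebesgue) (\<lambda>z. a (fst z) * b (snd z) * scaled t (fst z - snd z))"
    by (rule Bochner_Integration.integrable_bound[OF i bilin_borel])
      (use a b bd in \<open>auto intro!: AE_I2 bd[THEN order_trans]\<close>)
  have "\<bar>bilin t a b\<bar> \<le> (LINT z|(lebesgue \<Otimes>\<^sub>M lebesgue). \<bar>a (fst z) * b (snd z) * scaled t (fst z - snd z)\<bar>)"
    unfolding bilin_def by (rule integral_abs_bound)
  also have "\<dots> \<le> (LINT z|(lebesgue \<Otimes>\<^sub>M lebesgue). ?w z)"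
    by (rule integral_mono) (use * i bd in auto)
  also have "\<dots> = (l/2) * (mass * (LINT x|lebesgue. (a x)\<^sup>2)) + (1/(2*l)) * (mass * (LINT x|lebesgue. (b x)\<^sup>2))"
    by (subst Bochner_Integration.integral_add)
      (auto simp: pair_snd_integrable[OF t b(2)] pair_fst_integrable[OF t a(2)])
  also have "\<dots> = mass * (l * (LINT x|lebesgue. (a x)\<^sup>2) + (LINT x|lebesgue. (b x)\<^sup>2) / l) / 2"
    using l by (simp add: field_simps)
  finally show "\<bar>bilin t a b\<bar> \<le> mass * (l * (LINT x|lebesgue. (a x)\<^sup>2) + (LINT x|lebesgue. (b x)\<^sup>2) / l) / 2" .
qed

end

context mollifier
begin

lemma average_tendsto:
  assumes g: "continuous_on UNIV g" "\<And>x. \<bar>g x\<bar> \<le> B"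
    and t: "\<And>n. \<tau> n > 0" "\<tau> \<longlonglongrightarrow> 0"
  shows "(\<lambda>n. LINT y|lebesgue. g y * scaled (\<tau> n) (x - y)) \<longlonglongrightarrow> mass * g x"
proof (rule tendstoI)
  fix e :: real assume e: "e > 0"
  \<comment> \<open>The summand 1 is there because \<open>mass\<close> may be 0 for a general
    kernel.\<close>
  define d where "d = e / (mass + 1)"
  have "isCont g x" using g(1) by (simp add: continuous_on_eq_continuous_at)
  moreover have d: "d > 0" using e mass_nonneg by (simp add: d_def)
  ultimately obtain r where r: "r > 0" "\<And>y. dist y x < r \<Longrightarrow> dist (g y) (g x) < d"
    unfolding continuous_at_eps_delta by metis
  have gm: "g \<in> borel_measurable lebesgue"
    by (intro borel_measurable_lebesgueI borel_measurable_continuous_onI g)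
  have ig: "integrable lebesgue (\<lambda>y. g y * scaled (\<tau> n) (x - y))" for n
    by (rule integrable_cmult_bounded[OF scaled_translate(1)[OF t(1)] gm g(2)])
  have "\<forall>\<^sub>F n in sequentially. \<tau> n < r" using order_tendstoD(2)[OF t(2)] r by simp
  then show "\<forall>\<^sub>F n in sequentially. dist (LINT y|lebesgue. g y * scaled (\<tau> n) (x - y)) (mass * g x) < e"
  proof eventually_elim
    case (elim n)
    have i2: "integrable lebesgue (\<lambda>y. g x * scaled (\<tau> n) (x - y))"
      by (intro integrable_mult_right scaled_translate t)
    have "(LINT y|lebesgue. g y * scaled (\<tau> n) (x - y)) - mass * g x =
        (LINT y|lebesgue. g y * scaled (\<tau> n) (x - y) - g x * scaled (\<tau> n) (x - y))"
      using Bochner_Integration.integral_diff[OF ig[of n] i2] scaled_translate(2)[OF t(1)] by simp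
    also have "\<bar>\<dots>\<bar> \<le> (LINT y|lebesgue. \<bar>g y * scaled (\<tau> n) (x - y) - g x * scaled (\<tau> n) (x - y)\<bar>)"
      by (rule integral_abs_bound)
    also have "\<dots> \<le> (LINT y|lebesgue. d * scaled (\<tau> n) (x - y))"
    proof (rule integral_mono)
      fix y
      show "\<bar>g y * scaled (\<tau> n) (x - y) - g x * scaled (\<tau> n) (x - y)\<bar> \<le> d * scaled (\<tau> n) (x - y)"
      proof (cases "norm (x - y) < r")
        case True
        then have "\<bar>g y - g x\<bar> \<le> d" using r(2)[of y] by (simp add: dist_norm norm_minus_commute less_imp_le)
        then show ?thesis using scaled_nonneg[OF t(1), of n "x - y"]
          by (metis abs_mult abs_of_nonneg left_diff_distrib mult_right_mono)
      next
        case False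
        then show ?thesis using scaled_supp[OF t(1), of n "x - y"] elim by simp
      qed
    qed (use ig i2 scaled_translate(1)[OF t(1)] in auto)
    also have "\<dots> = d * mass" using scaled_translate(2)[OF t(1)] by simp
    also have "\<dots> < e" using e mass_nonneg by (simp add: d_def field_simps)
    finally show ?case by (simp add: dist_real_def)
  qed
qed

lemma bilin_iterated:
  assumes "integrable (lebesgue \<Otimes>\<^sub>M lebesgue) (\<lambda>z. a (fst z) * b (snd z) * scaled t (fst z - snd z))"
  shows "bilin t a b = (LINT x|lebesgue. a x * (LINT y|lebesgue. b y * scaled t (x - y)))"
    and "bilin t a b = (LINT y|lebesgue. b y * (LINT x|lebesgue. a x * scaled t (x - y)))"
proof -
  show "bilin t a b = (LINT x|lebesgue. a x * (LINT y|lebesgue. b y * scaled t (x - y)))"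
    unfolding bilin_def leb2.integral_fst'[OF assms, symmetric] by (simp add: mult.assoc)
  have "bilin t a b = (LINT y|lebesgue. LINT x|lebesgue. a x * b y * scaled t (x - y))"
    using leb2.integral_snd[of "\<lambda>x y. a x * b y * scaled t (x - y)"] assms
    by (simp add: bilin_def case_prod_unfold)
  also have "\<dots> = (LINT y|lebesgue. b y * (LINT x|lebesgue. a x * scaled t (x - y)))"
    by (intro Bochner_Integration.integral_cong refl, subst integral_mult_right_zero[symmetric])
       (simp add: ac_simps)
  finally show "bilin t a b = (LINT y|lebesgue. b y * (LINT x|lebesgue. a x * scaled t (x - y)))" .
qed

lemma bilin_tendsto_continuous:
  assumes a: "integrable lebesgue a" "\<And>x. \<bar>a x\<bar> \<le> A"
    and g: "continuous_on UNIV g" "\<And>x. \<bar>g x\<bar> \<le> B" "integrable lebesgue g"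
    and t: "\<And>n. \<tau> n > 0" "\<tau> \<longlonglongrightarrow> 0"
  shows "(\<lambda>n. bilin (\<tau> n) a g) \<longlonglongrightarrow> mass * (LINT x|lebesgue. a x * g x)"
proof -
  have pi: "integrable (lebesgue \<Otimes>\<^sub>M lebesgue) (\<lambda>z. a (fst z) * g (snd z) * scaled (\<tau> n) (fst z - snd z))" for n
    using bilin_integrable_L1(1)[OF t(1) borel_measurable_integrable[OF a(1)] a(2) g(3)] .
  have "(\<lambda>n. LINT x|lebesgue. a x * (LINT y|lebesgue. g y * scaled (\<tau> n) (x - y)))
      \<longlonglongrightarrow> (LINT x|lebesgue. a x * (mass * g x))"
  proof (rule integral_dominated_convergence[where w="\<lambda>x. (B * mass) * \<bar>a x\<bar>"])
    show "AE x in lebesgue. (\<lambda>n. a x * (LINT y|lebesgue. g y * scaled (\<tau> n) (x - y))) \<longlonglongrightarrow> a x * (mass * g x)"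
      by (intro AE_I2 tendsto_mult tendsto_const average_tendsto[OF g(1,2) t])
    show "AE x in lebesgue. norm (a x * (LINT y|lebesgue. g y * scaled (\<tau> n) (x - y))) \<le> B * mass * \<bar>a x\<bar>" for n
    proof (rule AE_I2)
      fix x
      have "\<bar>LINT y|lebesgue. g y * scaled (\<tau> n) (x - y)\<bar> \<le> (LINT y|lebesgue. \<bar>g y * scaled (\<tau> n) (x - y)\<bar>)"
        by (rule integral_abs_bound)
      also have "\<dots> \<le> (LINT y|lebesgue. B * scaled (\<tau> n) (x - y))"
      proof (rule integral_mono)
        show "integrable lebesgue (\<lambda>y. \<bar>g y * scaled (\<tau> n) (x - y)\<bar>)"
          by (intro integrable_abs integrable_cmult_bounded[OF scaled_translate(1)[OF t(1)] borel_measurable_integrable[OF g(3)] g(2)])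
      qed (use scaled_nonneg[OF t(1)] g(2) scaled_translate(1)[OF t(1)] in \<open>auto simp: abs_mult mult_right_mono\<close>)
      also have "\<dots> = B * mass" using scaled_translate(2)[OF t(1)] by simp
      finally show "norm (a x * (LINT y|lebesgue. g y * scaled (\<tau> n) (x - y))) \<le> B * mass * \<bar>a x\<bar>"
        by (simp add: abs_mult mult.commute mult_left_mono)
    qed
    show "(\<lambda>x. a x * (mass * g x)) \<in> borel_measurable lebesgue" using a g by auto
    show "(\<lambda>x. a x * (LINT y|lebesgue. g y * scaled (\<tau> n) (x - y))) \<in> borel_measurable lebesgue" for n
      using leb2.integrable_fst'[OF pi[of n]] by (auto simp: mult.assoc)
  qed (use a in auto)
  then show ?thesis
    using bilin_iterated(1)[OF pi] by (simp add: mult.left_commute)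
qed

lemma bilin_diff_right:
  assumes "integrable (lebesgue \<Otimes>\<^sub>M lebesgue) (\<lambda>z. a (fst z) * b (snd z) * scaled t (fst z - snd z))"
    "integrable (lebesgue \<Otimes>\<^sub>M lebesgue) (\<lambda>z. a (fst z) * c (snd z) * scaled t (fst z - snd z))"
  shows "bilin t a (\<lambda>x. b x - c x) = bilin t a b - bilin t a c"
  unfolding bilin_def Bochner_Integration.integral_diff[OF assms, symmetric]
  by (simp add: algebra_simps)

lemma bilin_diff_left:
  assumes "integrable (lebesgue \<Otimes>\<^sub>M lebesgue) (\<lambda>z. a (fst z) * b (snd z) * scaled t (fst z - snd z))"
    "integrable (lebesgue \<Otimes>\<^sub>M lebesgue) (\<lambda>z. c (fst z) * b (snd z) * scaled t (fst z - snd z))"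
  shows "bilin t (\<lambda>x. a x - c x) b = bilin t a b - bilin t c b"
  unfolding bilin_def Bochner_Integration.integral_diff[OF assms, symmetric]
  by (simp add: algebra_simps)

text \<open>Only b is approximated, in L^1 by a bounded continuous function. The factor a is merely
  bounded and stays as it is; the bound uniform in t controls the difference.\<close>

lemma bilin_tendsto_L1:
  assumes a: "integrable lebesgue a" "\<And>x. \<bar>a x\<bar> \<le> A" and b: "integrable lebesgue b"
    and t: "\<And>n. \<tau> n > 0" "\<tau> \<longlonglongrightarrow> 0"
  shows "(\<lambda>n. bilin (\<tau> n) a b) \<longlonglongrightarrow> mass * (LINT x|lebesgue. a x * b x)"
proof (rule tendsto_of_approx)
  fix e :: real assume e: "e > 0"
  have A: "A \<ge> 0" using a(2)[of 0] by simp
  define d where "d = e / (A * mass + 1)"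
  have d: "d > 0" "A * mass * d \<le> e"
  proof -
    have "A * mass \<ge> 0" using A mass_nonneg by simp
    then show "d > 0" "A * mass * d \<le> e" using e by (auto simp: d_def field_simps)
  qed
  obtain g B where g: "continuous_on UNIV g" "\<And>x. \<bar>g x\<bar> \<le> B" "integrable lebesgue g"
    "(LINT x|lebesgue. \<bar>b x - g x\<bar>) < d"
    using integrable_continuous_approx[OF b] d by blast
  have am: "a \<in> borel_measurable lebesgue" using a by auto
  have small: "A * mass * (LINT x|lebesgue. \<bar>b x - g x\<bar>) \<le> e"
  proof -
    have "A * mass * (LINT x|lebesgue. \<bar>b x - g x\<bar>) \<le> A * mass * d"
      using g(4) A mass_nonneg by (intro mult_left_mono) auto
    then show ?thesis using d(2) by simp
  qed
  have "\<bar>bilin (\<tau> n) a b - bilin (\<tau> n) a g\<bar> \<le> e" for n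
  proof -
    have "bilin (\<tau> n) a b - bilin (\<tau> n) a g = bilin (\<tau> n) a (\<lambda>x. b x - g x)"
      using bilin_diff_right bilin_integrable_L1(1)[OF t(1) am a(2)] b g(3) by simp
    also have "\<bar>\<dots>\<bar> \<le> A * mass * (LINT x|lebesgue. \<bar>b x - g x\<bar>)"
      using bilin_integrable_L1(2)[OF t(1) am a(2) Bochner_Integration.integrable_diff[OF b g(3)]] .
    finally show ?thesis using small by simp
  qed
  moreover have "\<bar>mass * (LINT x|lebesgue. a x * b x) - mass * (LINT x|lebesgue. a x * g x)\<bar> \<le> e"
  proof -
    have iab: "integrable lebesgue (\<lambda>x. a x * b x)" by (rule integrable_cmult_bounded[OF b am a(2)])
    have iag: "integrable lebesgue (\<lambda>x. a x * g x)" by (rule integrable_cmult_bounded[OF g(3) am a(2)])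
    have "\<bar>(LINT x|lebesgue. a x * b x) - (LINT x|lebesgue. a x * g x)\<bar> = \<bar>LINT x|lebesgue. a x * b x - a x * g x\<bar>"
      by (simp add: Bochner_Integration.integral_diff[OF iab iag])
    also have "\<dots> \<le> (LINT x|lebesgue. \<bar>a x * b x - a x * g x\<bar>)" by (rule integral_abs_bound)
    also have "\<dots> \<le> (LINT x|lebesgue. A * \<bar>b x - g x\<bar>)"
    proof (rule integral_mono)
      fix x show "\<bar>a x * b x - a x * g x\<bar> \<le> A * \<bar>b x - g x\<bar>"
        using a(2)[of x] by (simp add: abs_mult mult_right_mono flip: right_diff_distrib)
    qed (use iab iag b g in auto)
    finally have "mass * \<bar>(LINT x|lebesgue. a x * b x) - (LINT x|lebesgue. a x * g x)\<bar> \<le> mass * (A * (LINT x|lebesgue. \<bar>b x - g x\<bar>))"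
      using mass_nonneg by (simp add: mult_left_mono)
    also have "\<dots> \<le> e" using small by (simp add: mult_ac)
    finally show ?thesis using mass_nonneg by (simp add: abs_mult flip: right_diff_distrib)
  qed
  ultimately show "\<exists>h M. h \<longlonglongrightarrow> M \<and> (\<forall>\<^sub>F n in sequentially. \<bar>bilin (\<tau> n) a b - h n\<bar> \<le> e) \<and>
      \<bar>mass * (LINT x|lebesgue. a x * b x) - M\<bar> \<le> e"
    using bilin_tendsto_continuous[OF a g(1-3) t]
    by (intro exI[of _ "\<lambda>n. bilin (\<tau> n) a g"] exI conjI always_eventually) auto
qed

end

text \<open>Cutting off both the values and the support makes an L^2 function bounded and
  integrable, which is what \<open>bilin_tendsto_L1\<close> asks for.\<close>

lemma truncation_L2:
  fixes a :: "'a::euclidean_space \<Rightarrow> real"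
  assumes a: "a \<in> borel_measurable lebesgue" "integrable lebesgue (\<lambda>x. (a x)\<^sup>2)" and e: "e > 0"
  obtains a' B where "a' \<in> borel_measurable lebesgue" "\<And>x. \<bar>a' x\<bar> \<le> B" "integrable lebesgue a'"
    "integrable lebesgue (\<lambda>x. (a' x)\<^sup>2)" "(LINT x|lebesgue. (a' x)\<^sup>2) \<le> (LINT x|lebesgue. (a x)\<^sup>2)"
    "integrable lebesgue (\<lambda>x. (a x - a' x)\<^sup>2)" "(LINT x|lebesgue. (a x - a' x)\<^sup>2) < e"
proof -
  define S where "S n = {x. \<bar>a x\<bar> \<le> real n} \<inter> cball 0 (real n)" for n
  have "{x \<in> space lebesgue. \<bar>a x\<bar> \<le> real n} \<in> sets lebesgue" for n using a(1) by measurable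
  then have S: "S n \<in> sets lebesgue" for n unfolding S_def by auto
  define c where "c n x = indicator (S n) x * a x" for n x
  have cm: "c n \<in> borel_measurable lebesgue" for n
    unfolding c_def using a S[of n] by measurable
  have "(\<lambda>n. LINT x|lebesgue. (a x - c n x)\<^sup>2) \<longlonglongrightarrow> (LINT x|(lebesgue :: 'a measure). (0::real))"
  proof (rule integral_dominated_convergence[where w="\<lambda>x. (a x)\<^sup>2"])
    show "AE x in lebesgue. (\<lambda>n. (a x - c n x)\<^sup>2) \<longlonglongrightarrow> 0"
    proof (rule AE_I2)
      fix x
      obtain N where N: "max \<bar>a x\<bar> (norm x) \<le> real N" using real_arch_simple by blast
      have "\<forall>\<^sub>F n in sequentially. (a x - c n x)\<^sup>2 = 0"
        using eventually_ge_at_top[of N]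
      proof eventually_elim
        case (elim n)
        then have "x \<in> S n" using N by (auto simp: S_def intro: order_trans)
        then show ?case by (simp add: c_def)
      qed
      then show "(\<lambda>n. (a x - c n x)\<^sup>2) \<longlonglongrightarrow> 0" by (rule tendsto_eventually)
    qed
    show "AE x in lebesgue. norm ((a x - c n x)\<^sup>2) \<le> (a x)\<^sup>2" for n
      by (rule AE_I2) (simp add: c_def indicator_def)
  qed (use a cm in auto)
  then have "\<forall>\<^sub>F n in sequentially. (LINT x|lebesgue. (a x - c n x)\<^sup>2) < e"
    using order_tendstoD(2)[of _ 0 sequentially e] e by simp
  then obtain n where n: "(LINT x|lebesgue. (a x - c n x)\<^sup>2) < e" by (auto simp: eventually_sequentially)
  have c: "\<bar>c n x\<bar> \<le> real n" "norm x > real n \<Longrightarrow> c n x = 0" for x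
    by (auto simp: c_def S_def indicator_def)
  have i2: "integrable lebesgue (\<lambda>x. (c n x)\<^sup>2)"
  proof (rule Bochner_Integration.integrable_bound[OF a(2)])
    show "AE x in lebesgue. norm ((c n x)\<^sup>2) \<le> norm ((a x)\<^sup>2)"
      by (rule AE_I2) (simp add: c_def indicator_def)
  qed (use cm[of n] in measurable)
  show ?thesis
  proof (rule that[of "c n" "real n"])
    show "integrable lebesgue (c n)" by (rule integrable_bounded_support[OF cm c])
    show "(LINT x|lebesgue. (c n x)\<^sup>2) \<le> (LINT x|lebesgue. (a x)\<^sup>2)"
      by (rule integral_mono[OF i2 a(2)]) (simp add: c_def indicator_def)
    show "integrable lebesgue (\<lambda>x. (a x - c n x)\<^sup>2)"
    proof (rule Bochner_Integration.integrable_bound[OF a(2)])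
      show "AE x in lebesgue. norm ((a x - c n x)\<^sup>2) \<le> norm ((a x)\<^sup>2)"
        by (rule AE_I2) (simp add: c_def indicator_def)
    qed (use cm[of n] a(1) in measurable)
  qed (use cm c i2 n in auto)
qed

lemma integrable_mult_L2:
  fixes a b :: "_ \<Rightarrow> real"
  assumes a: "a \<in> borel_measurable M" "integrable M (\<lambda>x. (a x)\<^sup>2)"
    and b: "b \<in> borel_measurable M" "integrable M (\<lambda>x. (b x)\<^sup>2)" and l: "l > 0"
  shows "integrable M (\<lambda>x. a x * b x)"
    and "\<bar>LINT x|M. a x * b x\<bar> \<le> (l * (LINT x|M. (a x)\<^sup>2) + (LINT x|M. (b x)\<^sup>2) / l) / 2"
proof -
  have bd: "\<bar>a x * b x\<bar> \<le> (l * (a x)\<^sup>2 + (b x)\<^sup>2 / l) / 2" for x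
    by (rule AM_GM_weighted[OF l])
  have i: "integrable M (\<lambda>x. (l * (a x)\<^sup>2 + (b x)\<^sup>2 / l) / 2)"
    using a b by auto
  show *: "integrable M (\<lambda>x. a x * b x)"
    by (rule Bochner_Integration.integrable_bound[OF i])
      (use a b in \<open>auto intro!: AE_I2 order_trans[OF bd abs_ge_self] simp del: abs_divide\<close>)
  have "\<bar>LINT x|M. a x * b x\<bar> \<le> (LINT x|M. \<bar>a x * b x\<bar>)" by (rule integral_abs_bound)
  also have "\<dots> \<le> (LINT x|M. (l * (a x)\<^sup>2 + (b x)\<^sup>2 / l) / 2)"
    by (rule integral_mono) (use * i bd in auto)
  also have "\<dots> = (l * (LINT x|M. (a x)\<^sup>2) + (LINT x|M. (b x)\<^sup>2) / l) / 2"
    using a b by simp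
  finally show "\<bar>LINT x|M. a x * b x\<bar> \<le> (l * (LINT x|M. (a x)\<^sup>2) + (LINT x|M. (b x)\<^sup>2) / l) / 2" .
qed

text \<open>The factors are truncated one after the other. Each time the weight in the
  arithmetic-geometric mean is adapted to the factor that has become small.\<close>

lemma (in mollifier) bilin_tendsto_L2:
  assumes a: "a \<in> borel_measurable lebesgue" "integrable lebesgue (\<lambda>x. (a x)\<^sup>2)"
    and b: "b \<in> borel_measurable lebesgue" "integrable lebesgue (\<lambda>x. (b x)\<^sup>2)"
    and t: "\<And>n. \<tau> n > 0" "\<tau> \<longlonglongrightarrow> 0"
  shows "(\<lambda>n. bilin (\<tau> n) a b) \<longlonglongrightarrow> mass * (LINT x|lebesgue. a x * b x)"
proof (rule tendsto_of_approx)
  fix e :: real assume e: "e > 0"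
  let ?q = "\<lambda>f. LINT x|lebesgue. (f x)\<^sup>2"
  define d where "d = e / (mass * (2 + ?q a + ?q b) + 1)"
  have qn: "?q a \<ge> 0" "?q b \<ge> 0" by simp_all
  have d: "d > 0" "mass * d * (2 + ?q a + ?q b) / 2 \<le> e"
  proof -
    have "mass * (2 + ?q a + ?q b) \<ge> 0" using qn mass_nonneg by simp
    then have "d > 0" "mass * (2 + ?q a + ?q b) * d \<le> e" using e by (auto simp: d_def field_simps)
    then show "d > 0" "mass * d * (2 + ?q a + ?q b) / 2 \<le> e" using e by (auto simp: ac_simps)
  qed
  obtain a' A where a': "a' \<in> borel_measurable lebesgue" "\<And>x. \<bar>a' x\<bar> \<le> A" "integrable lebesgue a'"
    "integrable lebesgue (\<lambda>x. (a' x)\<^sup>2)" "?q a' \<le> ?q a"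
    "integrable lebesgue (\<lambda>x. (a x - a' x)\<^sup>2)" "?q (\<lambda>x. a x - a' x) < d\<^sup>2"
    using truncation_L2[OF a, of "d\<^sup>2"] d by auto
  obtain b' B where b': "b' \<in> borel_measurable lebesgue" "\<And>x. \<bar>b' x\<bar> \<le> B" "integrable lebesgue b'"
    "integrable lebesgue (\<lambda>x. (b' x)\<^sup>2)" "?q b' \<le> ?q b"
    "integrable lebesgue (\<lambda>x. (b x - b' x)\<^sup>2)" "?q (\<lambda>x. b x - b' x) < d\<^sup>2"
    using truncation_L2[OF b, of "d\<^sup>2"] d by auto
  have ab'm: "(\<lambda>x. a x - a' x) \<in> borel_measurable lebesgue" "(\<lambda>x. b x - b' x) \<in> borel_measurable lebesgue"
    using a b a' b' by auto
  \<comment> \<open>The truncation error has squared norm below d^2. With weight 1/d it contributes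
    d, and the other factor is multiplied by d; the next estimate does the same with the roles
    exchanged.\<close>
  have l1: "(1/d) * ?q (\<lambda>x. a x - a' x) + ?q b / (1/d) \<le> d * (1 + ?q b)"
  proof -
    have "(1/d) * ?q (\<lambda>x. a x - a' x) \<le> (1/d) * d\<^sup>2" using a'(7) d by (intro mult_left_mono) auto
    then show ?thesis using d by (simp add: power2_eq_square algebra_simps)
  qed
  have l2: "d * ?q a' + ?q (\<lambda>x. b x - b' x) / d \<le> d * (1 + ?q a)"
  proof -
    have "?q (\<lambda>x. b x - b' x) / d \<le> d\<^sup>2 / d" using b'(7) d by (intro divide_right_mono) auto
    moreover have "d * ?q a' \<le> d * ?q a" using a'(5) d by simp
    moreover have "d\<^sup>2 / d = d" using d by (simp add: power2_eq_square)
    ultimately show ?thesis by (simp only: distrib_left mult_1_right)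
  qed
  have bound: "mass * ((1/d) * ?q (\<lambda>x. a x - a' x) + ?q b / (1/d)) / 2 + mass * (d * ?q a' + ?q (\<lambda>x. b x - b' x) / d) / 2 \<le> e"
  proof -
    have "mass * ((1/d) * ?q (\<lambda>x. a x - a' x) + ?q b / (1/d)) / 2 + mass * (d * ?q a' + ?q (\<lambda>x. b x - b' x) / d) / 2
       \<le> mass * (d * (1 + ?q b)) / 2 + mass * (d * (1 + ?q a)) / 2"
      using l1 l2 mass_nonneg by (intro add_mono divide_right_mono mult_left_mono) auto
    also have "\<dots> = mass * d * (2 + ?q a + ?q b) / 2" by (simp add: field_simps)
    also note d(2)
    finally show ?thesis .
  qed
  have "1 / d > 0" using d by simp
  have "\<bar>bilin (\<tau> n) a b - bilin (\<tau> n) a' b'\<bar> \<le> e" for n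
  proof -
    have 1: "bilin (\<tau> n) (\<lambda>x. a x - a' x) b = bilin (\<tau> n) a b - bilin (\<tau> n) a' b"
      using bilin_diff_left bilin_integrable_L2(1)[OF t(1) a b d(1)]
        bilin_integrable_L2(1)[OF t(1) a'(1,4) b d(1)] by blast
    have 2: "bilin (\<tau> n) a' (\<lambda>x. b x - b' x) = bilin (\<tau> n) a' b - bilin (\<tau> n) a' b'"
      using bilin_diff_right bilin_integrable_L2(1)[OF t(1) a'(1,4) b d(1)]
        bilin_integrable_L2(1)[OF t(1) a'(1,4) b'(1,4) d(1)] by blast
    have "\<bar>bilin (\<tau> n) (\<lambda>x. a x - a' x) b\<bar> + \<bar>bilin (\<tau> n) a' (\<lambda>x. b x - b' x)\<bar> \<le> e"
      using bilin_integrable_L2(2)[OF t(1)[of n] ab'm(1) a'(6) b \<open>1 / d > 0\<close>]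
        bilin_integrable_L2(2)[OF t(1)[of n] a'(1,4) ab'm(2) b'(6) d(1)] bound by linarith
    then show ?thesis using 1 2 by linarith
  qed
  moreover have "\<bar>mass * (LINT x|lebesgue. a x * b x) - mass * (LINT x|lebesgue. a' x * b' x)\<bar> \<le> e"
  proof -
    note i = integrable_mult_L2(1)[OF a b d(1)] integrable_mult_L2(1)[OF a'(1,4) b d(1)]
       integrable_mult_L2(1)[OF a'(1,4) b'(1,4) d(1)]
    have 1: "(LINT x|lebesgue. (a x - a' x) * b x) = (LINT x|lebesgue. a x * b x) - (LINT x|lebesgue. a' x * b x)"
      by (simp add: left_diff_distrib Bochner_Integration.integral_diff[OF i(1,2)])
    have 2: "(LINT x|lebesgue. a' x * (b x - b' x)) = (LINT x|lebesgue. a' x * b x) - (LINT x|lebesgue. a' x * b' x)"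
      by (simp add: right_diff_distrib Bochner_Integration.integral_diff[OF i(2,3)])
    have 3: "mass * \<bar>LINT x|lebesgue. (a x - a' x) * b x\<bar> \<le> mass * (((1/d) * ?q (\<lambda>x. a x - a' x) + ?q b / (1/d)) / 2)"
      using integrable_mult_L2(2)[OF ab'm(1) a'(6) b \<open>1 / d > 0\<close>] mass_nonneg by (intro mult_left_mono)
    have 4: "mass * \<bar>LINT x|lebesgue. a' x * (b x - b' x)\<bar> \<le> mass * ((d * ?q a' + ?q (\<lambda>x. b x - b' x) / d) / 2)"
      using integrable_mult_L2(2)[OF a'(1,4) ab'm(2) b'(6) d(1)] mass_nonneg by (intro mult_left_mono)
    have "\<bar>mass * (LINT x|lebesgue. a x * b x) - mass * (LINT x|lebesgue. a' x * b' x)\<bar>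
        = \<bar>mass * (LINT x|lebesgue. (a x - a' x) * b x) + mass * (LINT x|lebesgue. a' x * (b x - b' x))\<bar>"
      unfolding 1 2 by (simp add: algebra_simps)
    also have "\<dots> \<le> mass * \<bar>LINT x|lebesgue. (a x - a' x) * b x\<bar> + mass * \<bar>LINT x|lebesgue. a' x * (b x - b' x)\<bar>"
      using mass_nonneg by (intro order_trans[OF abs_triangle_ineq]) (simp add: abs_mult)
    finally show ?thesis using 3 4 bound unfolding times_divide_eq_right by linarith
  qed
  ultimately show "\<exists>h M. h \<longlonglongrightarrow> M \<and> (\<forall>\<^sub>F n in sequentially. \<bar>bilin (\<tau> n) a b - h n\<bar> \<le> e) \<and>
      \<bar>mass * (LINT x|lebesgue. a x * b x) - M\<bar> \<le> e"
    using bilin_tendsto_L1[OF a'(3,2) b'(3) t]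
    by (intro exI[of _ "\<lambda>n. bilin (\<tau> n) a' b'"] exI conjI always_eventually) auto
qed

section \<open>Integrals over pairs and differentiation under the integral\<close>

lemma integrable_pair_mult:
  fixes a b :: "'a::euclidean_space \<Rightarrow> real"
  assumes a: "integrable lebesgue a" and b: "integrable lebesgue b"
  shows "integrable (lebesgue \<Otimes>\<^sub>M lebesgue) (\<lambda>z. a (fst z) * b (snd z))"
proof (rule leb2.Fubini_integrable)
  show "(\<lambda>z. a (fst z) * b (snd z)) \<in> borel_measurable (lebesgue \<Otimes>\<^sub>M lebesgue)"
    using a b by (intro borel_measurable_times measurable_compose[OF measurable_fst] measurable_compose[OF measurable_snd]) auto
qed (use a b in \<open>auto simp: abs_mult\<close>)

lemma DERIV_parametric_integral:
  fixes f :: "real \<Rightarrow> 'a \<Rightarrow> real"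
  assumes t: "r < t" "t < s"
    and int: "\<And>u. r < u \<Longrightarrow> u < s \<Longrightarrow> integrable M (f u)"
    and der: "\<And>u x. r < u \<Longrightarrow> u < s \<Longrightarrow> ((\<lambda>u. f u x) has_real_derivative f' u x) (at u)"
    and bd: "\<And>u x. r < u \<Longrightarrow> u < s \<Longrightarrow> \<bar>f' u x\<bar> \<le> w x"
    and w: "integrable M w" and m: "f' t \<in> borel_measurable M"
  shows "((\<lambda>u. LINT x|M. f u x) has_real_derivative (LINT x|M. f' t x)) (at t)"
  unfolding DERIV_def
proof (subst tendsto_at_iff_sequentially, intro allI impI)
  fix X :: "nat \<Rightarrow> real" assume X: "\<forall>i. X i \<in> UNIV - {0}" "X \<longlonglongrightarrow> 0"
  \<comment> \<open>The default value \<open>f' t x\<close> outside the interval makes domination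
    and measurability hold for every n and not only eventually. Inside, the mean value inequality
    bounds the quotient by w.\<close>
  define q where "q n x = (if r < t + X n \<and> t + X n < s then (f (t + X n) x - f t x) / X n else f' t x)" for n x
  have X0: "X i \<noteq> 0" for i using X by auto
  have ev: "\<forall>\<^sub>F n in sequentially. r < t + X n \<and> t + X n < s"
  proof -
    have "(\<lambda>n. t + X n) \<longlonglongrightarrow> t + 0" by (intro tendsto_intros X)
    then show ?thesis
      using order_tendstoD[of "\<lambda>n. t + X n" t sequentially] t by (simp add: eventually_conj_iff)
  qed
  have bq: "\<bar>q n x\<bar> \<le> w x" for n x
  proof (cases "r < t + X n \<and> t + X n < s")
    case True
    have "\<bar>f (t + X n) x - f t x\<bar> \<le> w x * \<bar>t + X n - t\<bar>"
    proof (rule field_differentiable_bound[where S="{r<..<s}" and f="\<lambda>u. f u x" and f'="\<lambda>u. f' u x", simplified real_norm_def])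
      show "convex {r<..<s}" by simp
      show "((\<lambda>u. f u x) has_field_derivative f' z x) (at z within {r<..<s})" if "z \<in> {r<..<s}" for z
        using der that by (auto intro: has_field_derivative_at_within)
    qed (use True t bd in auto)
    then show ?thesis using True X0[of n] by (simp add: q_def divide_le_eq)
  next
    case False then show ?thesis using bd t by (auto simp: q_def)
  qed
  have "(\<lambda>n. LINT x|M. q n x) \<longlonglongrightarrow> (LINT x|M. f' t x)"
  proof (rule integral_dominated_convergence[where w=w])
    show "AE x in M. (\<lambda>n. q n x) \<longlonglongrightarrow> f' t x"
    proof (rule AE_I2)
      fix x
      have "((\<lambda>h. (f (t + h) x - f t x) / h) \<longlongrightarrow> f' t x) (at 0)"
        using der[OF t, of x] by (simp add: DERIV_def)
      then have "(\<lambda>n. (f (t + X n) x - f t x) / X n) \<longlonglongrightarrow> f' t x"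
        using X by (auto simp: tendsto_at_iff_sequentially comp_def)
      moreover have "\<forall>\<^sub>F n in sequentially. (f (t + X n) x - f t x) / X n = q n x"
        using ev by eventually_elim (simp add: q_def)
      ultimately show "(\<lambda>n. q n x) \<longlonglongrightarrow> f' t x" by (rule Lim_transform_eventually)
    qed
    show "q n \<in> borel_measurable M" for n
    proof (cases "r < t + X n \<and> t + X n < s")
      case True
      then show ?thesis unfolding q_def using borel_measurable_integrable[OF int[of "t + X n"]]
        borel_measurable_integrable[OF int[OF t]] by simp
    next
      case False
      then have "q n = f' t" by (intro ext) (simp only: q_def if_False)
      then show ?thesis using m by (simp only:)
    qed
  qed (use m w bq in auto)
  moreover have "\<forall>\<^sub>F n in sequentially. (LINT x|M. q n x) =
      ((\<lambda>h. ((LINT x|M. f (t + h) x) - (LINT x|M. f t x)) / h) \<circ> X) n"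
    using ev
  proof eventually_elim
    case (elim n)
    have "(LINT x|M. q n x) = (LINT x|M. (f (t + X n) x - f t x) / X n)"
      using elim by (simp add: q_def)
    also have "\<dots> = ((LINT x|M. f (t + X n) x) - (LINT x|M. f t x)) / X n"
      using Bochner_Integration.integral_diff[OF int[of "t + X n"] int[OF t]] elim by simp
    finally show ?case by simp
  qed
  ultimately show "((\<lambda>h. ((LINT x|M. f (t + h) x) - (LINT x|M. f t x)) / h) \<circ> X) \<longlonglongrightarrow> (LINT x|M. f' t x)"
    by (rule Lim_transform_eventually)
qed

section \<open>Local integrability and bump kernels\<close>

lemma L1_loc_cball:
  fixes f :: "real^'n \<Rightarrow> 'b::euclidean_space"
  assumes "f \<in> L1_loc" shows "integrable lebesgue (\<lambda>x. indicator (cball 0 R) x *\<^sub>R f x)"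
  using assms unfolding L1_loc_def set_integrable_def by auto

lemma L1_loc_borel:
  fixes f :: "real^'n \<Rightarrow> 'b::euclidean_space"
  assumes "f \<in> L1_loc" shows "f \<in> borel_measurable lebesgue"
proof (rule borel_measurable_LIMSEQ_metric)
  show "(\<lambda>x. indicator (cball 0 (real n)) x *\<^sub>R f x) \<in> borel_measurable lebesgue" for n
    using L1_loc_cball[OF assms] by auto
  fix x :: "real^'n"
  obtain N where N: "norm x \<le> real N" using real_arch_simple by blast
  have "\<forall>\<^sub>F n in sequentially. indicator (cball 0 (real n)) x *\<^sub>R f x = f x"
    using eventually_ge_at_top[of N] by eventually_elim (use N in \<open>auto simp: indicator_def\<close>)
  then show "(\<lambda>n. indicator (cball 0 (real n)) x *\<^sub>R f x) \<longlonglongrightarrow> f x" by (rule tendsto_eventually)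
qed

lemma L1_loc_mult_integrable:
  assumes f: "f \<in> L1_loc" and h: "h \<in> borel_measurable lebesgue" "\<And>x. \<bar>h x\<bar> \<le> B" "\<And>x. norm x > R \<Longrightarrow> h x = 0"
  shows "integrable lebesgue (\<lambda>x. f x * h x :: real)"
proof -
  have "integrable lebesgue (\<lambda>x. h x * (indicator (cball 0 R) x *\<^sub>R f x))"
    by (rule integrable_cmult_bounded[OF L1_loc_cball[OF f] h(1,2)])
  also have "(\<lambda>x. h x * (indicator (cball 0 R) x *\<^sub>R f x)) = (\<lambda>x. f x * h x)"
  proof
    fix x show "h x * (indicator (cball 0 R) x *\<^sub>R f x) = f x * h x"
      using h(3)[of x] by (cases "norm x \<le> R") auto
  qed
  finally show ?thesis .
qed

lemma L1_locI:
  assumes "\<And>R. integrable lebesgue (\<lambda>x. indicator (cball 0 R) x *\<^sub>R f x)"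
  shows "f \<in> L1_loc"
  unfolding L1_loc_def
proof (intro CollectI allI impI)
  fix K :: "(real^'a) set" assume K: "compact K"
  then obtain R where R: "K \<subseteq> cball 0 R"
    using compact_imp_bounded[OF K] by (auto simp: bounded_iff subset_iff)
  have "f absolutely_integrable_on cball 0 R" using assms by (simp add: set_integrable_def)
  then show "f absolutely_integrable_on K"
    by (rule set_integrable_subset[OF _ fmeasurableD[OF lmeasurable_compact[OF K]] R])
qed

lemma integrable_imp_L1_loc:
  fixes f :: "real^'n \<Rightarrow> real"
  assumes "integrable lebesgue f" shows "f \<in> L1_loc"
proof (rule L1_locI)
  fix R
  show "integrable lebesgue (\<lambda>x. indicator (cball 0 R) x *\<^sub>R f x)"
    unfolding real_scaleR_def by (rule integrable_cmult_bounded[OF assms, where B=1])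
      (auto intro: borel_measurable_indicator)
qed

lemma L1_loc_nth:
  fixes G :: "real^'n \<Rightarrow> real^'m"
  assumes "G \<in> L1_loc" shows "(\<lambda>x. G x $ i) \<in> L1_loc"
proof (rule L1_locI)
  fix R
  show "integrable lebesgue (\<lambda>x. indicator (cball 0 R) x *\<^sub>R G x $ i)"
    using integrable_bounded_linear[OF bounded_linear_vec_nth L1_loc_cball[OF assms, of R], of i] by simp
qed

lemma continuous_bounded_support:
  fixes u :: "real^'n \<Rightarrow> real"
  assumes "continuous_on UNIV u" "\<And>x. norm x > R \<Longrightarrow> u x = 0"
  shows "\<exists>B. \<forall>x. \<bar>u x\<bar> \<le> B"
proof -
  have "compact (u ` cball 0 R)"
    using assms(1) by (intro compact_continuous_image) (auto intro: continuous_on_subset)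
  then obtain B where B: "\<And>z. z \<in> cball 0 R \<Longrightarrow> \<bar>u z\<bar> \<le> B"
    by (force dest: compact_imp_bounded simp: bounded_iff)
  have "\<bar>u z\<bar> \<le> max B 0" for z using B[of z] assms(2)[of z] by (cases "norm z > R") auto
  then show ?thesis by blast
qed

lemma Cc_infty_continuous: "u \<in> Cc_infty \<Longrightarrow> continuous_on UNIV u"
  by (simp add: Cc_infty_iff smooth_continuous)

lemma continuous_lebesgue_borel:
  fixes u :: "real^'n \<Rightarrow> real"
  shows "continuous_on UNIV u \<Longrightarrow> u \<in> borel_measurable lebesgue"
  by (intro borel_measurable_lebesgueI borel_measurable_continuous_onI)

lemma Cc_infty_borel: "u \<in> Cc_infty \<Longrightarrow> u \<in> borel_measurable lebesgue"
  by (intro continuous_lebesgue_borel Cc_infty_continuous)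

lemma Cc_infty_bounded:
  assumes "u \<in> Cc_infty" shows "\<exists>B. \<forall>x. \<bar>u x\<bar> \<le> B"
proof -
  obtain R where R: "\<And>x. norm x > R \<Longrightarrow> u x = 0" using Cc_infty_bounded_support[OF assms] by metis
  show ?thesis by (rule continuous_bounded_support[OF Cc_infty_continuous[OF assms] R])
qed

lemma L1_loc_mult_Cc_infty:
  assumes "f \<in> L1_loc" "u \<in> Cc_infty" shows "integrable lebesgue (\<lambda>x. f x * u x)"
proof -
  obtain R where R: "\<And>x. norm x > R \<Longrightarrow> u x = 0" using Cc_infty_bounded_support[OF assms(2)] by metis
  obtain B where B: "\<And>x. \<bar>u x\<bar> \<le> B" using Cc_infty_bounded[OF assms(2)] by metis
  show ?thesis by (rule L1_loc_mult_integrable[OF assms(1) Cc_infty_borel[OF assms(2)] B R])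
qed

section \<open>Smooth radial kernels\<close>

definition kernel :: "nat \<Rightarrow> real \<Rightarrow> real^'n \<Rightarrow> real" where
  "kernel n t z = bump n ((norm z)\<^sup>2 / t\<^sup>2)"

lemma kernel_swap: "kernel n t (x - y) = kernel n t (y - x)"
  by (simp add: kernel_def norm_minus_commute)

lemma kernel_eq_0: "t > 0 \<Longrightarrow> norm z \<ge> t \<Longrightarrow> kernel n t z = 0"
  unfolding kernel_def by (rule bump_eq_0) (simp add: power_mono)

lemma smooth_kernel: "smooth (\<lambda>x. kernel n t (x - y))"
proof -
  have "smooth (\<lambda>x. (norm (x - y))\<^sup>2 * (1 / t\<^sup>2))" by (intro smooth_mult smooth_normsq smooth_const)
  from smooth_bump[OF this] show ?thesis by (simp add: kernel_def)
qed

lemma continuous_kernel: "continuous_on UNIV (kernel n t)"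
  using smooth_continuous[OF smooth_kernel[of n t 0]] by simp

lemma kernel_Cc_infty:
  assumes "t > 0" shows "(\<lambda>x. kernel n t (x - y)) \<in> Cc_infty"
proof -
  have "kernel n t (x - y) = 0" if "norm x > norm y + t" for x
    using that norm_triangle_ineq2[of x y] by (intro kernel_eq_0 assms) auto
  then show ?thesis by (auto simp: Cc_infty_iff smooth_kernel)
qed

lemma kernel_Cc_infty': "t > 0 \<Longrightarrow> (\<lambda>y. kernel n t (x - y)) \<in> Cc_infty"
  using kernel_Cc_infty[of t n x] by (simp add: kernel_swap)

lemma partial_deriv_kernel:
  "partial_deriv i (\<lambda>x. kernel n t (x - y)) x = kernel (Suc n) t (x - y) * (2 * (x $ i - y $ i) / t\<^sup>2)"
proof -
  have d: "((\<lambda>s. bump n (s / t\<^sup>2)) has_real_derivative bump (Suc n) (s / t\<^sup>2) * (1 / t\<^sup>2)) (at s)" for s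
    by (rule bump_DERIV[OF DERIV_cdivide[OF DERIV_ident]])
  show ?thesis
    unfolding kernel_def
    by (subst partial_deriv_comp[OF smooth_differentiable[OF smooth_normsq] d])
       (simp add: partial_deriv_normsq)
qed

text \<open>The Laplacian of h(|z|^2) is 4 |z|^2 h'' + 2 N h'; here h is the profile with its
  argument divided by t^2.\<close>

lemma laplacian_kernel:
  fixes x :: "real^'n"
  shows "laplacian (\<lambda>x. kernel n t (x - y)) x =
    (4 * ((norm (x - y))\<^sup>2 / t\<^sup>2) * kernel (n + 2) t (x - y) + 2 * real CARD('n) * kernel (Suc n) t (x - y)) / t\<^sup>2"
proof -
  have s: "smooth (\<lambda>x. 2 * (x $ i - y $ i) / t\<^sup>2)" for i
    using smooth_mult[OF smooth_const[of "2 / t\<^sup>2"] smooth_diff[OF smooth_coord smooth_const]] by simp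
  have pd: "partial_deriv i (\<lambda>x. 2 * (x $ i - y $ i) / t\<^sup>2) x = 2 / t\<^sup>2" for i
  proof -
    have "((\<lambda>x. 2 * (x $ i - y $ i) / t\<^sup>2) has_derivative (\<lambda>h. 2 * h $ i / t\<^sup>2)) (at x)"
      unfolding divide_inverse
      by (auto intro!: derivative_eq_intros bounded_linear.has_derivative[OF bounded_linear_vec_nth])
    from partial_deriv_eqI[OF this] show ?thesis by simp
  qed
  have "partial_deriv i (partial_deriv i (\<lambda>x. kernel n t (x - y))) x =
     kernel (n + 2) t (x - y) * (4 * (x $ i - y $ i)\<^sup>2 / t ^ 4) + kernel (Suc n) t (x - y) * (2 / t\<^sup>2)" for i
  proof -
    have "partial_deriv i (\<lambda>x. kernel n t (x - y)) = (\<lambda>x. kernel (Suc n) t (x - y) * (2 * (x $ i - y $ i) / t\<^sup>2))"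
      by (rule ext) (rule partial_deriv_kernel)
    then have "partial_deriv i (partial_deriv i (\<lambda>x. kernel n t (x - y))) x =
        partial_deriv i (\<lambda>x. kernel (Suc n) t (x - y)) x * (2 * (x $ i - y $ i) / t\<^sup>2)
        + kernel (Suc n) t (x - y) * partial_deriv i (\<lambda>x. 2 * (x $ i - y $ i) / t\<^sup>2) x"
      by (simp only: partial_deriv_mult[OF smooth_differentiable[OF smooth_kernel] smooth_differentiable[OF s]])
    moreover have "4 * d\<^sup>2 / t ^ 4 = (2 * d / t\<^sup>2) * (2 * d / t\<^sup>2)" for d
      by (simp add: power2_eq_square power4_eq_xxxx mult.assoc)
    ultimately show ?thesis
      unfolding partial_deriv_kernel pd by (simp only: mult.assoc add_2_eq_Suc')
  qed
  moreover have "(norm (x - y))\<^sup>2 = (\<Sum>i\<in>UNIV. (x $ i - y $ i)\<^sup>2)"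
    by (simp add: norm_vec_def L2_set_def sum_nonneg)
  ultimately show ?thesis
    by (simp add: laplacian_def sum.distrib flip: sum_distrib_left sum_divide_distrib)
       (simp add: add_divide_distrib power2_eq_square numeral_eq_Suc mult_ac)
qed

lemma mollifier_kernel_0: "mollifier (kernel 0 1)"
proof
  show "continuous_on UNIV (kernel 0 1)" by (rule continuous_kernel)
  show "0 \<le> kernel 0 1 z" for z by (simp add: kernel_def bump_0_nonneg)
  show "norm z \<ge> 1 \<Longrightarrow> kernel 0 1 z = 0" for z by (rule kernel_eq_0) auto
qed

text \<open>Nonnegativity is the monotonicity of the bump profile. Averages with this kernel are
  those whose derivative in t is a Laplacian, in the argument about the zero set of \<mu>.\<close>

lemma mollifier_kernel_1: "mollifier (\<lambda>z. - kernel 1 1 z)"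
proof
  show "continuous_on UNIV (\<lambda>z. - kernel 1 1 z)" by (intro continuous_on_minus continuous_kernel)
  show "0 \<le> - kernel 1 1 z" for z using bump_1_nonpos by (simp add: kernel_def)
  show "norm z \<ge> 1 \<Longrightarrow> - kernel 1 1 z = 0" for z using kernel_eq_0[of 1 z 1] by simp
qed

lemma kernel_scale: "t > 0 \<Longrightarrow> kernel n 1 (z /\<^sub>R t) = kernel n t z"
  by (simp add: kernel_def power_divide divide_simps power_mult_distrib)

lemma scaled_kernel_0: "t > 0 \<Longrightarrow> mollifier.scaled (kernel 0 1) t z = kernel 0 t z / t ^ CARD('n)" for z :: "real^'n"
  by (simp add: mollifier.scaled_def[OF mollifier_kernel_0] kernel_scale)

lemma scaled_kernel_1: "t > 0 \<Longrightarrow> mollifier.scaled (\<lambda>z. - kernel 1 1 z) t z = - kernel 1 t z / t ^ CARD('n)" for z :: "real^'n"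
  by (simp add: mollifier.scaled_def[OF mollifier_kernel_1] kernel_scale del: One_nat_def)

lemma mass_kernel_0_pos: "mollifier.mass (kernel 0 1 :: real^'n \<Rightarrow> real) > 0"
proof -
  interpret k: mollifier "kernel 0 1 :: real^'n \<Rightarrow> real" by (rule mollifier_kernel_0)
  \<comment> \<open>On the ball of radius 1/2 one has 1/(1 - |z|^2) <= 4/3, so the bump is at least
    exp (-2) there.\<close>
  have "0 < exp (- 2) * measure lborel (cball (0::real^'n) (1/2))"
    by (simp add: content_cball_pos)
  also have "\<dots> = (LINT z|lborel. exp (- 2) * indicator (cball (0::real^'n) (1/2)) z)"
    by simp
  also have "\<dots> \<le> (LINT z|lborel. kernel 0 1 (z::real^'n))"
  proof (rule integral_mono)
    show "integrable lborel (\<lambda>z. exp (- 2) * indicator (cball (0::real^'n) (1/2)) z :: real)"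
      by (intro integrable_mult_right integrable_real_indicator) (auto simp: emeasure_cball_less_top)
    fix z :: "real^'n"
    show "exp (- 2) * indicator (cball 0 (1/2)) z \<le> (kernel 0 1 z :: real)"
    proof (cases "norm z \<le> 1/2")
      case True
      then have z: "(norm z)\<^sup>2 \<le> 1/4" using power_mono[of "norm z" "1/2" 2] by (simp add: power2_eq_square)
      then have "1 / (1 - (norm z)\<^sup>2) \<le> 2" by (simp add: field_simps)
      then show ?thesis using z True by (simp add: kernel_def bump_0)
    qed (simp add: k.nonneg)
  qed (rule k.k_integrable)
  also have "\<dots> = k.mass" by (simp add: k.mass_lborel)
  finally show ?thesis .
qed

section \<open>Weak derivatives\<close>

lemma inverse_Suc_seq: "(\<lambda>n. 1 / (real n + 1)) \<longlonglongrightarrow> 0" "1 / (real n + 1) > 0" "1 / (real n + 1) \<le> 1"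
proof -
  show "(\<lambda>n. 1 / (real n + 1)) \<longlonglongrightarrow> 0" using LIMSEQ_inverse_real_of_nat by (simp add: inverse_eq_divide add.commute)
qed auto

lemma indicator_cball_borel: "(indicator (cball a R) :: 'a::euclidean_space \<Rightarrow> real) \<in> borel_measurable lebesgue"
  by (auto intro: borel_measurable_indicator)

lemma indicator_mult_square: "(indicator A x * r)\<^sup>2 = indicator A x * (r::real)\<^sup>2"
  by (simp add: indicator_def)

text \<open>A kernel of scale at most 1 centred in the ball of radius R does not see points outside
  the ball of radius R + 1. Cutting off there costs nothing and turns locally integrable functions
  into integrable ones.\<close>

lemma kernel_local:
  assumes "t > 0" "t \<le> 1" "norm x \<le> R"
  shows "indicator (cball 0 (R + 1)) y * f y * kernel n t (x - y) = f y * kernel n t (x - y)"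
proof (cases "norm y \<le> R + 1")
  case False
  then have "norm (x - y) \<ge> t" using norm_triangle_ineq3[of x y] assms by linarith
  then have "kernel n t (x - y) = 0" by (rule kernel_eq_0[OF assms(1)])
  then show ?thesis by simp
qed simp

text \<open>Tested with kernels centred at x, f has vanishing averages at all scales up to 1. Paired
  with the sign of f on a ball, these averages converge to the integral of \<bar>f\<bar> over that
  ball times \<open>mass\<close>, which is positive.\<close>

lemma AE_eq_0_of_Cc_infty:
  fixes f :: "real^'n \<Rightarrow> real"
  assumes f: "f \<in> L1_loc" and orth: "\<And>\<eta>. \<eta> \<in> Cc_infty \<Longrightarrow> (LINT x|lebesgue. f x * \<eta> x) = 0"
  shows "AE x in lebesgue. f x = 0"
proof -
  interpret k: mollifier "kernel 0 1 :: real^'n \<Rightarrow> real" by (rule mollifier_kernel_0)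
  have fm: "f \<in> borel_measurable lebesgue" by (rule L1_loc_borel[OF f])
  have "AE x in lebesgue. norm x \<le> R \<longrightarrow> f x = 0" for R
  proof -
    define a where "a x = indicator (cball 0 R) x * sgn (f x)" for x
    define b where "b x = indicator (cball 0 (R + 1)) x * f x" for x
    have am: "a \<in> borel_measurable lebesgue"
      unfolding a_def using fm indicator_cball_borel by measurable
    have a1: "\<bar>a x\<bar> \<le> 1" for x by (simp add: a_def indicator_def sgn_if)
    have ai: "integrable lebesgue a"
      by (rule integrable_bounded_support[OF am a1, of R]) (simp add: a_def)
    have bi: "integrable lebesgue b" using L1_loc_cball[OF f, of "R + 1"] by (simp add: b_def[abs_def])
    let ?\<tau> = "\<lambda>n. 1 / (real n + 1)"
    have "k.bilin (?\<tau> n) a b = 0" for n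
    proof -
      note t = inverse_Suc_seq(2,3)[of n]
      have z: "a x * (LINT y|lebesgue. b y * k.scaled (?\<tau> n) (x - y)) = 0" for x
      proof (cases "norm x \<le> R")
        case True
        have "(LINT y|lebesgue. b y * k.scaled (?\<tau> n) (x - y)) =
            (LINT y|lebesgue. f y * kernel 0 (?\<tau> n) (x - y)) / ?\<tau> n ^ CARD('n)"
          unfolding scaled_kernel_0[OF t(1)] b_def times_divide_eq_right kernel_local[OF t True] by simp
        also have "\<dots> = 0" using orth[OF kernel_Cc_infty'[OF t(1)]] by simp
        finally show ?thesis by simp
      qed (simp add: a_def)
      show ?thesis
        using k.bilin_iterated(1)[OF k.bilin_integrable_L1(1)[OF t(1) am a1 bi]] unfolding z by simp
    qed
    then have "k.mass * (LINT x|lebesgue. a x * b x) = 0"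
      using LIMSEQ_unique[OF k.bilin_tendsto_L1[OF ai a1 bi inverse_Suc_seq(2,1)], of 0] by simp
    then have "(LINT x|lebesgue. a x * b x) = 0" using mass_kernel_0_pos[where 'n='n] by auto
    moreover have ab: "a x * b x = indicator (cball 0 R) x * \<bar>f x\<bar>" for x
      by (auto simp: a_def b_def indicator_def abs_sgn mult.commute)
    moreover have "integrable lebesgue (\<lambda>x. a x * b x)" by (rule integrable_cmult_bounded[OF bi am a1])
    ultimately have "AE x in lebesgue. a x * b x = 0"
      using integral_nonneg_eq_0_iff_AE[of lebesgue "\<lambda>x. a x * b x"] by simp
    then show ?thesis by eventually_elim (auto simp: ab)
  qed
  then have "AE x in lebesgue. \<forall>n. norm x \<le> real n \<longrightarrow> f x = 0"
    unfolding AE_all_countable by blast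
  then show ?thesis by eventually_elim (meson real_arch_simple)
qed

lemma has_weak_grad_unique:
  assumes "has_weak_grad f G" "has_weak_grad f H"
  shows "AE x in lebesgue. G x = H x"
proof -
  have "AE x in lebesgue. G x $ i - H x $ i = 0" for i
  proof (rule AE_eq_0_of_Cc_infty)
    have GH: "(\<lambda>x. G x $ i) \<in> L1_loc" "(\<lambda>x. H x $ i) \<in> L1_loc"
      using assms L1_loc_nth unfolding has_weak_grad_def by blast+
    show "(\<lambda>x. G x $ i - H x $ i) \<in> L1_loc"
    proof (rule L1_locI)
      fix R show "integrable lebesgue (\<lambda>x. indicator (cball 0 R) x *\<^sub>R (G x $ i - H x $ i))"
        using Bochner_Integration.integrable_diff[OF L1_loc_cball[OF GH(1), of R] L1_loc_cball[OF GH(2), of R]]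
        by (simp add: right_diff_distrib)
    qed
    fix \<eta> :: "real^'a \<Rightarrow> real" assume \<eta>: "\<eta> \<in> Cc_infty"
    have "(LINT x|lebesgue. (G x $ i - H x $ i) * \<eta> x) = (LINT x|lebesgue. G x $ i * \<eta> x) - (LINT x|lebesgue. H x $ i * \<eta> x)"
      using Bochner_Integration.integral_diff[OF L1_loc_mult_Cc_infty[OF GH(1) \<eta>] L1_loc_mult_Cc_infty[OF GH(2) \<eta>]]
      by (simp add: left_diff_distrib)
    also have "\<dots> = 0"
    proof -
      have "(LINT x|lebesgue. f x * partial_deriv i \<eta> x) = - (LINT x|lebesgue. G x $ i * \<eta> x)"
        "(LINT x|lebesgue. f x * partial_deriv i \<eta> x) = - (LINT x|lebesgue. H x $ i * \<eta> x)"
        using assms \<eta> unfolding has_weak_grad_def by blast+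
      then show ?thesis by simp
    qed
    finally show "(LINT x|lebesgue. (G x $ i - H x $ i) * \<eta> x) = 0" .
  qed
  then have "AE x in lebesgue. \<forall>i. G x $ i - H x $ i = 0" by (simp add: AE_all_countable)
  then show ?thesis by eventually_elim (simp add: vec_eq_iff)
qed

section \<open>The weak gradient of a square\<close>

lemma L2_loc_cball:
  fixes f :: "real^'n \<Rightarrow> 'b::euclidean_space"
  assumes "f \<in> L2_loc" shows "integrable lebesgue (\<lambda>x. indicator (cball 0 R) x * (norm (f x))\<^sup>2)"
proof -
  have "(\<lambda>x. (norm (f x))\<^sup>2) absolutely_integrable_on cball 0 R" using assms unfolding L2_loc_def by auto
  then show ?thesis by (simp add: set_integrable_def)
qed

lemma L2_loc_nth:
  fixes G :: "real^'n \<Rightarrow> real^'m"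
  assumes "G \<in> L2_loc"
  shows "(\<lambda>x. G x $ i) \<in> borel_measurable lebesgue"
    and "integrable lebesgue (\<lambda>x. indicator (cball 0 R) x * (G x $ i)\<^sup>2)"
proof -
  have "G \<in> borel_measurable lebesgue" using assms by (simp add: L2_loc_def)
  then show m: "(\<lambda>x. G x $ i) \<in> borel_measurable lebesgue"
    by (rule measurable_compose[OF _ borel_measurable_continuous_onI])
      (intro continuous_intros)
  show "integrable lebesgue (\<lambda>x. indicator (cball 0 R) x * (G x $ i)\<^sup>2)"
  proof (rule Bochner_Integration.integrable_bound[OF L2_loc_cball[OF assms, of R]])
    show "(\<lambda>x. indicator (cball 0 R) x * (G x $ i)\<^sup>2) \<in> borel_measurable lebesgue"
      using m indicator_cball_borel by measurable
    show "AE x in lebesgue. norm (indicator (cball 0 R) x * (G x $ i)\<^sup>2) \<le> norm (indicator (cball 0 R) x * (norm (G x))\<^sup>2)"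
    proof (rule AE_I2)
      fix x
      have "(G x $ i)\<^sup>2 \<le> (norm (G x))\<^sup>2" using component_le_norm_cart[of "G x" i] by (simp add: abs_le_square_iff[symmetric])
      then show "norm (indicator (cball 0 R) x * (G x $ i)\<^sup>2) \<le> norm (indicator (cball 0 R) x * (norm (G x))\<^sup>2)"
        by (simp add: indicator_def)
    qed
  qed
qed

lemma L2_mult_Cc_infty:
  fixes f :: "real^'n \<Rightarrow> real"
  assumes f: "f \<in> borel_measurable lebesgue" "\<And>R. integrable lebesgue (\<lambda>x. indicator (cball 0 R) x * (f x)\<^sup>2)"
    and u: "u \<in> Cc_infty"
  shows "integrable lebesgue (\<lambda>x. (f x * u x)\<^sup>2)"
proof -
  have "(\<lambda>x. (f x)\<^sup>2) \<in> L1_loc" by (rule L1_locI) (use f in simp)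
  from L1_loc_mult_Cc_infty[OF this Cc_infty_mult[OF u Cc_infty_smooth[OF u]]]
  show ?thesis by (simp add: power2_eq_square mult_ac)
qed

text \<open>The kernel \<open>k\<^sub>t (x - y)\<close> has opposite derivatives in \<open>x\<close> and \<open>y\<close>.  Testing the weak gradient once
  with \<open>x \<mapsto> k\<^sub>t (x - y) \<eta> x\<close> and once with \<open>y \<mapsto> k\<^sub>t (x - y)\<close> and integrating over the other variable
  against \<open>\<phi>\<close> resp. \<open>\<phi> \<eta>\<close> gives the product rule in the limit \<open>t \<longrightarrow> 0\<close>,
  without differentiating a convolution.\<close>

lemma weak_grad_square_test:
  fixes \<phi> :: "real^'n \<Rightarrow> real"
  assumes wg: "has_weak_grad \<phi> G" and \<phi>2: "\<phi> \<in> L2_loc" and G2: "G \<in> L2_loc" and \<eta>: "\<eta> \<in> Cc_infty"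
  shows "(LINT x|lebesgue. (\<phi> x)\<^sup>2 * partial_deriv i \<eta> x) = - (LINT x|lebesgue. 2 * \<phi> x * G x $ i * \<eta> x)"
proof -
  interpret k: mollifier "kernel 0 1 :: real^'n \<Rightarrow> real" by (rule mollifier_kernel_0)
  have \<phi>1: "\<phi> \<in> L1_loc"
    and wgD: "\<And>\<psi>. \<psi> \<in> Cc_infty \<Longrightarrow> (LINT x|lebesgue. \<phi> x * partial_deriv i \<psi> x) = - (LINT x|lebesgue. G x $ i * \<psi> x)"
    using wg unfolding has_weak_grad_def by blast+
  have \<eta>': "partial_deriv i \<eta> \<in> Cc_infty" by (rule Cc_infty_partial_deriv[OF \<eta>])
  obtain R0 where R0: "R0 > 0" "\<And>x. norm x > R0 \<Longrightarrow> \<eta> x = 0" using Cc_infty_bounded_support[OF \<eta>] by metis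
  obtain R1 where R1: "R1 > 0" "\<And>x. norm x > R1 \<Longrightarrow> partial_deriv i \<eta> x = 0"
    using Cc_infty_bounded_support[OF \<eta>'] by metis
  define R where "R = max R0 R1"
  have R: "\<And>x. norm x > R \<Longrightarrow> \<eta> x = 0" "\<And>x. norm x > R \<Longrightarrow> partial_deriv i \<eta> x = 0"
    using R0 R1 by (auto simp: R_def)
  define b where "b x = indicator (cball 0 (R + 1)) x * \<phi> x" for x
  define g where "g x = indicator (cball 0 (R + 1)) x * G x $ i" for x
  define a0 where "a0 x = \<phi> x * \<eta> x" for x
  define a1 where "a1 x = \<phi> x * partial_deriv i \<eta> x" for x
  define a2 where "a2 x = G x $ i * \<eta> x" for x
  have \<phi>m: "\<phi> \<in> borel_measurable lebesgue" by (rule L1_loc_borel[OF \<phi>1])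
  have \<phi>s: "integrable lebesgue (\<lambda>x. indicator (cball 0 R) x * (\<phi> x)\<^sup>2)" for R
    using L2_loc_cball[OF \<phi>2] by simp
  note Gs = L2_loc_nth[OF G2, where i=i]
  have m: "a0 \<in> borel_measurable lebesgue" "a1 \<in> borel_measurable lebesgue" "a2 \<in> borel_measurable lebesgue"
    unfolding a0_def a1_def a2_def using \<phi>m Gs(1) Cc_infty_borel[OF \<eta>] Cc_infty_borel[OF \<eta>']
    by (auto intro: borel_measurable_times)
  have mb: "b \<in> borel_measurable lebesgue" "g \<in> borel_measurable lebesgue"
    unfolding b_def g_def using \<phi>m Gs(1) by (auto intro!: borel_measurable_times indicator_cball_borel)
  have sq: "integrable lebesgue (\<lambda>x. (a0 x)\<^sup>2)" "integrable lebesgue (\<lambda>x. (a1 x)\<^sup>2)" "integrable lebesgue (\<lambda>x. (a2 x)\<^sup>2)"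
    unfolding a0_def a1_def a2_def
    using L2_mult_Cc_infty[OF \<phi>m \<phi>s] L2_mult_Cc_infty[OF Gs] \<eta> \<eta>' by auto
  have sqb: "integrable lebesgue (\<lambda>x. (b x)\<^sup>2)" "integrable lebesgue (\<lambda>x. (g x)\<^sup>2)"
    unfolding b_def g_def using \<phi>s[of "R + 1"] Gs(2)[of "R + 1"]
    by (simp_all add: indicator_mult_square)
  have i0: "integrable lebesgue a0" unfolding a0_def by (rule L1_loc_mult_Cc_infty[OF \<phi>1 \<eta>])
  have ib: "integrable lebesgue b" using L1_loc_cball[OF \<phi>1, of "R + 1"] by (simp add: b_def[abs_def])
  note int_b = k.bilin_integrable_L2(1)[OF _ _ _ mb(1) sqb(1) zero_less_one]
  \<comment> \<open>As t -> 0 and up to the factor \<open>mass\<close>, the terms tend to the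
    integrals of \<phi> G_i \<eta>, of \<phi>^2 times the derivative of \<eta>, and of \<phi> G_i
    \<eta> once more.\<close>
  have key: "k.bilin t a0 g + k.bilin t a1 b + k.bilin t a2 b = 0" if t: "0 < t" "t \<le> 1" for t
  proof -
    define \<kappa> where "\<kappa> z = kernel 1 t z * (2 * z $ i / t\<^sup>2) / t ^ CARD('n)" for z :: "real^'n"
    have \<kappa>: "\<kappa> z = partial_deriv i (\<lambda>x. kernel 0 t (x - y)) (y + z) / t ^ CARD('n)" for z y
      using partial_deriv_kernel[where i=i and n=0 and t=t and y=y and x="y + z"] by (simp add: \<kappa>_def)
    have \<kappa>c: "continuous_on UNIV \<kappa>"
      unfolding \<kappa>_def divide_inverse by (intro continuous_intros continuous_kernel)
    have \<kappa>m: "\<kappa> \<in> borel_measurable borel" by (rule borel_measurable_continuous_onI[OF \<kappa>c])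
    have "\<kappa> z = 0" if "norm z > t" for z using kernel_eq_0[OF t(1), of z 1] that by (simp add: \<kappa>_def)
    then obtain B where B: "\<And>z. \<bar>\<kappa> z\<bar> \<le> B" using continuous_bounded_support[OF \<kappa>c] by metis
    have pi: "integrable (lebesgue \<Otimes>\<^sub>M lebesgue) (\<lambda>z. \<kappa> (fst z - snd z) * (a0 (fst z) * b (snd z)))"
      by (rule integrable_cmult_bounded[OF integrable_pair_mult[OF i0 ib] borel_measurable_lebesgue_pair_diff[OF \<kappa>m] B])
    have K: "(\<lambda>x. kernel 0 t (x - y) / t ^ CARD('n)) \<in> Cc_infty" for y :: "real^'n"
      using Cc_infty_mult[OF kernel_Cc_infty[OF t(1)] smooth_const[of "1 / t ^ CARD('n)"]] by simp
    have Kd: "partial_deriv i (\<lambda>x. kernel 0 t (x - y) / t ^ CARD('n)) x = \<kappa> (x - y)" for x y :: "real^'n"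
    proof -
      have "partial_deriv i (\<lambda>x. kernel 0 t (x - y) * (1 / t ^ CARD('n))) x = \<kappa> (x - y)"
        by (subst partial_deriv_mult[OF smooth_differentiable[OF smooth_kernel] smooth_differentiable[OF smooth_const]])
          (simp add: partial_deriv_const \<kappa>[of _ y])
      then show ?thesis by simp
    qed
    have E1: "(LINT x|lebesgue. a0 x * \<kappa> (x - y)) =
        - (LINT x|lebesgue. a1 x * k.scaled t (x - y)) - (LINT x|lebesgue. a2 x * k.scaled t (x - y))" for y
    proof -
      let ?K = "\<lambda>x. kernel 0 t (x - y) / t ^ CARD('n)"
      have sK: "smooth ?K" by (rule Cc_infty_smooth[OF K])
      have t1: "(\<lambda>x. \<eta> x * ?K x) \<in> Cc_infty" by (rule Cc_infty_mult[OF \<eta> sK])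
      have pd: "partial_deriv i (\<lambda>x. \<eta> x * ?K x) x = partial_deriv i \<eta> x * ?K x + \<eta> x * \<kappa> (x - y)" for x
        unfolding Kd[symmetric]
        by (rule partial_deriv_mult[OF smooth_differentiable[OF Cc_infty_smooth[OF \<eta>]] smooth_differentiable[OF sK]])
      have sk: "smooth (\<lambda>x. \<kappa> (x - y))"
        unfolding Kd[symmetric] using smooth_partial_deriv[OF sK, of i] by simp
      have "(LINT x|lebesgue. \<phi> x * (partial_deriv i \<eta> x * ?K x) + \<phi> x * (\<eta> x * \<kappa> (x - y))) = - (LINT x|lebesgue. G x $ i * (\<eta> x * ?K x))"
        using wgD[OF t1] unfolding pd by (simp only: distrib_left)
      moreover have "(LINT x|lebesgue. \<phi> x * (partial_deriv i \<eta> x * ?K x) + \<phi> x * (\<eta> x * \<kappa> (x - y))) =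
          (LINT x|lebesgue. \<phi> x * (partial_deriv i \<eta> x * ?K x)) + (LINT x|lebesgue. \<phi> x * (\<eta> x * \<kappa> (x - y)))"
        by (intro Bochner_Integration.integral_add L1_loc_mult_Cc_infty \<phi>1 Cc_infty_mult \<eta> \<eta>' sK sk)
      ultimately show ?thesis
        unfolding a0_def a1_def a2_def scaled_kernel_0[OF t(1)] by (simp add: mult.assoc)
    qed
    have E2: "(LINT y|lebesgue. \<phi> y * \<kappa> (x - y)) = (LINT y|lebesgue. G y $ i * k.scaled t (x - y))" for x
    proof -
      \<comment> \<open>The derivative of an even kernel is odd; this is the opposite sign of the
        derivatives in x and in y.\<close>
      have "\<kappa> (y - x) = - \<kappa> (x - y)" for y
        using kernel_swap[of 1 t y x] by (simp add: \<kappa>_def algebra_simps diff_divide_distrib)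
      moreover have "k.scaled t (x - y) = kernel 0 t (y - x) / t ^ CARD('n)" for y
        unfolding scaled_kernel_0[OF t(1)] by (simp only: kernel_swap[of 0 t x y])
      ultimately show ?thesis using wgD[OF K[of x]] unfolding Kd by simp
    qed
    \<comment> \<open>E2 moves the derivative from the copy of \<phi> in y to the kernel, Fubini
      exchanges the integrals, and E1 moves it on to the copy in x and to \<eta>. The cutoffs in b
      and g are invisible because \<eta> vanishes outside the ball of radius R.\<close>
    have "k.bilin t a0 g = (LINT x|lebesgue. a0 x * (LINT y|lebesgue. g y * k.scaled t (x - y)))"
      by (rule k.bilin_iterated(1)[OF k.bilin_integrable_L2(1)[OF t(1) m(1) sq(1) mb(2) sqb(2) zero_less_one]])
    also have "\<dots> = (LINT x|lebesgue. a0 x * (LINT y|lebesgue. b y * \<kappa> (x - y)))"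
    proof (intro Bochner_Integration.integral_cong refl)
      fix x
      show "a0 x * (LINT y|lebesgue. g y * k.scaled t (x - y)) = a0 x * (LINT y|lebesgue. b y * \<kappa> (x - y))"
      proof (cases "norm x \<le> R")
        case True
        have "g y * k.scaled t (x - y) = G y $ i * k.scaled t (x - y)" for y
          using kernel_local[OF t True, of y "\<lambda>y. G y $ i" 0] by (simp add: g_def scaled_kernel_0[OF t(1)])
        moreover have "b y * \<kappa> (x - y) = \<phi> y * \<kappa> (x - y)" for y
          using kernel_local[OF t True, of y \<phi> 1] by (simp add: b_def \<kappa>_def mult.assoc[symmetric] del: One_nat_def)
        ultimately show ?thesis using E2[of x] by (simp only:)
      qed (simp add: a0_def R)
    qed
    also have "\<dots> = (LINT x|lebesgue. LINT y|lebesgue. \<kappa> (x - y) * (a0 x * b y))"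
      by (intro Bochner_Integration.integral_cong refl, subst integral_mult_right_zero[symmetric])
        (simp add: ac_simps)
    also have "\<dots> = (LINT y|lebesgue. LINT x|lebesgue. \<kappa> (x - y) * (a0 x * b y))"
      using leb2.Fubini_integral[of "\<lambda>x y. \<kappa> (x - y) * (a0 x * b y)"] pi by (simp add: case_prod_unfold)
    also have "\<dots> = (LINT y|lebesgue. b y * (LINT x|lebesgue. a0 x * \<kappa> (x - y)))"
      by (intro Bochner_Integration.integral_cong refl, subst integral_mult_right_zero[symmetric])
        (simp add: ac_simps)
    also have "\<dots> = (LINT y|lebesgue. - (b y * (LINT x|lebesgue. a1 x * k.scaled t (x - y))) - b y * (LINT x|lebesgue. a2 x * k.scaled t (x - y)))"
      unfolding E1 by (simp add: algebra_simps)
    also have "\<dots> = - (LINT y|lebesgue. b y * (LINT x|lebesgue. a1 x * k.scaled t (x - y))) - (LINT y|lebesgue. b y * (LINT x|lebesgue. a2 x * k.scaled t (x - y)))"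
    proof -
      have "integrable lebesgue (\<lambda>y. b y * (LINT x|lebesgue. a x * k.scaled t (x - y)))"
        if "a \<in> borel_measurable lebesgue" "integrable lebesgue (\<lambda>x. (a x)\<^sup>2)" for a
      proof -
        have "integrable lebesgue (\<lambda>y. LINT x|lebesgue. a x * b y * k.scaled t (x - y))"
          using leb2.integrable_snd[of "\<lambda>x y. a x * b y * k.scaled t (x - y)"] int_b[OF t(1) that]
          by (simp add: case_prod_unfold)
        then show ?thesis by (simp add: mult.left_commute mult.assoc flip: integral_mult_right_zero)
      qed
      then show ?thesis using m sq by simp
    qed
    also have "\<dots> = - k.bilin t a1 b - k.bilin t a2 b"
      using k.bilin_iterated(2)[OF int_b[OF t(1) m(2) sq(2)]] k.bilin_iterated(2)[OF int_b[OF t(1) m(3) sq(3)]] by simp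
    finally show ?thesis by simp
  qed
  let ?\<tau> = "\<lambda>n. 1 / (real n + 1)"
  note lim = k.bilin_tendsto_L2[OF _ _ _ _ inverse_Suc_seq(2,1)]
  have "(\<lambda>n. k.bilin (?\<tau> n) a0 g + k.bilin (?\<tau> n) a1 b + k.bilin (?\<tau> n) a2 b) \<longlonglongrightarrow>
      k.mass * (LINT x|lebesgue. a0 x * g x) + k.mass * (LINT x|lebesgue. a1 x * b x) + k.mass * (LINT x|lebesgue. a2 x * b x)"
    by (intro tendsto_add lim m sq mb sqb)
  then have "k.mass * (LINT x|lebesgue. a0 x * g x) + k.mass * (LINT x|lebesgue. a1 x * b x) + k.mass * (LINT x|lebesgue. a2 x * b x) = 0"
    using key[OF inverse_Suc_seq(2,3)] LIMSEQ_unique[OF _ tendsto_const[of 0]] by simp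
  then have "k.mass * ((LINT x|lebesgue. a0 x * g x) + (LINT x|lebesgue. a1 x * b x) + (LINT x|lebesgue. a2 x * b x)) = 0"
    by (simp add: distrib_left)
  then have sum0: "(LINT x|lebesgue. a0 x * g x) + (LINT x|lebesgue. a1 x * b x) + (LINT x|lebesgue. a2 x * b x) = 0"
    using mass_kernel_0_pos[where 'n='n] by simp
  have e0: "a0 x * g x = \<phi> x * G x $ i * \<eta> x" and e1: "a1 x * b x = (\<phi> x)\<^sup>2 * partial_deriv i \<eta> x"
    and e2: "a2 x * b x = \<phi> x * G x $ i * \<eta> x" for x
    using R[of x] by (auto simp: a0_def a1_def a2_def b_def g_def indicator_def power2_eq_square not_le)
  show ?thesis using sum0 unfolding e0 e1 e2 by (simp add: mult.assoc)
qed

lemma has_weak_grad_square: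
  assumes wg: "has_weak_grad \<phi> G" and \<phi>2: "\<phi> \<in> L2_loc" and G2: "G \<in> L2_loc"
  shows "has_weak_grad (\<lambda>x. (\<phi> x)\<^sup>2) (\<lambda>x. (2 * \<phi> x) *\<^sub>R G x)"
  unfolding has_weak_grad_def
proof (intro conjI ballI allI)
  show "(\<lambda>x. (\<phi> x)\<^sup>2) \<in> L1_loc" by (rule L1_locI) (use L2_loc_cball[OF \<phi>2] in simp)
  have \<phi>m: "\<phi> \<in> borel_measurable lebesgue" and Gm: "G \<in> borel_measurable lebesgue"
    using \<phi>2 G2 by (auto simp: L2_loc_def)
  show "(\<lambda>x. (2 * \<phi> x) *\<^sub>R G x) \<in> L1_loc"
  proof (rule L1_locI)
    fix R
    show "integrable lebesgue (\<lambda>x. indicator (cball 0 R) x *\<^sub>R ((2 * \<phi> x) *\<^sub>R G x))"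
    proof (rule Bochner_Integration.integrable_bound[OF Bochner_Integration.integrable_add[OF L2_loc_cball[OF \<phi>2, of R] L2_loc_cball[OF G2, of R]]])
      show "(\<lambda>x. indicator (cball 0 R) x *\<^sub>R ((2 * \<phi> x) *\<^sub>R G x)) \<in> borel_measurable lebesgue"
        using \<phi>m Gm by (intro borel_measurable_scaleR indicator_cball_borel) auto
      show "AE x in lebesgue. norm (indicator (cball 0 R) x *\<^sub>R ((2 * \<phi> x) *\<^sub>R G x))
          \<le> norm (indicator (cball 0 R) x * (norm (\<phi> x))\<^sup>2 + indicator (cball 0 R) x * (norm (G x))\<^sup>2)"
      proof (rule AE_I2)
        fix x
        have "2 * \<bar>\<phi> x\<bar> * norm (G x) \<le> (\<phi> x)\<^sup>2 + (norm (G x))\<^sup>2"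
          using sum_squares_bound[of "\<bar>\<phi> x\<bar>" "norm (G x)"] by simp
        then show "norm (indicator (cball 0 R) x *\<^sub>R ((2 * \<phi> x) *\<^sub>R G x))
          \<le> norm (indicator (cball 0 R) x * (norm (\<phi> x))\<^sup>2 + indicator (cball 0 R) x * (norm (G x))\<^sup>2)"
          by (simp add: indicator_def abs_mult)
      qed
    qed
  qed
  fix \<eta> :: "real^'a \<Rightarrow> real" and i assume "\<eta> \<in> Cc_infty"
  from weak_grad_square_test[OF wg \<phi>2 G2 this, of i]
  show "(LINT x|lebesgue. (\<phi> x)\<^sup>2 * partial_deriv i \<eta> x) = - (LINT x|lebesgue. ((2 * \<phi> x) *\<^sub>R G x) $ i * \<eta> x)"
    by simp
qed

text \<open>With \<open>p\<^sub>t\<close> the bump at scale \<open>t\<close> and \<open>m\<^sub>t\<close> the rescaling of \<open>- p'\<close>, both normalised by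
  \<open>t\<^sup>-\<^sup>N\<close>, one has \<open>\<partial>\<^sub>t m\<^sub>t = (t / 2) \<Delta> p\<^sub>t\<close>.  Hence if \<open>\<Delta>\<mu>\<close> were negative on a subset \<open>A\<close> of \<open>{\<mu> = 0}\<close>
  of positive measure, the averages \<open>\<integral>\<^bsub>A\<^esub> \<mu> * m\<^sub>t \<ge> 0\<close> would be strictly decreasing for small \<open>t\<close>,
  although they tend to \<open>0\<close> as \<open>t \<longrightarrow> 0\<close>.\<close>

lemma weak_laplacian_nonneg_on_zeros:
  fixes \<mu> D :: "real^'n \<Rightarrow> real"
  notes One_nat_def [simp del]
  assumes wl: "has_weak_laplacian \<mu> D" and \<mu>0: "\<And>x. 0 \<le> \<mu> x"
  shows "AE x in lebesgue. \<mu> x = 0 \<longrightarrow> 0 \<le> D x"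
proof -
  interpret k: mollifier "kernel 0 1 :: real^'n \<Rightarrow> real" by (rule mollifier_kernel_0)
  interpret m: mollifier "\<lambda>z::real^'n. - kernel 1 1 z" by (rule mollifier_kernel_1)
  have \<mu>1: "\<mu> \<in> L1_loc" and D1: "D \<in> L1_loc"
    and wlD: "\<And>\<eta>. \<eta> \<in> Cc_infty \<Longrightarrow> (LINT x|lebesgue. \<mu> x * laplacian \<eta> x) = (LINT x|lebesgue. D x * \<eta> x)"
    using wl unfolding has_weak_laplacian_def by blast+
  have \<mu>m: "\<mu> \<in> borel_measurable lebesgue" and Dm: "D \<in> borel_measurable lebesgue"
    using L1_loc_borel \<mu>1 D1 by blast+
  let ?N = "real CARD('n)"
  have "AE x in lebesgue. norm x \<le> R \<longrightarrow> \<mu> x = 0 \<longrightarrow> 0 \<le> D x" for R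
  proof -
    define A where "A = {x. \<mu> x = 0 \<and> D x < 0}"
    have "{x \<in> space lebesgue. \<mu> x = 0 \<and> D x < 0} \<in> sets lebesgue" using \<mu>m Dm by measurable
    then have Am: "A \<in> sets lebesgue" by (simp add: A_def)
    define a :: "real^'n \<Rightarrow> real" where "a x = indicator (cball 0 R) x * indicator A x" for x
    define b where "b x = indicator (cball 0 (R + 1)) x * \<mu> x" for x
    define d where "d x = indicator (cball 0 (R + 1)) x * D x" for x
    have am: "a \<in> borel_measurable lebesgue"
      unfolding a_def using Am by (intro borel_measurable_times indicator_cball_borel borel_measurable_indicator)
    have a0: "a x \<ge> 0" and a1: "\<bar>a x\<bar> \<le> 1" for x by (simp_all add: a_def indicator_def)
    have ai: "integrable lebesgue a"
      by (rule integrable_bounded_support[OF am a1, of R]) (simp add: a_def)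
    have bi: "integrable lebesgue b" using L1_loc_cball[OF \<mu>1, of "R + 1"] by (simp add: b_def[abs_def])
    have di: "integrable lebesgue d" using L1_loc_cball[OF D1, of "R + 1"] by (simp add: d_def[abs_def])
    \<comment> \<open>F averages \<mu> over the suspected set with the second kernel, H averages its
      weak Laplacian with the first one. The indicator a serves as the bounded factor in both
      limits.\<close>
    define F where "F t = m.bilin t a b" for t
    define H where "H t = k.bilin t a d" for t
    have F_nonneg: "F t \<ge> 0" if "t > 0" for t
      unfolding F_def m.bilin_def
      by (rule Bochner_Integration.integral_nonneg)
        (use m.scaled_nonneg[OF that] in \<open>simp add: a0 b_def \<mu>0\<close>)
    have F_deriv: "(F has_real_derivative (t / 2) * H t) (at t)" if t: "0 < t" "t < 1" for t
    proof -
      \<comment> \<open>This is the derivative in u of the scaled second kernel. Comparing it with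
        the Laplacian of the first kernel at the same scale gives the factor t/2, see
        \<open>q_lap\<close>.\<close>
      define q where "q u z = (?N * kernel 1 u z + 2 * ((norm z)\<^sup>2 / u\<^sup>2) * kernel 2 u z) / u ^ Suc CARD('n)" for u and z :: "real^'n"
      have q_deriv: "((\<lambda>u. m.scaled u z) has_real_derivative q u z) (at u)" if u: "u > 0" for u z
      proof -
        have "((\<lambda>u. - bump 1 ((norm z)\<^sup>2 / u\<^sup>2) / u ^ CARD('n)) has_real_derivative q u z) (at u)"
        proof -
          have 1: "((\<lambda>u. - bump 1 ((norm z)\<^sup>2 / u\<^sup>2)) has_real_derivative bump 2 ((norm z)\<^sup>2 / u\<^sup>2) * (2 * (norm z)\<^sup>2 / u ^ 3)) (at u)"
          proof -
            have "((\<lambda>u. c / u\<^sup>2) has_real_derivative - (2 * c / u ^ 3)) (at u)" for c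
              using u by (auto intro!: derivative_eq_intros simp: field_simps power2_eq_square power3_eq_cube power4_eq_xxxx)
            from DERIV_minus[OF bump_DERIV[OF this, of 1]] show ?thesis by (simp add: numeral_2_eq_2 One_nat_def)
          qed
          have 2: "((\<lambda>u. u ^ CARD('n)) has_real_derivative ?N * u ^ (CARD('n) - 1)) (at u)"
            by (auto intro!: derivative_eq_intros simp: One_nat_def)
          have N: "u ^ CARD('n) = u ^ (CARD('n) - 1) * u"
            using power_minus_mult[of "CARD('n)" u] by simp
          have "((\<lambda>u. - bump 1 ((norm z)\<^sup>2 / u\<^sup>2) / u ^ CARD('n)) has_real_derivative
             (bump 2 ((norm z)\<^sup>2 / u\<^sup>2) * (2 * (norm z)\<^sup>2 / u ^ 3) * u ^ CARD('n)
               - - bump 1 ((norm z)\<^sup>2 / u\<^sup>2) * (?N * u ^ (CARD('n) - 1))) / (u ^ CARD('n) * u ^ CARD('n))) (at u)"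
            by (rule DERIV_divide[OF 1 2]) (use u in simp)
          also have "(bump 2 ((norm z)\<^sup>2 / u\<^sup>2) * (2 * (norm z)\<^sup>2 / u ^ 3) * u ^ CARD('n)
               - - bump 1 ((norm z)\<^sup>2 / u\<^sup>2) * (?N * u ^ (CARD('n) - 1))) / (u ^ CARD('n) * u ^ CARD('n)) = q u z"
            unfolding q_def kernel_def N power_Suc using u
            by (simp add: field_simps power2_eq_square power3_eq_cube)
          finally show ?thesis .
        qed
        then show ?thesis
        proof (rule has_field_derivative_transform_within_open[where S="{0<..}"])
          show "- bump 1 ((norm z)\<^sup>2 / v\<^sup>2) / v ^ CARD('n) = m.scaled v z" if "v \<in> {0<..}" for v
            using scaled_kernel_1[of v z] that by (simp only: kernel_def greaterThan_iff)
        qed (use u in auto)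
      qed
      \<comment> \<open>With \<theta> = |z|^2/u^2 the numerator of q is a function of \<theta> alone
        that vanishes for \<theta> >= 1, so one constant bounds it for all z and u.\<close>
      have "compact ((\<lambda>\<theta>. ?N * bump 1 \<theta> + 2 * \<theta> * bump 2 \<theta>) ` {0..1})"
        by (intro compact_continuous_image continuous_intros) auto
      then obtain C where C: "\<And>\<theta>. 0 \<le> \<theta> \<Longrightarrow> \<theta> \<le> 1 \<Longrightarrow> \<bar>?N * bump 1 \<theta> + 2 * \<theta> * bump 2 \<theta>\<bar> \<le> C"
        by (force dest!: compact_imp_bounded simp: bounded_iff)
      have C0: "C \<ge> 0" using C[of 0] by linarith
      have C': "\<bar>?N * bump 1 \<theta> + 2 * \<theta> * bump 2 \<theta>\<bar> \<le> C" if "0 \<le> \<theta>" for \<theta>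
        using C[of \<theta>] C0 that bump_eq_0[of \<theta>] by (cases "\<theta> \<le> 1") auto
      have q_bound: "\<bar>q u z\<bar> \<le> C / (t / 2) ^ Suc CARD('n)" if "t / 2 \<le> u" for u z
      proof -
        have u: "u > 0" using t that by simp
        have "\<bar>q u z\<bar> = \<bar>?N * bump 1 ((norm z)\<^sup>2 / u\<^sup>2) + 2 * ((norm z)\<^sup>2 / u\<^sup>2) * bump 2 ((norm z)\<^sup>2 / u\<^sup>2)\<bar> / u ^ Suc CARD('n)"
          unfolding q_def kernel_def using u by (simp add: abs_divide)
        also have "\<dots> \<le> C / (t / 2) ^ Suc CARD('n)"
          using C0 t that by (intro frac_le C' power_mono) auto
        finally show ?thesis .
      qed
      have qc: "continuous_on UNIV (q t)"
        unfolding q_def divide_inverse by (intro continuous_intros continuous_kernel)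
      have qm: "q t \<in> borel_measurable borel" by (rule borel_measurable_continuous_onI[OF qc])
      have ab: "integrable (lebesgue \<Otimes>\<^sub>M lebesgue) (\<lambda>z. a (fst z) * b (snd z))" by (rule integrable_pair_mult[OF ai bi])
      have pi: "integrable (lebesgue \<Otimes>\<^sub>M lebesgue) (\<lambda>z. q t (fst z - snd z) * (a (fst z) * b (snd z)))"
        by (rule integrable_cmult_bounded[OF ab borel_measurable_lebesgue_pair_diff[OF qm] q_bound]) (use t in simp)
      have D: "(F has_real_derivative (LINT z|(lebesgue \<Otimes>\<^sub>M lebesgue). q t (fst z - snd z) * (a (fst z) * b (snd z)))) (at t)"
        unfolding F_def m.bilin_def
      \<comment> \<open>Staying above t/2 keeps the negative powers of u bounded, so that a multiple
        of \<bar>a b\<bar> dominates.\<close>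
      proof (rule DERIV_parametric_integral[where r="t/2" and s=1 and w="\<lambda>z. C / (t / 2) ^ Suc CARD('n) * \<bar>a (fst z) * b (snd z)\<bar>"
            and f'="\<lambda>u z. q u (fst z - snd z) * (a (fst z) * b (snd z))"])
        show "integrable (lebesgue \<Otimes>\<^sub>M lebesgue) (\<lambda>z. a (fst z) * b (snd z) * m.scaled u (fst z - snd z))" if "t / 2 < u" for u
          using m.bilin_integrable_L1(1)[OF _ am a1 bi, of u] that t by simp
        show "((\<lambda>u. a (fst z) * b (snd z) * m.scaled u (fst z - snd z)) has_real_derivative q u (fst z - snd z) * (a (fst z) * b (snd z))) (at u)"
          if "t / 2 < u" for u and z :: "(real^'n) \<times> (real^'n)"
          using DERIV_cmult[OF q_deriv[of u "fst z - snd z"], of "a (fst z) * b (snd z)"] that t by (simp add: mult.commute)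
        show "\<bar>q u (fst z - snd z) * (a (fst z) * b (snd z))\<bar> \<le> C / (t / 2) ^ Suc CARD('n) * \<bar>a (fst z) * b (snd z)\<bar>"
          if "t / 2 < u" for u and z :: "(real^'n) \<times> (real^'n)"
          using q_bound[of u "fst z - snd z"] that by (subst abs_mult) (intro mult_right_mono, auto)
        show "integrable (lebesgue \<Otimes>\<^sub>M lebesgue) (\<lambda>z. C / (t / 2) ^ Suc CARD('n) * \<bar>a (fst z) * b (snd z)\<bar>)"
          by (intro integrable_mult_right integrable_abs ab)
        show "(\<lambda>z. q t (fst z - snd z) * (a (fst z) * b (snd z))) \<in> borel_measurable (lebesgue \<Otimes>\<^sub>M lebesgue)"
          using pi by (rule borel_measurable_integrable)
      qed (use t in auto)
      have q_lap: "q t (x - y) = (t / 2) / t ^ CARD('n) * laplacian (\<lambda>y. kernel 0 t (y - x)) y" for x y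
      proof -
        have "laplacian (\<lambda>y. kernel 0 t (y - x)) y = (4 * ((norm (x - y))\<^sup>2 / t\<^sup>2) * kernel 2 t (x - y) + 2 * ?N * kernel 1 t (x - y)) / t\<^sup>2"
          using laplacian_kernel[where n=0 and t=t and y=x and x=y] kernel_swap[of _ t x y] norm_minus_commute[of x y]
          by (simp add: One_nat_def numeral_2_eq_2)
        moreover have "(t / 2) / t ^ CARD('n) * ((4 * r * k2 + 2 * ?N * k1) / t\<^sup>2) = (?N * k1 + 2 * r * k2) / t ^ Suc CARD('n)" for r k1 k2
          using t by (simp add: field_simps power2_eq_square)
        ultimately show ?thesis unfolding q_def by (simp only:)
      qed
      have inner: "a x * (LINT y|lebesgue. b y * q t (x - y)) = (t / 2) * (a x * (LINT y|lebesgue. d y * k.scaled t (x - y)))" for x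
      proof (cases "norm x \<le> R")
        case True
        note loc = kernel_local[OF t(1) less_imp_le[OF t(2)] True]
        have bq: "b y * q t (x - y) = \<mu> y * q t (x - y)" for y
        proof -
          have split: "c * q t (x - y) = (?N * (c * kernel 1 t (x - y)) + 2 * ((norm (x - y))\<^sup>2 / t\<^sup>2) * (c * kernel 2 t (x - y))) / t ^ Suc CARD('n)" for c
            unfolding q_def times_divide_eq_right by (simp only: distrib_left mult_ac)
          show ?thesis unfolding split b_def loc ..
        qed
        have "(LINT y|lebesgue. b y * q t (x - y)) = (LINT y|lebesgue. (t / 2) / t ^ CARD('n) * (\<mu> y * laplacian (\<lambda>y. kernel 0 t (y - x)) y))"
          by (intro Bochner_Integration.integral_cong refl) (simp only: bq, simp only: q_lap mult.left_commute)
        also have "\<dots> = (t / 2) / t ^ CARD('n) * (LINT y|lebesgue. D y * kernel 0 t (y - x))"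
          by (simp add: wlD[OF kernel_Cc_infty[OF t(1)]])
        also have "\<dots> = (t / 2) * (LINT y|lebesgue. D y * k.scaled t (x - y))"
          by (simp add: scaled_kernel_0[OF t(1)] kernel_swap[of 0 t x])
        also have "(LINT y|lebesgue. D y * k.scaled t (x - y)) = (LINT y|lebesgue. d y * k.scaled t (x - y))"
          unfolding d_def scaled_kernel_0[OF t(1)] times_divide_eq_right loc ..
        finally show ?thesis by simp
      qed (simp add: a_def)
      have "(LINT z|(lebesgue \<Otimes>\<^sub>M lebesgue). q t (fst z - snd z) * (a (fst z) * b (snd z))) =
          (LINT x|lebesgue. a x * (LINT y|lebesgue. b y * q t (x - y)))"
        using leb2.integral_fst'[OF pi, symmetric] by (simp add: mult.assoc mult.commute[of "q t _"])
      also have "\<dots> = (t / 2) * H t"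
        unfolding inner H_def k.bilin_iterated(1)[OF k.bilin_integrable_L1(1)[OF t(1) am a1 di]] by simp
      finally show ?thesis using D by (simp only:)
    qed
    have int_ad: "integrable lebesgue (\<lambda>x. a x * d x)" by (rule integrable_cmult_bounded[OF di am a1])
    have ad: "a x * d x = indicator (cball 0 R) x * (indicator A x * D x)" for x
      by (auto simp: a_def d_def indicator_def)
    have ad_le: "a x * d x \<le> 0" for x by (auto simp: ad indicator_def A_def)
    have "(LINT x|lebesgue. a x * d x) = 0"
    proof (rule ccontr)
      assume "(LINT x|lebesgue. a x * d x) \<noteq> 0"
      moreover have "0 \<le> (LINT x|lebesgue. - (a x * d x))"
        by (rule Bochner_Integration.integral_nonneg) (use ad_le in simp)
      then have "(LINT x|lebesgue. a x * d x) \<le> 0" by simp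
      ultimately have neg: "k.mass * (LINT x|lebesgue. a x * d x) < 0"
        using mass_kernel_0_pos[where 'n='n] by (simp add: mult_pos_neg)
      \<comment> \<open>The limit of H at 0 is \<open>mass\<close> times the integral of D over the
        suspected set, which is negative; nonnegative values of H at arbitrarily small scales would
        contradict it.\<close>
      have "\<exists>t0>0. t0 < 1 \<and> (\<forall>t. 0 < t \<longrightarrow> t < t0 \<longrightarrow> H t < 0)"
      proof (rule ccontr)
        assume con: "\<not> ?thesis"
        have "\<exists>t. 0 < t \<and> t < 1 / (real n + 2) \<and> H t \<ge> 0" for n
          using con by (auto simp: not_less dest!: spec[of _ "1 / (real n + 2)"])
        then obtain \<tau> where \<tau>: "\<And>n. 0 < \<tau> n" "\<And>n. \<tau> n < 1 / (real n + 2)" "\<And>n. H (\<tau> n) \<ge> 0" by metis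
        have "\<tau> \<longlonglongrightarrow> 0"
        proof (rule tendsto_sandwich[OF _ _ tendsto_const inverse_Suc_seq(1)])
          have "\<tau> n \<le> 1 / (real n + 1)" for n
            using \<tau>(2)[of n] frac_le[of 1 1 "real n + 1" "real n + 2"] by simp
          then show "\<forall>\<^sub>F n in sequentially. \<tau> n \<le> 1 / (real n + 1)" by simp
        qed (use \<tau>(1) in \<open>simp add: less_imp_le\<close>)
        then have "(\<lambda>n. H (\<tau> n)) \<longlonglongrightarrow> k.mass * (LINT x|lebesgue. a x * d x)"
          unfolding H_def by (rule k.bilin_tendsto_L1[OF ai a1 di \<tau>(1)])
        then have "0 \<le> k.mass * (LINT x|lebesgue. a x * d x)"
          by (rule LIMSEQ_le_const) (use \<tau>(3) in auto)
        with neg show False by simp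
      qed
      then obtain t0 where t0: "t0 > 0" "t0 < 1" "\<And>t. 0 < t \<Longrightarrow> t < t0 \<Longrightarrow> H t < 0" by blast
      have dec: "F u > F v" if "0 < u" "u < v" "v < t0" for u v
      proof (rule DERIV_neg_imp_decreasing[OF that(2)])
        fix x assume "u \<le> x" "x \<le> v"
        then show "\<exists>y. (F has_real_derivative y) (at x) \<and> y < 0"
          using F_deriv[of x] t0 that by (intro exI[of _ "x / 2 * H x"] conjI) (auto intro!: mult_pos_neg)
      qed
      have "(\<lambda>n. F (t0 / 4 * (1 / (real n + 1)))) \<longlonglongrightarrow> m.mass * (LINT x|lebesgue. a x * b x)"
        unfolding F_def
      proof (rule m.bilin_tendsto_L1[OF ai a1 bi])
        show "t0 / 4 * (1 / (real n + 1)) > 0" for n using t0 by simp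
        show "(\<lambda>n. t0 / 4 * (1 / (real n + 1))) \<longlonglongrightarrow> 0"
          using tendsto_mult[OF tendsto_const inverse_Suc_seq(1), of "t0 / 4"] by simp
      qed
      moreover have "a x * b x = 0" for x by (auto simp: a_def b_def A_def indicator_def)
      ultimately have lim: "(\<lambda>n. F (t0 / 4 * (1 / (real n + 1)))) \<longlonglongrightarrow> 0" by simp
      \<comment> \<open>F decreases and tends to 0 as t -> 0, since \<mu> vanishes on A. The limit
        gives only F(t0/3) <= 0; the further point t0/2 restores strictness and contradicts F >=
        0.\<close>
      have "F (t0 / 3) \<le> F (t0 / 4 * (1 / (real n + 1)))" for n
      proof -
        have "t0 / 4 * (1 / (real n + 1)) \<le> t0 / 4 * 1"
          using t0 inverse_Suc_seq(3)[of n] by (intro mult_left_mono) auto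
        then show ?thesis using t0 by (intro less_imp_le dec) auto
      qed
      then have "F (t0 / 3) \<le> 0" using LIMSEQ_le_const[OF lim] by blast
      moreover have "F (t0 / 2) < F (t0 / 3)" using t0 by (intro dec) auto
      moreover have "F (t0 / 2) \<ge> 0" using t0 by (intro F_nonneg) auto
      ultimately show False by simp
    qed
    then have "(LINT x|lebesgue. - (a x * d x)) = 0" by simp
    then have "AE x in lebesgue. - (a x * d x) = 0"
      using integral_nonneg_eq_0_iff_AE[of lebesgue "\<lambda>x. - (a x * d x)"] int_ad ad_le by simp
    then show ?thesis
      by eventually_elim (auto simp: ad A_def indicator_def split: if_splits)
  qed
  then have "AE x in lebesgue. \<forall>n. norm x \<le> real n \<longrightarrow> \<mu> x = 0 \<longrightarrow> 0 \<le> D x"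
    unfolding AE_all_countable by blast
  then show ?thesis by eventually_elim (meson real_arch_simple)
qed

section \<open>The weighted Hardy inequality\<close>

text \<open>The field - grad psi / psi is x/|x|^2 times a + 1/(2 log (1/|x|)) with a = (N-2)/2, and
  in s = |x|^2 the second summand is 1/ln (1/s). Adding \<open>exp 1\<close> inside the logarithm
  keeps it in (0, 1] for all s > 0 without changing its behaviour at 0.\<close>

definition log_corr :: "real \<Rightarrow> real" where
  "log_corr s = 1 / ln (exp 1 + 1 / s)"

text \<open>For the field F = x (a + \<open>log_corr\<close> s)/s with s = |x|^2 and N = 2 a + 2,
  this is div F - |F|^2 minus a^2/s. It is the logarithmic gain in Hardy's inequality.\<close>

definition log_potential :: "real \<Rightarrow> real" where
  "log_potential s = (log_corr s)\<^sup>2 * (1 - exp 1 * s) / ((1 + exp 1 * s) * s)"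

lemma ln_exp_1_plus: "s > 0 \<Longrightarrow> ln (exp 1 + 1 / s) \<ge> 1" for s :: real
  by (subst ln_ge_iff) (auto intro: add_pos_pos)

lemma log_corr_bounds: assumes "s > 0" shows "0 < log_corr s" "log_corr s \<le> 1"
  using ln_exp_1_plus[OF assms] by (auto simp: log_corr_def)

lemma log_corr_DERIV:
  assumes "s > 0"
  shows "(log_corr has_real_derivative (log_corr s)\<^sup>2 / (s * (1 + exp 1 * s))) (at s)"
proof -
  have p: "exp 1 + 1 / s > 0" using assms by (intro add_pos_pos) auto
  have L: "ln (exp 1 + 1 / s) \<noteq> 0" using ln_exp_1_plus[OF assms] by linarith
  have "((\<lambda>s. 1 / ln (exp 1 + 1 / s)) has_real_derivative
      - ((- (1 / s\<^sup>2)) / (exp 1 + 1 / s)) / (ln (exp 1 + 1 / s))\<^sup>2) (at s)"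
    using assms p L by (auto intro!: derivative_eq_intros simp: power2_eq_square)
  also have "- ((- (1 / s\<^sup>2)) / (exp 1 + 1 / s)) / (ln (exp 1 + 1 / s))\<^sup>2 = (log_corr s)\<^sup>2 / (s * (1 + exp 1 * s))"
  proof -
    have "s\<^sup>2 * (exp 1 + 1 / s) = s * (1 + exp 1 * s)"
      using assms by (simp add: field_simps power2_eq_square)
    then show ?thesis by (simp add: log_corr_def power_divide)
  qed
  finally show ?thesis unfolding log_corr_def[abs_def] .
qed

text \<open>For \<open>exp 1 * s > 1\<close> the gain turns negative. This bound supplies the offset
  that makes Fatou's lemma applicable, and it limits what has to be compensated away from the
  origin.\<close>

lemma log_potential_ge: assumes "s > 0" shows "log_potential s \<ge> - exp 1"
proof (cases "exp 1 * s \<le> 1")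
  case True
  then have "log_potential s \<ge> 0" using assms by (simp add: log_potential_def)
  then show ?thesis using exp_gt_zero[of "1::real"] by linarith
next
  case False
  let ?t = "exp 1 * s"
  have c: "(log_corr s)\<^sup>2 \<le> 1" using log_corr_bounds[OF assms] by (simp add: power_le_one)
  have "(log_corr s)\<^sup>2 * (?t - 1) \<le> 1 * (?t + 1)"
    using c False by (intro mult_mono) auto
  also have "\<dots> \<le> ?t * (1 + ?t)"
  proof -
    have "1 * (?t + 1) \<le> ?t * (?t + 1)" using False by (intro mult_right_mono) auto
    then show ?thesis by (simp only: add.commute)
  qed
  also have "\<dots> = exp 1 * ((1 + ?t) * s)" by simp
  finally have "(log_corr s)\<^sup>2 * (?t - 1) \<le> exp 1 * ((1 + ?t) * s)" .
  then have "(log_corr s)\<^sup>2 * (?t - 1) / ((1 + ?t) * s) \<le> exp 1"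
    using assms by (subst pos_divide_le_eq) (auto intro!: mult_pos_pos add_pos_pos)
  moreover have "log_potential s = - ((log_corr s)\<^sup>2 * (?t - 1) / ((1 + ?t) * s))"
    unfolding log_potential_def minus_divide_left minus_mult_right minus_diff_eq ..
  ultimately show ?thesis by linarith
qed

text \<open>With t = \<open>exp 1 * s\<close> and l = - ln s the logarithm in
  \<open>log_corr\<close> is l + ln (1 + t) <= l (1 + t). The relative error is thus of order t, and
  after division by s it is bounded. The condition on s makes t <= 1 and l >= 1.\<close>

lemma log_potential_near_0:
  assumes s: "0 < s" "s \<le> exp (- 1)"
  shows "1 / (s * (ln s)\<^sup>2) \<le> log_potential s + 4 * exp 1"
proof -
  define t where "t = exp 1 * s"
  define l where "l = - ln s"
  have t: "0 < t" "t \<le> 1" using s by (auto simp: t_def exp_minus field_simps)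
  have l: "l \<ge> 1" using s ln_le_cancel_iff[of s "exp (-1)"] by (simp add: l_def)
  have "exp 1 + 1 / s = (1 + t) / s" using s by (simp add: t_def field_simps)
  then have "ln (exp 1 + 1 / s) = ln (1 + t) + l" using s t by (simp add: l_def ln_div)
  also have "\<dots> \<le> t + l" using ln_add_one_self_le_self[of t] t by simp
  also have "\<dots> \<le> l * (1 + t)" using l t by (simp add: distrib_left)
  finally have L: "ln (exp 1 + 1 / s) \<le> l * (1 + t)" .
  have c: "1 / (l * (1 + t)) \<le> log_corr s"
    unfolding log_corr_def using L ln_exp_1_plus[OF s(1)] by (intro divide_left_mono) (use l t in auto)
  \<comment> \<open>Two factors 1 + t come from the squared logarithm and one from the denominator
    of \<open>log_potential\<close>; together with the numerator 1 - t they give the slope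
    -4.\<close>
  have "(1 - 4 * t) * (1 + t) ^ 3 \<le> 1 - t"
  proof -
    have "1 - t - (1 - 4 * t) * (1 + t) ^ 3 = 9 * t\<^sup>2 + 11 * t ^ 3 + 4 * t ^ 4"
      by (simp add: power2_eq_square power3_eq_cube power4_eq_xxxx algebra_simps)
    moreover have "9 * t\<^sup>2 + 11 * t ^ 3 + 4 * t ^ 4 \<ge> 0" using t by simp
    ultimately show ?thesis by linarith
  qed
  then have "1 - 4 * t \<le> (1 - t) / (1 + t) ^ 3" using t by (simp add: pos_le_divide_eq)
  then have "(1 - 4 * t) / (l\<^sup>2 * s) \<le> (1 - t) / (1 + t) ^ 3 / (l\<^sup>2 * s)"
    using l s by (intro divide_right_mono) auto
  also have "\<dots> = (1 / (l * (1 + t)))\<^sup>2 * (1 - t) / ((1 + t) * s)"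
    using l s t by (simp add: power2_eq_square power3_eq_cube)
  also have "\<dots> \<le> (log_corr s)\<^sup>2 * (1 - t) / ((1 + t) * s)"
    using c l s t by (intro divide_right_mono mult_right_mono power_mono) auto
  also have "\<dots> = log_potential s" by (simp add: log_potential_def t_def)
  finally have "(1 - 4 * t) / (l\<^sup>2 * s) \<le> log_potential s" .
  moreover have "(1 - 4 * t) / (l\<^sup>2 * s) = 1 / (s * (ln s)\<^sup>2) - 4 * exp 1 / l\<^sup>2"
    using l s by (simp add: t_def diff_divide_distrib l_def mult_ac)
  moreover have "4 * exp 1 / l\<^sup>2 \<le> 4 * exp (1::real)" using l by (simp add: divide_le_eq one_le_power)
  ultimately show ?thesis by linarith
qed

text \<open>With F = x g(s), \<tau> = |x|^2 and N = 2 a + 2 the right side is div F - |F|^2. For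
  \<delta> = 0 there is equality, because 2 a A - A^2 = a^2 - c^2 for A = a + c. The regularisation
  only adds \<delta>/s^2 times a nonnegative quantity.\<close>

lemma radial_riccati:
  fixes a \<delta> \<tau> s :: real
  assumes a: "a \<ge> 0" and \<delta>: "\<delta> \<ge> 0" and \<tau>: "\<tau> \<ge> 0" and s: "s = \<tau> + \<delta>" "s > 0"
  defines "g \<equiv> (a + log_corr s) / s"
    and "g' \<equiv> - (a + log_corr s) / s\<^sup>2 + (log_corr s)\<^sup>2 / (s * (1 + exp 1 * s)) / s"
  shows "a\<^sup>2 / s + log_potential s \<le> (2 * a + 2) * g + 2 * \<tau> * g' - \<tau> * g\<^sup>2"
proof -
  define c where "c = log_corr s"
  define X where "X = c\<^sup>2 / (1 + exp 1 * s)"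
  define A where "A = a + c"
  have c: "0 < c" "c \<le> 1" using log_corr_bounds[OF s(2)] by (auto simp: c_def)
  have es: "1 + exp 1 * s > 1" using s by simp
  have X: "X \<le> A"
  proof -
    have "X \<le> c\<^sup>2" unfolding X_def using es by (simp add: divide_le_eq mult_le_cancel_left1)
    also have "\<dots> \<le> c" using c by (simp add: power2_eq_square mult_left_le)
    finally show ?thesis using a by (simp add: A_def)
  qed
  have "2 * X - c\<^sup>2 = c\<^sup>2 * (1 - exp 1 * s) / (1 + exp 1 * s)"
    unfolding X_def using es by (simp add: field_simps)
  then have q: "log_potential s = (2 * X - c\<^sup>2) / s" by (simp add: log_potential_def c_def)
  have g': "g' = (X - A) / s\<^sup>2"
    unfolding g'_def X_def A_def c_def by (simp add: diff_divide_distrib add_divide_distrib power2_eq_square mult_ac)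
  have \<tau>s: "\<tau> = s - \<delta>" using s by simp
  have "(2 * a + 2) * g + 2 * \<tau> * g' - \<tau> * g\<^sup>2 =
     (a\<^sup>2 + (2 * X - c\<^sup>2)) / s + \<delta> / s\<^sup>2 * (2 * (A - X) + A\<^sup>2)"
    unfolding g' g_def \<tau>s c_def[symmetric] A_def
    using s(2) by (simp add: field_simps power2_eq_square)
  moreover have "\<delta> / s\<^sup>2 * (2 * (A - X) + A\<^sup>2) \<ge> 0" using \<delta> X by simp
  ultimately show ?thesis by (simp add: q add_divide_distrib)
qed

lemma radial_DERIV:
  assumes "s > 0"
  shows "((\<lambda>s. (a + log_corr s) / s) has_real_derivative
    - (a + log_corr s) / s\<^sup>2 + (log_corr s)\<^sup>2 / (s * (1 + exp 1 * s)) / s) (at s)"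
proof -
  have "((\<lambda>s. (a + log_corr s) / s) has_real_derivative
     ((0 + (log_corr s)\<^sup>2 / (s * (1 + exp 1 * s))) * s - (a + log_corr s) * 1) / (s * s)) (at s)"
    by (intro DERIV_divide DERIV_add DERIV_const DERIV_ident log_corr_DERIV assms) (use assms in simp)
  also have "((0 + (log_corr s)\<^sup>2 / (s * (1 + exp 1 * s))) * s - (a + log_corr s) * 1) / (s * s) =
    - (a + log_corr s) / s\<^sup>2 + (log_corr s)\<^sup>2 / (s * (1 + exp 1 * s)) / s"
  proof -
    have "(Y * s - Z) / (s * s) = - Z / s\<^sup>2 + Y / s" for Y Z
      using assms by (simp add: field_simps power2_eq_square)
    then show ?thesis by (simp only: add_0 mult_1_right)
  qed
  finally show ?thesis .
qed

text \<open>No dominating function is available for the singular weights; their integrability comes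
  from bounds that are uniform in the regularisation.\<close>

lemma Fatou_bound:
  fixes f :: "nat \<Rightarrow> 'a \<Rightarrow> real"
  assumes int: "\<And>n. integrable M (f n)" and nonneg: "\<And>n. AE x in M. 0 \<le> f n x"
    and bd: "\<And>n. integral\<^sup>L M (f n) \<le> K" and lim: "AE x in M. (\<lambda>n. f n x) \<longlonglongrightarrow> g x"
    and gm: "g \<in> borel_measurable M"
  shows "integrable M g" "integral\<^sup>L M g \<le> K"
proof -
  have "AE x in M. \<forall>n. 0 \<le> f n x" using nonneg by (simp add: AE_all_countable)
  then have g0: "AE x in M. 0 \<le> g x"
    using lim by eventually_elim (auto intro: LIMSEQ_le_const)
  have K: "K \<ge> 0" using bd[of 0] integral_nonneg_AE[OF nonneg[of 0]] by linarith
  have "(\<integral>\<^sup>+x. ennreal (g x) \<partial>M) = (\<integral>\<^sup>+x. liminf (\<lambda>n. ennreal (f n x)) \<partial>M)"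
    using lim by (intro nn_integral_cong_AE, eventually_elim) (auto intro!: lim_imp_Liminf[symmetric] tendsto_ennrealI)
  also have "\<dots> \<le> liminf (\<lambda>n. \<integral>\<^sup>+x. ennreal (f n x) \<partial>M)"
    using int by (intro nn_integral_liminf) auto
  also have "\<dots> = liminf (\<lambda>n. ennreal (integral\<^sup>L M (f n)))"
    using int nonneg by (simp add: nn_integral_eq_integral)
  also have "\<dots> \<le> ennreal K"
    by (intro Liminf_le) (auto intro!: always_eventually ennreal_leI bd)
  finally have le: "(\<integral>\<^sup>+x. ennreal (g x) \<partial>M) \<le> ennreal K" .
  show ig: "integrable M g"
  proof (rule integrableI_nonneg[OF gm g0])
    show "(\<integral>\<^sup>+x. ennreal (g x) \<partial>M) < \<infinity>" using le by (simp add: order_le_less_trans)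
  qed
  show "integral\<^sup>L M g \<le> K"
    using le K by (simp add: nn_integral_eq_integral[OF ig g0])
qed

section \<open>The square expansion with a smooth vector field\<close>

lemma norm_grad_sq: "(norm (grad v x))\<^sup>2 = (\<Sum>i\<in>UNIV. (partial_deriv i v x)\<^sup>2)"
  by (simp add: grad_def norm_vec_def L2_set_def sum_nonneg)

lemma laplacian_square:
  assumes "smooth v"
  shows "laplacian (\<lambda>x. v x * v x) x = (\<Sum>i\<in>UNIV. 2 * partial_deriv i (\<lambda>x. v x * partial_deriv i v x) x)"
proof -
  have d: "v differentiable at y" "partial_deriv i v differentiable at y" for i y
    using assms by (auto intro: smooth_differentiable)
  have "partial_deriv i (\<lambda>x. v x * v x) = (\<lambda>x. 2 * (v x * partial_deriv i v x))" for i
    by (rule ext) (simp add: partial_deriv_mult[OF d(1) d(1)])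
  moreover have "partial_deriv i (\<lambda>x. 2 * (v x * partial_deriv i v x)) x = 2 * partial_deriv i (\<lambda>x. v x * partial_deriv i v x) x" for i
    by (subst partial_deriv_mult) (auto simp: partial_deriv_const intro!: smooth_differentiable smooth_mult smooth_partial_deriv assms)
  ultimately show ?thesis by (simp add: laplacian_def)
qed

text \<open>V and D stand for the weak gradient and Laplacian of m. \<open>V_zero\<close> makes V
  equal to m times V/m in spite of division by 0, \<open>D_zero\<close> has the sign that is needed
  where P forgets D, and \<open>fisher\<close> makes m P and m \<bar>V/m\<bar>^2 integrable against
  test functions.\<close>

locale weak_density =
  fixes m :: "real^'n \<Rightarrow> real" and V :: "real^'n \<Rightarrow> real^'n" and D :: "real^'n \<Rightarrow> real"
  assumes m_nonneg: "AE x in lebesgue. 0 \<le> m x"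
    and weak_grad: "has_weak_grad m V"
    and weak_lap: "has_weak_laplacian m D"
    and V_zero: "AE x in lebesgue. m x = 0 \<longrightarrow> V x = 0"
    and D_zero: "AE x in lebesgue. m x = 0 \<longrightarrow> 0 \<le> D x"
    and fisher: "(\<lambda>x. (norm (V x))\<^sup>2 / m x) \<in> L1_loc"
begin

definition P :: "real^'n \<Rightarrow> real" where
  "P x = 1/4 * (norm (V x /\<^sub>R m x))\<^sup>2 - 1/2 * (D x / m x)"

lemma m_L1_loc: "m \<in> L1_loc" and V_L1_loc: "(\<lambda>x. V x $ i) \<in> L1_loc" and D_L1_loc: "D \<in> L1_loc"
  using weak_grad weak_lap L1_loc_nth unfolding has_weak_grad_def has_weak_laplacian_def by blast+

lemma m_borel: "m \<in> borel_measurable lebesgue" and D_borel: "D \<in> borel_measurable lebesgue"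
  using L1_loc_borel m_L1_loc D_L1_loc by blast+

lemma V_borel: "V \<in> borel_measurable lebesgue"
  using weak_grad L1_loc_borel unfolding has_weak_grad_def by blast

lemma weak_gradD: "\<eta> \<in> Cc_infty \<Longrightarrow> (LINT x|lebesgue. m x * partial_deriv i \<eta> x) = - (LINT x|lebesgue. V x $ i * \<eta> x)"
  using weak_grad unfolding has_weak_grad_def by blast

lemma m_mult_integrable: "u \<in> Cc_infty \<Longrightarrow> integrable lebesgue (\<lambda>x. m x * u x)"
  by (rule L1_loc_mult_Cc_infty[OF m_L1_loc])

text \<open>This is true also where m vanishes, since all quotients are 0 there; the indicator keeps
  track of the part of D that P does not see.\<close>

lemma mP_eq: "m x * P x = 1/4 * ((norm (V x))\<^sup>2 / m x) - 1/2 * (indicator {x. m x \<noteq> 0} x * D x)"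
  by (simp add: P_def power_divide power2_eq_square indicator_def field_simps)

lemma support_borel: "(indicator {x. m x \<noteq> 0} :: real^'n \<Rightarrow> real) \<in> borel_measurable lebesgue"
proof -
  have "{x \<in> space lebesgue. m x \<noteq> 0} \<in> sets lebesgue" using m_borel by measurable
  then show ?thesis by (auto intro: borel_measurable_indicator)
qed

lemma D_supp_L1_loc: "(\<lambda>x. indicator {x. m x \<noteq> 0} x * D x) \<in> L1_loc"
proof (rule L1_locI)
  fix R
  have "integrable lebesgue (\<lambda>x. indicator {x. m x \<noteq> 0} x * (indicator (cball 0 R) x *\<^sub>R D x))"
    by (rule integrable_cmult_bounded[OF L1_loc_cball[OF D_L1_loc] support_borel, where B=1]) (auto simp: indicator_def)
  then show "integrable lebesgue (\<lambda>x. indicator (cball 0 R) x *\<^sub>R (indicator {x. m x \<noteq> 0} x * D x))"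
    by (simp add: mult.left_commute)
qed

lemma mP_integrable:
  assumes "u \<in> Cc_infty" shows "integrable lebesgue (\<lambda>x. m x * P x * u x)"
proof -
  have "integrable lebesgue (\<lambda>x. 1/4 * ((norm (V x))\<^sup>2 / m x * u x) - 1/2 * (indicator {x. m x \<noteq> 0} x * D x * u x))"
    by (intro Bochner_Integration.integrable_diff integrable_mult_right L1_loc_mult_Cc_infty fisher D_supp_L1_loc assms)
  then show ?thesis unfolding mP_eq by (simp only: left_diff_distrib mult.assoc)
qed

text \<open>Expansion of m |w + c V/(2m) + c F|^2, to be used with w the gradient of v and c = v.
  Afterwards m occurs as a denominator only below |V|^2, so zeros of m do no harm. The terms of the
  last sum stay together because the by-parts formula for v^2 F evaluates them jointly.\<close>

lemma square_pointwise:
  fixes w :: "'n \<Rightarrow> real" and F :: "'n \<Rightarrow> real"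
  assumes "0 \<le> m x" "m x = 0 \<longrightarrow> V x = 0"
  shows "0 \<le> m x * (\<Sum>i\<in>UNIV. (w i)\<^sup>2) + 1/4 * (c\<^sup>2 * ((norm (V x))\<^sup>2 / m x))
     + (\<Sum>i\<in>UNIV. m x * (F i)\<^sup>2 * c\<^sup>2) + (\<Sum>i\<in>UNIV. V x $ i * (c * w i))
     + (\<Sum>i\<in>UNIV. m x * (2 * c * w i * F i) + V x $ i * (c\<^sup>2 * F i))"
proof (cases "m x = 0")
  case True
  then show ?thesis using assms by simp
next
  case False
  then have mx: "m x > 0" using assms by simp
  have "0 \<le> (\<Sum>i\<in>UNIV. m x * (w i + c * V x $ i / (2 * m x) + F i * c)\<^sup>2)"
    using mx by (intro sum_nonneg) auto
  also have "\<dots> = (\<Sum>i\<in>UNIV. m x * (w i)\<^sup>2 + 1/4 * (c\<^sup>2 * ((V x $ i)\<^sup>2 / m x)) + m x * (F i)\<^sup>2 * c\<^sup>2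
      + V x $ i * (c * w i) + (m x * (2 * c * w i * F i) + V x $ i * (c\<^sup>2 * F i)))"
    using mx by (intro sum.cong refl) (simp add: field_simps power2_eq_square)
  also have "\<dots> = m x * (\<Sum>i\<in>UNIV. (w i)\<^sup>2) + 1/4 * (c\<^sup>2 * ((\<Sum>i\<in>UNIV. (V x $ i)\<^sup>2) / m x))
     + (\<Sum>i\<in>UNIV. m x * (F i)\<^sup>2 * c\<^sup>2) + (\<Sum>i\<in>UNIV. V x $ i * (c * w i))
     + (\<Sum>i\<in>UNIV. m x * (2 * c * w i * F i) + V x $ i * (c\<^sup>2 * F i))"
    by (simp add: sum.distrib sum_distrib_left sum_divide_distrib)
  also have "(\<Sum>i\<in>UNIV. (V x $ i)\<^sup>2) = (norm (V x))\<^sup>2"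
    by (simp add: norm_vec_def L2_set_def sum_nonneg)
  finally show ?thesis .
qed

text \<open>The vector field v grad v has half the Laplacian of v^2 as its divergence, so testing
  the weak gradient with it amounts to testing the weak Laplacian with v^2.\<close>

lemma integral_V_grad:
  assumes v: "v \<in> Cc_infty"
  shows "(\<Sum>i\<in>UNIV. LINT x|lebesgue. V x $ i * (v x * partial_deriv i v x)) = - 1/2 * (LINT x|lebesgue. D x * (v x)\<^sup>2)"
proof -
  have sv: "smooth v" by (rule Cc_infty_smooth[OF v])
  have w: "(\<lambda>x. v x * partial_deriv i v x) \<in> Cc_infty" for i
    by (intro Cc_infty_mult[OF v] smooth_partial_deriv sv)
  have "(LINT x|lebesgue. D x * (v x * v x)) = (LINT x|lebesgue. m x * laplacian (\<lambda>x. v x * v x) x)"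
    using weak_lap Cc_infty_mult[OF v sv] unfolding has_weak_laplacian_def by simp
  also have "\<dots> = (LINT x|lebesgue. (\<Sum>i\<in>UNIV. 2 * (m x * partial_deriv i (\<lambda>x. v x * partial_deriv i v x) x)))"
    by (simp add: laplacian_square[OF sv] sum_distrib_left mult.left_commute)
  also have "\<dots> = (\<Sum>i\<in>UNIV. (LINT x|lebesgue. 2 * (m x * partial_deriv i (\<lambda>x. v x * partial_deriv i v x) x)))"
    by (intro Bochner_Integration.integral_sum integrable_mult_right m_mult_integrable Cc_infty_partial_deriv w)
  also have "\<dots> = (\<Sum>i\<in>UNIV. - 2 * (LINT x|lebesgue. V x $ i * (v x * partial_deriv i v x)))"
    by (simp add: weak_gradD[OF w])
  finally show ?thesis by (simp add: power2_eq_square sum_negf flip: sum_distrib_left)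
qed

lemma vector_field_ineq:
  fixes F :: "'n \<Rightarrow> real^'n \<Rightarrow> real"
  assumes v: "v \<in> Cc_infty" and F: "\<And>i. smooth (F i)"
  shows "(LINT x|lebesgue. m x * ((v x)\<^sup>2 * (\<Sum>i\<in>UNIV. partial_deriv i (F i) x - (F i x)\<^sup>2)))
    \<le> (LINT x|lebesgue. m x * (norm (grad v x))\<^sup>2) + (LINT x|lebesgue. m x * P x * (v x)\<^sup>2)"
proof -
  have sv: "smooth v" by (rule Cc_infty_smooth[OF v])
  have v2: "(\<lambda>x. (v x)\<^sup>2) \<in> Cc_infty" using Cc_infty_mult[OF v sv] by (simp add: power2_eq_square)
  have vF: "(\<lambda>x. (v x)\<^sup>2 * F i x) \<in> Cc_infty" for i by (rule Cc_infty_mult[OF v2 F])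
  have vw: "(\<lambda>x. v x * partial_deriv i v x) \<in> Cc_infty" for i
    by (intro Cc_infty_mult[OF v] smooth_partial_deriv sv)
  have ww: "(\<lambda>x. (partial_deriv i v x)\<^sup>2) \<in> Cc_infty" for i
    using Cc_infty_mult[OF Cc_infty_partial_deriv[OF v] smooth_partial_deriv[OF sv]] by (simp add: power2_eq_square)
  have vwF: "(\<lambda>x. 2 * v x * partial_deriv i v x * F i x) \<in> Cc_infty" for i
    using Cc_infty_mult[OF v smooth_mult[OF smooth_const[of 2] smooth_mult[OF smooth_partial_deriv[OF sv, of i] F[of i]]]] by (simp add: mult_ac)
  have vdF: "(\<lambda>x. (v x)\<^sup>2 * partial_deriv i (F i) x) \<in> Cc_infty" for i
    by (intro Cc_infty_mult[OF v2] smooth_partial_deriv F)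
  have vF2: "(\<lambda>x. (v x)\<^sup>2 * (F i x)\<^sup>2) \<in> Cc_infty" for i
    by (intro Cc_infty_mult[OF v2] smooth_power F)
  have pd: "partial_deriv i (\<lambda>x. (v x)\<^sup>2 * F i x) x = 2 * v x * partial_deriv i v x * F i x + (v x)\<^sup>2 * partial_deriv i (F i) x" for i x
  proof -
    have "partial_deriv i (\<lambda>x. (v x)\<^sup>2) x = 2 * v x * partial_deriv i v x"
      using partial_deriv_mult[OF smooth_differentiable[OF sv] smooth_differentiable[OF sv], where x=x and i=i]
      by (simp add: power2_eq_square)
    then show ?thesis
      using partial_deriv_mult[OF smooth_differentiable[OF Cc_infty_smooth[OF v2]] smooth_differentiable[OF F[of i]], where x=x and i=i]
      by simp
  qed
  note [simp] = m_mult_integrable[OF ww] m_mult_integrable[OF vwF] m_mult_integrable[OF vF2] m_mult_integrable[OF vdF]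
    L1_loc_mult_Cc_infty[OF V_L1_loc vw] L1_loc_mult_Cc_infty[OF V_L1_loc vF]
    L1_loc_mult_Cc_infty[OF fisher v2, simplified] L1_loc_mult_Cc_infty[OF D_L1_loc v2] L1_loc_mult_Cc_infty[OF D_supp_L1_loc v2]
  define I1 where "I1 = (LINT x|lebesgue. m x * (norm (grad v x))\<^sup>2)"
  define I2 where "I2 = (LINT x|lebesgue. (norm (V x))\<^sup>2 / m x * (v x)\<^sup>2)"
  define I3 where "I3 = (\<Sum>i\<in>UNIV. LINT x|lebesgue. m x * ((v x)\<^sup>2 * (F i x)\<^sup>2))"
  define I4 where "I4 = (\<Sum>i\<in>UNIV. LINT x|lebesgue. V x $ i * (v x * partial_deriv i v x))"
  define I5 where "I5 = (\<Sum>i\<in>UNIV. LINT x|lebesgue. m x * ((v x)\<^sup>2 * partial_deriv i (F i) x))"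
  have i1: "integrable lebesgue (\<lambda>x. m x * (norm (grad v x))\<^sup>2)"
    by (simp add: norm_grad_sq sum_distrib_left)
  have by_parts: "(LINT x|lebesgue. m x * (2 * v x * partial_deriv i v x * F i x) + V x $ i * ((v x)\<^sup>2 * F i x))
      = - (LINT x|lebesgue. m x * ((v x)\<^sup>2 * partial_deriv i (F i) x))" for i
    using weak_gradD[OF vF, of i i] unfolding pd by (simp add: distrib_left)
  have "0 \<le> (LINT x|lebesgue. m x * (norm (grad v x))\<^sup>2 + 1/4 * ((norm (V x))\<^sup>2 / m x * (v x)\<^sup>2)
     + (\<Sum>i\<in>UNIV. m x * ((v x)\<^sup>2 * (F i x)\<^sup>2)) + (\<Sum>i\<in>UNIV. V x $ i * (v x * partial_deriv i v x))
     + (\<Sum>i\<in>UNIV. m x * (2 * v x * partial_deriv i v x * F i x) + V x $ i * ((v x)\<^sup>2 * F i x)))"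
  proof (rule integral_nonneg_AE)
    show "AE x in lebesgue. 0 \<le> m x * (norm (grad v x))\<^sup>2 + 1/4 * ((norm (V x))\<^sup>2 / m x * (v x)\<^sup>2)
     + (\<Sum>i\<in>UNIV. m x * ((v x)\<^sup>2 * (F i x)\<^sup>2)) + (\<Sum>i\<in>UNIV. V x $ i * (v x * partial_deriv i v x))
     + (\<Sum>i\<in>UNIV. m x * (2 * v x * partial_deriv i v x * F i x) + V x $ i * ((v x)\<^sup>2 * F i x))"
      using m_nonneg V_zero
    proof eventually_elim
      case (elim x)
      from square_pointwise[OF elim, of "\<lambda>i. partial_deriv i v x" "v x" "\<lambda>i. F i x"]
      show ?case by (simp add: norm_grad_sq mult_ac)
    qed
  qed
  also have "\<dots> = I1 + 1/4 * I2 + I3 + I4 + (\<Sum>i\<in>UNIV. LINT x|lebesgue. m x * (2 * v x * partial_deriv i v x * F i x) + V x $ i * ((v x)\<^sup>2 * F i x))"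
  proof -
    have add5: "(LINT x|lebesgue. f1 x + 1/4 * f2 x + f3 x + f4 x + f5 x) = (LINT x|lebesgue. f1 x) + 1/4 * (LINT x|lebesgue. f2 x)
        + (LINT x|lebesgue. f3 x) + (LINT x|lebesgue. f4 x) + (LINT x|lebesgue. f5 x)"
      if "integrable lebesgue f1" "integrable lebesgue f2" "integrable lebesgue f3" "integrable lebesgue f4" "integrable lebesgue f5"
      for f1 f2 f3 f4 f5 :: "real^'n \<Rightarrow> real"
      using that by simp
    show ?thesis
      unfolding I1_def I2_def I3_def I4_def
      by (subst add5) (auto simp: i1 intro!: arg_cong2[where f="(+)"] Bochner_Integration.integral_sum)
  qed
  also have "\<dots> = I1 + 1/4 * I2 + I3 + I4 - I5"
    unfolding by_parts I5_def by (simp add: sum_negf)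
  finally have main: "I5 - I3 \<le> I1 + 1/4 * I2 + I4" by simp
  \<comment> \<open>Here the sign of D on the zero set of m enters: leaving D out there lowers the
    integral and thus raises its multiple by -1/2.\<close>
  have "(LINT x|lebesgue. indicator {x. m x \<noteq> 0} x * D x * (v x)\<^sup>2) \<le> (LINT x|lebesgue. D x * (v x)\<^sup>2)"
  proof (rule integral_mono_AE)
    show "AE x in lebesgue. indicator {x. m x \<noteq> 0} x * D x * (v x)\<^sup>2 \<le> D x * (v x)\<^sup>2"
      using D_zero by eventually_elim (auto simp: indicator_def)
  qed auto
  then have "1/4 * I2 + I4 \<le> (LINT x|lebesgue. 1/4 * ((norm (V x))\<^sup>2 / m x * (v x)\<^sup>2) - 1/2 * (indicator {x. m x \<noteq> 0} x * D x * (v x)\<^sup>2))"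
    unfolding I4_def integral_V_grad[OF v] I2_def
      Bochner_Integration.integral_diff[OF integrable_mult_right[OF L1_loc_mult_Cc_infty[OF fisher v2]]
        integrable_mult_right[OF L1_loc_mult_Cc_infty[OF D_supp_L1_loc v2]]] integral_mult_right_zero
    by linarith
  also have "\<dots> = (LINT x|lebesgue. m x * P x * (v x)\<^sup>2)"
    unfolding mP_eq by (simp only: left_diff_distrib mult.assoc)
  finally have "I5 - I3 \<le> I1 + (LINT x|lebesgue. m x * P x * (v x)\<^sup>2)" using main by linarith
  moreover have "I5 - I3 = (LINT x|lebesgue. m x * ((v x)\<^sup>2 * (\<Sum>i\<in>UNIV. partial_deriv i (F i) x - (F i x)\<^sup>2)))"
  proof -
    have "(LINT x|lebesgue. m x * ((v x)\<^sup>2 * (\<Sum>i\<in>UNIV. partial_deriv i (F i) x - (F i x)\<^sup>2))) =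
      (LINT x|lebesgue. (\<Sum>i\<in>UNIV. m x * ((v x)\<^sup>2 * partial_deriv i (F i) x) - m x * ((v x)\<^sup>2 * (F i x)\<^sup>2)))"
      by (simp only: sum_distrib_left right_diff_distrib)
    also have "\<dots> = I5 - I3" by (simp add: I5_def I3_def sum_subtractf)
    finally show ?thesis by simp
  qed
  ultimately show ?thesis by (simp add: I1_def)
qed

end

section \<open>Hardy's inequality through regularisation at the origin\<close>

lemma smooth_radial:
  assumes "\<delta> > 0"
  shows "smooth (\<lambda>x::real^'n. (norm x)\<^sup>2 + \<delta>)"
  using smooth_add[OF smooth_normsq[of 0] smooth_const[of \<delta>]] by simp

lemma radial_pos: "\<delta> > 0 \<Longrightarrow> (norm x)\<^sup>2 + \<delta> > 0" for x :: "'a::real_normed_vector"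
  by (simp add: add_nonneg_pos)

lemma partial_deriv_normsq_0: "partial_deriv i (\<lambda>x. (norm x)\<^sup>2) x = 2 * x $ i"
  using partial_deriv_normsq[of i 0 x] by simp

lemma partial_deriv_radial:
  fixes x :: "real^'n"
  assumes "(h has_real_derivative h') (at ((norm x)\<^sup>2 + \<delta>))"
  shows "partial_deriv i (\<lambda>x. h ((norm x)\<^sup>2 + \<delta>)) x = h' * (2 * x $ i)"
proof -
  have s: "smooth (\<lambda>x::real^'n. (norm x)\<^sup>2)" using smooth_normsq[of 0] by simp
  have "partial_deriv i (\<lambda>x. (norm x)\<^sup>2 + \<delta>) x = 2 * x $ i"
    by (subst partial_deriv_add[OF smooth_differentiable[OF s] smooth_differentiable[OF smooth_const]])
      (simp add: partial_deriv_normsq_0 partial_deriv_const)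
  then show ?thesis
    using partial_deriv_comp[OF smooth_differentiable[OF smooth_add[OF s smooth_const[of \<delta>]]] assms] by simp
qed

lemma smooth_log_corr:
  assumes "smooth f" "\<And>x. f x > 0" shows "smooth (\<lambda>x. log_corr (f x))"
proof -
  have p: "exp 1 + 1 / f x > 0" for x using assms(2)[of x] by (intro add_pos_pos) auto
  have L: "ln (exp 1 + 1 / f x) > 0" for x using ln_exp_1_plus[OF assms(2)[of x]] by linarith
  show ?thesis unfolding log_corr_def
    by (intro smooth_divide smooth_const smooth_ln smooth_add assms p L)
qed

lemma tendsto_log_potential:
  assumes "s > 0" "(f \<longlongrightarrow> s) F"
  shows "((\<lambda>n. log_potential (f n)) \<longlongrightarrow> log_potential s) F"
proof -
  have "isCont log_corr s" by (rule DERIV_isCont[OF log_corr_DERIV[OF assms(1)]])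
  then have c: "((\<lambda>n. log_corr (f n)) \<longlongrightarrow> log_corr s) F" using assms(2) by (rule isCont_tendsto_compose)
  have "(1 + exp 1 * s) * s \<noteq> 0" using assms(1) by (simp add: add_pos_pos less_imp_neq[symmetric])
  then show ?thesis unfolding log_potential_def by (intro tendsto_intros c assms(2))
qed

lemma AE_lebesgue_neq: "AE x in lebesgue. x \<noteq> (a :: 'a::euclidean_space)"
  by (rule AE_I'[of "{a}"]) auto

context weak_density
begin

lemma hardy_regularised:
  assumes v: "v \<in> Cc_infty" and a: "a \<ge> 0" "2 * a + 2 = real CARD('n)" and \<delta>: "\<delta> > 0"
  shows "integrable lebesgue (\<lambda>x. m x * ((v x)\<^sup>2 * (a\<^sup>2 / ((norm x)\<^sup>2 + \<delta>) + log_potential ((norm x)\<^sup>2 + \<delta>))))"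
    and "(LINT x|lebesgue. m x * ((v x)\<^sup>2 * (a\<^sup>2 / ((norm x)\<^sup>2 + \<delta>) + log_potential ((norm x)\<^sup>2 + \<delta>))))
     \<le> (LINT x|lebesgue. m x * (norm (grad v x))\<^sup>2) + (LINT x|lebesgue. m x * P x * (v x)\<^sup>2)"
proof -
  let ?s = "\<lambda>x::real^'n. (norm x)\<^sup>2 + \<delta>"
  have ss: "smooth ?s" by (rule smooth_radial[OF \<delta>])
  have s0: "?s x > 0" for x by (rule radial_pos[OF \<delta>])
  \<comment> \<open>The field x g(|x|^2 + \<delta>) is - grad psi / psi with the singularity
    smoothed out, and g' is the derivative of g.\<close>
  define g where "g s = (a + log_corr s) / s" for s
  define g' where "g' s = - (a + log_corr s) / s\<^sup>2 + (log_corr s)\<^sup>2 / (s * (1 + exp 1 * s)) / s" for s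
  define F where "F i x = x $ i * g (?s x)" for i x
  have sg: "smooth (\<lambda>x. g (?s x))"
    unfolding g_def by (intro smooth_divide smooth_add[OF smooth_const smooth_log_corr] ss s0)
  have sF: "smooth (F i)" for i unfolding F_def by (intro smooth_mult smooth_coord sg)
  have dF: "partial_deriv i (F i) x = g (?s x) + x $ i * (g' (?s x) * (2 * x $ i))" for i x
  proof -
    have "partial_deriv i (\<lambda>x. g (?s x)) x = g' (?s x) * (2 * x $ i)"
      by (rule partial_deriv_radial) (unfold g_def g'_def, rule radial_DERIV[OF s0])
    then show ?thesis unfolding F_def
      using partial_deriv_mult[OF smooth_differentiable[OF smooth_coord] smooth_differentiable[OF sg], of i i x]
      by (simp add: partial_deriv_coord)
  qed
  have sum: "(\<Sum>i\<in>UNIV. partial_deriv i (F i) x - (F i x)\<^sup>2) =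
     real CARD('n) * g (?s x) + 2 * (norm x)\<^sup>2 * g' (?s x) - (norm x)\<^sup>2 * (g (?s x))\<^sup>2" for x
  proof -
    have n: "(norm x)\<^sup>2 = (\<Sum>i\<in>UNIV. (x $ i)\<^sup>2)" by (simp add: norm_vec_def L2_set_def sum_nonneg)
    have "(\<Sum>i\<in>UNIV. partial_deriv i (F i) x - (F i x)\<^sup>2) =
      (\<Sum>i\<in>UNIV. g (?s x) + (x $ i)\<^sup>2 * (2 * g' (?s x)) - (x $ i)\<^sup>2 * (g (?s x))\<^sup>2)"
      by (intro sum.cong refl) (simp add: dF F_def power2_eq_square mult_ac)
    also have "\<dots> = real CARD('n) * g (?s x) + (\<Sum>i\<in>UNIV. (x $ i)\<^sup>2) * (2 * g' (?s x)) - (\<Sum>i\<in>UNIV. (x $ i)\<^sup>2) * (g (?s x))\<^sup>2"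
      by (simp only: sum_subtractf sum.distrib sum_distrib_right sum_constant)
    also have "\<dots> = real CARD('n) * g (?s x) + 2 * (norm x)\<^sup>2 * g' (?s x) - (norm x)\<^sup>2 * (g (?s x))\<^sup>2"
      by (simp add: n)
    finally show ?thesis .
  qed
  have pt: "a\<^sup>2 / ?s x + log_potential (?s x) \<le> (\<Sum>i\<in>UNIV. partial_deriv i (F i) x - (F i x)\<^sup>2)" for x
    unfolding sum g_def g'_def a(2)[symmetric]
    by (rule radial_riccati) (use a \<delta> s0 in auto)
  have v2: "(\<lambda>x. (v x)\<^sup>2) \<in> Cc_infty"
    using Cc_infty_mult[OF v Cc_infty_smooth[OF v]] by (simp add: power2_eq_square)
  have pos: "0 < (1 + exp 1 * s) * s" if "s > 0" for s :: real
    by (intro mult_pos_pos add_pos_pos that) (use that in auto)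
  have "0 < (1 + exp 1 * ?s x) * ?s x" for x by (rule pos[OF s0])
  then have "smooth (\<lambda>x. a\<^sup>2 / ?s x + log_potential (?s x))"
    unfolding log_potential_def
    by (intro smooth_add[OF smooth_divide[OF smooth_const] smooth_divide] smooth_mult smooth_power smooth_diff smooth_log_corr ss s0
        smooth_const smooth_add[OF smooth_const])
  then show int: "integrable lebesgue (\<lambda>x. m x * ((v x)\<^sup>2 * (a\<^sup>2 / ?s x + log_potential (?s x))))"
    by (intro m_mult_integrable Cc_infty_mult[OF v2])
  have int2: "integrable lebesgue (\<lambda>x. m x * ((v x)\<^sup>2 * (\<Sum>i\<in>UNIV. partial_deriv i (F i) x - (F i x)\<^sup>2)))"
    by (intro m_mult_integrable Cc_infty_mult[OF v2] smooth_sum smooth_diff smooth_partial_deriv smooth_power sF)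
  have "(LINT x|lebesgue. m x * ((v x)\<^sup>2 * (a\<^sup>2 / ?s x + log_potential (?s x))))
     \<le> (LINT x|lebesgue. m x * ((v x)\<^sup>2 * (\<Sum>i\<in>UNIV. partial_deriv i (F i) x - (F i x)\<^sup>2)))"
  proof (rule integral_mono_AE[OF int int2])
    show "AE x in lebesgue. m x * ((v x)\<^sup>2 * (a\<^sup>2 / ?s x + log_potential (?s x)))
       \<le> m x * ((v x)\<^sup>2 * (\<Sum>i\<in>UNIV. partial_deriv i (F i) x - (F i x)\<^sup>2))"
      using m_nonneg by eventually_elim (intro mult_left_mono pt, auto)
  qed
  also have "\<dots> \<le> (LINT x|lebesgue. m x * (norm (grad v x))\<^sup>2) + (LINT x|lebesgue. m x * P x * (v x)\<^sup>2)"
    by (rule vector_field_ineq[OF v sF])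
  finally show "(LINT x|lebesgue. m x * ((v x)\<^sup>2 * (a\<^sup>2 / ?s x + log_potential (?s x))))
     \<le> (LINT x|lebesgue. m x * (norm (grad v x))\<^sup>2) + (LINT x|lebesgue. m x * P x * (v x)\<^sup>2)" .
qed

text \<open>Adding \<open>exp 1\<close> times m v^2 makes the regularised integrands nonnegative, so
  Fatou's lemma handles \<delta> -> 0. The singular logarithmic term is then cancelled pointwise by
  the bound on P, which leaves only C.\<close>

lemma hardy:
  assumes v: "v \<in> Cc_infty" and a: "a > 0" "2 * a + 2 = real CARD('n)"
    and PC: "AE x in lebesgue. P x \<le> log_potential ((norm x)\<^sup>2) + C"
  shows "integrable lebesgue (\<lambda>x. m x * ((v x)\<^sup>2 / (norm x)\<^sup>2))"
    and "a\<^sup>2 * (LINT x|lebesgue. m x * ((v x)\<^sup>2 / (norm x)\<^sup>2))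
      \<le> (LINT x|lebesgue. m x * (norm (grad v x))\<^sup>2) + C * (LINT x|lebesgue. m x * (v x)\<^sup>2)"
proof -
  let ?\<delta> = "\<lambda>n. 1 / (real n + 1)"
  let ?f = "\<lambda>n x. m x * ((v x)\<^sup>2 * (a\<^sup>2 / ((norm x)\<^sup>2 + ?\<delta> n) + log_potential ((norm x)\<^sup>2 + ?\<delta> n))) + exp 1 * (m x * (v x)\<^sup>2)"
  let ?g = "\<lambda>x. m x * ((v x)\<^sup>2 * (a\<^sup>2 / (norm x)\<^sup>2 + log_potential ((norm x)\<^sup>2))) + exp 1 * (m x * (v x)\<^sup>2)"
  let ?E = "(LINT x|lebesgue. m x * (norm (grad v x))\<^sup>2) + (LINT x|lebesgue. m x * P x * (v x)\<^sup>2)"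
  have v2: "(\<lambda>x. (v x)\<^sup>2) \<in> Cc_infty"
    using Cc_infty_mult[OF v Cc_infty_smooth[OF v]] by (simp add: power2_eq_square)
  note iv2 = m_mult_integrable[OF v2]
  note reg = hardy_regularised[OF v less_imp_le[OF a(1)] a(2) inverse_Suc_seq(2)]
  have vm: "v \<in> borel_measurable lebesgue" by (rule Cc_infty_borel[OF v])
  have pt0: "0 \<le> m x * ((v x)\<^sup>2 * (a\<^sup>2 / s)) \<and> 0 \<le> m x * ((v x)\<^sup>2 * (log_potential s + exp 1))"
    if "0 \<le> m x" "s > 0" for x s
    using log_potential_ge[OF that(2)] that by simp
  have split: "m x * ((v x)\<^sup>2 * (a\<^sup>2 / s + log_potential s)) + exp 1 * (m x * (v x)\<^sup>2) =
     m x * ((v x)\<^sup>2 * (a\<^sup>2 / s)) + m x * ((v x)\<^sup>2 * (log_potential s + exp 1))" for x s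
    by (simp add: algebra_simps)
  have i_f: "integrable lebesgue (?f n)" for n
    by (intro Bochner_Integration.integrable_add integrable_mult_right reg iv2)
  have nn: "AE x in lebesgue. 0 \<le> ?f n x" for n
    using m_nonneg unfolding split
    by eventually_elim (intro add_nonneg_nonneg, auto simp: pt0 radial_pos)
  have bd: "integral\<^sup>L lebesgue (?f n) \<le> ?E + exp 1 * (LINT x|lebesgue. m x * (v x)\<^sup>2)" for n
    using reg(2)[of n] by (subst Bochner_Integration.integral_add[OF reg(1) integrable_mult_right[OF iv2]]) simp
  have lim: "AE x in lebesgue. (\<lambda>n. ?f n x) \<longlonglongrightarrow> ?g x"
    using AE_lebesgue_neq[of 0]
  proof eventually_elim
    case (elim x)
    then have x: "(norm x)\<^sup>2 > 0" by simp
    have l: "(\<lambda>n. (norm x)\<^sup>2 + ?\<delta> n) \<longlonglongrightarrow> (norm x)\<^sup>2"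
      using tendsto_add[OF tendsto_const inverse_Suc_seq(1), of "(norm x)\<^sup>2"] by simp
    show ?case
      by (intro tendsto_intros tendsto_log_potential[OF x l] l) (use x in auto)
  qed
  have gm: "?g \<in> borel_measurable lebesgue"
  proof -
    have nm: "(\<lambda>x. norm x) \<in> borel_measurable (lebesgue :: (real^'n) measure)"
      by (rule borel_measurable_lebesgueI) simp
    note [measurable] = nm vm m_borel
    show ?thesis unfolding log_potential_def log_corr_def by measurable
  qed
  note fat = Fatou_bound[OF i_f nn bd lim gm]
  have "integrable lebesgue (\<lambda>x. m x * ((v x)\<^sup>2 * (a\<^sup>2 / (norm x)\<^sup>2)))"
  proof (rule Bochner_Integration.integrable_bound[OF fat(1)])
    show "AE x in lebesgue. norm (m x * ((v x)\<^sup>2 * (a\<^sup>2 / (norm x)\<^sup>2))) \<le> norm (?g x)"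
      using m_nonneg AE_lebesgue_neq[of 0]
    proof eventually_elim
      case (elim x)
      then have x: "(norm x)\<^sup>2 > 0" by simp
      from pt0[OF elim(1) x] show ?case unfolding split real_norm_def by linarith
    qed
    have nm: "(\<lambda>x. norm x) \<in> borel_measurable (lebesgue :: (real^'n) measure)"
      by (rule borel_measurable_lebesgueI) simp
    note [measurable] = nm vm m_borel
    show "(\<lambda>x. m x * ((v x)\<^sup>2 * (a\<^sup>2 / (norm x)\<^sup>2))) \<in> borel_measurable lebesgue" by measurable
  qed
  from integrable_mult_right[OF this, of "1 / a\<^sup>2"]
  show i1: "integrable lebesgue (\<lambda>x. m x * ((v x)\<^sup>2 / (norm x)\<^sup>2))"
    using a by simp
  have iP: "integrable lebesgue (\<lambda>x. m x * P x * (v x)\<^sup>2)" by (rule mP_integrable[OF v2])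
  have "a\<^sup>2 * (LINT x|lebesgue. m x * ((v x)\<^sup>2 / (norm x)\<^sup>2)) = (LINT x|lebesgue. a\<^sup>2 * (m x * ((v x)\<^sup>2 / (norm x)\<^sup>2)))"
    by (rule integral_mult_right_zero[symmetric])
  \<comment> \<open>P <= \<open>log_potential\<close> + C removes the logarithmic term of
    \<open>?g\<close>, and - \<open>exp 1\<close> takes back the offset.\<close>
  also have "\<dots> \<le> (LINT x|lebesgue. ?g x - m x * P x * (v x)\<^sup>2 + (C - exp 1) * (m x * (v x)\<^sup>2))"
  proof (rule integral_mono_AE)
    show "AE x in lebesgue. a\<^sup>2 * (m x * ((v x)\<^sup>2 / (norm x)\<^sup>2)) \<le> ?g x - m x * P x * (v x)\<^sup>2 + (C - exp 1) * (m x * (v x)\<^sup>2)"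
      using m_nonneg PC
    proof eventually_elim
      case (elim x)
      then have "m x * (v x)\<^sup>2 * P x \<le> m x * (v x)\<^sup>2 * (log_potential ((norm x)\<^sup>2) + C)"
        by (intro mult_left_mono) auto
      then show ?case by (simp add: algebra_simps)
    qed
  qed (intro integrable_mult_right Bochner_Integration.integrable_add Bochner_Integration.integrable_diff i1 fat(1) iP iv2)+
  also have "\<dots> = integral\<^sup>L lebesgue ?g - (LINT x|lebesgue. m x * P x * (v x)\<^sup>2) + (C - exp 1) * (LINT x|lebesgue. m x * (v x)\<^sup>2)"
    unfolding Bochner_Integration.integral_add[OF Bochner_Integration.integrable_diff[OF fat(1) iP] integrable_mult_right[OF iv2]]
      Bochner_Integration.integral_diff[OF fat(1) iP] integral_mult_right_zero ..
  also have "\<dots> \<le> (LINT x|lebesgue. m x * (norm (grad v x))\<^sup>2) + C * (LINT x|lebesgue. m x * (v x)\<^sup>2)"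
    using fat(2) by (simp only: left_diff_distrib)
  finally show "a\<^sup>2 * (LINT x|lebesgue. m x * ((v x)\<^sup>2 / (norm x)\<^sup>2))
      \<le> (LINT x|lebesgue. m x * (norm (grad v x))\<^sup>2) + C * (LINT x|lebesgue. m x * (v x)\<^sup>2)" .
qed

end

section \<open>The weighted Rellich inequality\<close>

lemma grad_borel:
  assumes "smooth u" shows "grad u \<in> borel_measurable lebesgue"
proof -
  have "continuous_on UNIV (grad u)"
    unfolding grad_def[abs_def] using assms
    by (intro continuous_on_vec_lambda smooth_continuous smooth_partial_deriv)
  then show ?thesis by (intro borel_measurable_lebesgueI borel_measurable_continuous_onI)
qed

lemma laplacian_borel:
  assumes "smooth u" shows "laplacian u \<in> borel_measurable lebesgue"
  unfolding laplacian_def[abs_def] using assms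
  by (intro continuous_lebesgue_borel continuous_on_sum smooth_continuous smooth_partial_deriv)

lemma Cc_infty_add:
  assumes "u \<in> Cc_infty" "v \<in> Cc_infty" shows "(\<lambda>x. u x + v x) \<in> Cc_infty"
proof -
  obtain R where R: "\<And>x. norm x > R \<Longrightarrow> u x = 0" using Cc_infty_bounded_support[OF assms(1)] by metis
  obtain R' where R': "\<And>x. norm x > R' \<Longrightarrow> v x = 0" using Cc_infty_bounded_support[OF assms(2)] by metis
  have "\<forall>x. norm x > max R R' \<longrightarrow> u x + v x = 0" using R R' by simp
  then show ?thesis using assms unfolding Cc_infty_iff by blast
qed

lemma Cc_infty_sum:
  assumes "\<And>i. f i \<in> Cc_infty" shows "(\<lambda>x. \<Sum>i\<in>A. f i x) \<in> Cc_infty"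
proof (induction A rule: infinite_finite_induct)
  case (insert i A)
  then show ?case using Cc_infty_add[OF assms[of i] insert.IH] by simp
qed (auto simp: Cc_infty_iff)

lemma grad_sq_Cc_infty:
  assumes u: "u \<in> Cc_infty" shows "(\<lambda>x. (norm (grad u x))\<^sup>2) \<in> Cc_infty"
proof -
  have "(\<lambda>x. (partial_deriv i u x)\<^sup>2) \<in> Cc_infty" for i
    using Cc_infty_mult[OF Cc_infty_partial_deriv[OF u] smooth_partial_deriv[OF Cc_infty_smooth[OF u]]]
    by (simp add: power2_eq_square)
  then show ?thesis unfolding norm_grad_sq by (rule Cc_infty_sum)
qed

section \<open>Integration by parts for L and Rellich's inequality\<close>

context weak_density
begin

definition L :: "(real^'n \<Rightarrow> real) \<Rightarrow> real^'n \<Rightarrow> real" where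
  "L u x = laplacian u x + (V x /\<^sub>R m x) \<bullet> grad u x"

lemma L_borel: assumes "smooth u" shows "L u \<in> borel_measurable lebesgue"
  unfolding L_def[abs_def] using grad_borel[OF assms] laplacian_borel[OF assms] V_borel m_borel by measurable

text \<open>The drift term is controlled by \<open>fisher\<close>, as m \<bar>V/m\<bar>^2 |grad u|^2
  is |V|^2/m times a test function. Hence the integral of |Lu|^2 is a genuine finite value.\<close>

lemma L_square_integrable:
  assumes u: "u \<in> Cc_infty" shows "integrable lebesgue (\<lambda>x. m x * (L u x)\<^sup>2)"
proof -
  have su: "smooth u" by (rule Cc_infty_smooth[OF u])
  have pp: "partial_deriv i (partial_deriv i u) \<in> Cc_infty" for i by (intro Cc_infty_partial_deriv u)
  have l: "laplacian u \<in> Cc_infty" unfolding laplacian_def[abs_def] by (rule Cc_infty_sum[OF pp])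
  have l2: "(\<lambda>x. (laplacian u x)\<^sup>2) \<in> Cc_infty"
    using Cc_infty_mult[OF l Cc_infty_smooth[OF l]] by (simp add: power2_eq_square)
  have cs: "(b \<bullet> g)\<^sup>2 \<le> (norm b)\<^sup>2 * (norm g)\<^sup>2" for b g :: "real^'n"
    using Cauchy_Schwarz_ineq[of b g] by (simp add: power2_norm_eq_inner)
  show ?thesis
  proof (rule Bochner_Integration.integrable_bound)
    show "integrable lebesgue (\<lambda>x. 2 * (m x * (laplacian u x)\<^sup>2) + 2 * ((norm (V x))\<^sup>2 / m x * (norm (grad u x))\<^sup>2))"
      by (intro Bochner_Integration.integrable_add integrable_mult_right m_mult_integrable l2 L1_loc_mult_Cc_infty fisher grad_sq_Cc_infty u)
    show "(\<lambda>x. m x * (L u x)\<^sup>2) \<in> borel_measurable lebesgue" using m_borel L_borel[OF su] by measurable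
    show "AE x in lebesgue. norm (m x * (L u x)\<^sup>2) \<le> norm (2 * (m x * (laplacian u x)\<^sup>2) + 2 * ((norm (V x))\<^sup>2 / m x * (norm (grad u x))\<^sup>2))"
      using m_nonneg
    proof eventually_elim
      case (elim x)
      let ?b = "V x /\<^sub>R m x"
      have "(L u x)\<^sup>2 \<le> 2 * (laplacian u x)\<^sup>2 + 2 * (?b \<bullet> grad u x)\<^sup>2"
        unfolding L_def using sum_squares_bound[of "laplacian u x" "?b \<bullet> grad u x"] by (simp add: power2_sum)
      also have "(?b \<bullet> grad u x)\<^sup>2 \<le> (norm ?b)\<^sup>2 * (norm (grad u x))\<^sup>2"
        by (rule cs)
      finally have "m x * (L u x)\<^sup>2 \<le> m x * (2 * (laplacian u x)\<^sup>2 + 2 * ((norm ?b)\<^sup>2 * (norm (grad u x))\<^sup>2))"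
        using elim by (intro mult_left_mono) auto
      also have "\<dots> = 2 * (m x * (laplacian u x)\<^sup>2) + 2 * ((norm (V x))\<^sup>2 / m x * (norm (grad u x))\<^sup>2)"
        using elim by (cases "m x = 0") (auto simp: power_mult_distrib field_simps power2_eq_square)
      finally show ?case using elim by simp
    qed
  qed
qed

text \<open>Formally m L u is the divergence of m grad u, so L is symmetric with respect to the
  density m. Weakly this means testing the weak gradient of m with w times the partial derivatives
  of u.\<close>

lemma L_by_parts:
  assumes u: "u \<in> Cc_infty" and w: "w \<in> Cc_infty"
  shows "integrable lebesgue (\<lambda>x. m x * (w x * L u x))"
    and "(LINT x|lebesgue. m x * (\<Sum>i\<in>UNIV. partial_deriv i w x * partial_deriv i u x)) = - (LINT x|lebesgue. m x * (w x * L u x))"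
proof -
  have su: "smooth u" and sw: "smooth w" using Cc_infty_smooth u w by blast+
  have wd: "(\<lambda>x. w x * partial_deriv i u x) \<in> Cc_infty" for i
    by (intro Cc_infty_mult w smooth_partial_deriv su)
  have wdd: "(\<lambda>x. w x * partial_deriv i (partial_deriv i u) x) \<in> Cc_infty" for i
    by (intro Cc_infty_mult w smooth_partial_deriv su)
  have dwd: "(\<lambda>x. partial_deriv i w x * partial_deriv i u x) \<in> Cc_infty" for i
    by (intro Cc_infty_mult Cc_infty_partial_deriv w smooth_partial_deriv su)
  have pd: "partial_deriv i (\<lambda>x. w x * partial_deriv i u x) x = partial_deriv i w x * partial_deriv i u x + w x * partial_deriv i (partial_deriv i u) x" for i x
    by (rule partial_deriv_mult[OF smooth_differentiable[OF sw] smooth_differentiable[OF smooth_partial_deriv[OF su]]])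
  let ?A = "\<lambda>x. \<Sum>i\<in>UNIV. m x * (partial_deriv i w x * partial_deriv i u x)"
  let ?B = "\<lambda>x. \<Sum>i\<in>UNIV. m x * (w x * partial_deriv i (partial_deriv i u) x)"
  let ?C = "\<lambda>x. \<Sum>i\<in>UNIV. V x $ i * (w x * partial_deriv i u x)"
  have iB: "integrable lebesgue ?B" by (intro Bochner_Integration.integrable_sum m_mult_integrable wdd)
  have iC: "integrable lebesgue ?C" by (intro Bochner_Integration.integrable_sum L1_loc_mult_Cc_infty V_L1_loc wd)
  have eq: "AE x in lebesgue. ?B x + ?C x = m x * (w x * L u x)"
    using V_zero
  proof eventually_elim
    case (elim x)
    have "V x $ i * c = m x * ((V x /\<^sub>R m x) $ i * c)" for i c using elim by (cases "m x = 0") auto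
    then have "?C x = (\<Sum>i\<in>UNIV. m x * ((V x /\<^sub>R m x) $ i * (w x * partial_deriv i u x)))" by (simp only:)
    also have "\<dots> = m x * (w x * ((V x /\<^sub>R m x) \<bullet> grad u x))"
      by (simp only: inner_vec_def grad_def vec_lambda_beta sum_distrib_left inner_real_def mult.left_commute)
    finally show ?case by (simp add: L_def laplacian_def distrib_left flip: sum_distrib_left)
  qed
  have Lm: "(\<lambda>x. m x * (w x * L u x)) \<in> borel_measurable lebesgue"
    using m_borel L_borel[OF su] Cc_infty_borel[OF w] by measurable
  have BCm: "(\<lambda>x. ?B x + ?C x) \<in> borel_measurable lebesgue"
    using iB iC by (intro borel_measurable_add) auto
  show "integrable lebesgue (\<lambda>x. m x * (w x * L u x))"
    using integrable_cong_AE[OF BCm Lm eq] Bochner_Integration.integrable_add[OF iB iC] by blast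
  have "integral\<^sup>L lebesgue ?A + integral\<^sup>L lebesgue ?B = (\<Sum>i\<in>UNIV. LINT x|lebesgue. m x * partial_deriv i (\<lambda>x. w x * partial_deriv i u x) x)"
    unfolding pd distrib_left
    by (simp add: m_mult_integrable dwd wdd sum.distrib)
  also have "\<dots> = - integral\<^sup>L lebesgue ?C"
    by (simp add: weak_gradD[OF wd] L1_loc_mult_Cc_infty V_L1_loc wd sum_negf)
  finally have "integral\<^sup>L lebesgue ?A = - (integral\<^sup>L lebesgue ?B + integral\<^sup>L lebesgue ?C)" by simp
  also have "\<dots> = - (LINT x|lebesgue. m x * (w x * L u x))"
    using integral_cong_AE[OF BCm Lm eq] Bochner_Integration.integral_add[OF iB iC] by simp
  finally show "(LINT x|lebesgue. m x * (\<Sum>i\<in>UNIV. partial_deriv i w x * partial_deriv i u x)) = - (LINT x|lebesgue. m x * (w x * L u x))"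
    by (simp only: sum_distrib_left)
qed

text \<open>Hardy's inequality for \<open>u / \<bar>x\<bar>\<close>, regularised at the origin, with \<open>\<integral> \<bar>\<nabla>(u / \<bar>x\<bar>)\<bar>\<^sup>2\<close> computed by parts.\<close>

lemma rellich_regularised:
  assumes u: "u \<in> Cc_infty" and a: "a > 0" "2 * a + 2 = real CARD('n)"
    and PC: "AE x in lebesgue. P x \<le> log_potential ((norm x)\<^sup>2) + C" and \<delta>: "\<delta> > 0"
  shows "integrable lebesgue (\<lambda>x. m x * (u x / ((norm x)\<^sup>2 + \<delta>))\<^sup>2)"
    and "(a\<^sup>2 - 1) * (LINT x|lebesgue. m x * (u x / ((norm x)\<^sup>2 + \<delta>))\<^sup>2)
      \<le> - (LINT x|lebesgue. m x * (u x / ((norm x)\<^sup>2 + \<delta>) * L u x)) + C * (LINT x|lebesgue. m x * ((u x)\<^sup>2 / ((norm x)\<^sup>2 + \<delta>)))"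
proof -
  let ?s = "\<lambda>x::real^'n. (norm x)\<^sup>2 + \<delta>"
  have su: "smooth u" by (rule Cc_infty_smooth[OF u])
  have ss: "smooth ?s" by (rule smooth_radial[OF \<delta>])
  have s0: "?s x > 0" for x by (rule radial_pos[OF \<delta>])
  \<comment> \<open>v and w regularise u/|x| and u/|x|^2, so that v^2 = u w. Hardy's inequality is
    applied to v, and w becomes the multiplier of L u.\<close>
  define w where "w x = u x / ?s x" for x
  define v where "v x = u x * ?s x powr (-1/2)" for x
  have si: "smooth (\<lambda>x. inverse (?s x))" by (rule smooth_inverse[OF ss s0])
  have sp: "smooth (\<lambda>x. ?s x powr (-1/2))" by (rule smooth_comp[OF smooth1_powr ss]) (use s0 in auto)
  have w: "w \<in> Cc_infty" unfolding w_def[abs_def] divide_inverse by (rule Cc_infty_mult[OF u si])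
  have v: "v \<in> Cc_infty" unfolding v_def[abs_def] by (rule Cc_infty_mult[OF u sp])
  have w2: "(\<lambda>x. (w x)\<^sup>2) \<in> Cc_infty" using Cc_infty_mult[OF w Cc_infty_smooth[OF w]] by (simp add: power2_eq_square)
  have rr: "?s x powr (-1/2) * ?s x powr (-1/2) = 1 / ?s x" for x
    using s0[of x] by (simp flip: powr_add add: powr_minus_divide)
  have v_sq: "(v x)\<^sup>2 = (u x)\<^sup>2 / ?s x" for x
    using rr[of x] by (simp add: v_def power2_eq_square mult_ac)
  have dw: "partial_deriv i w x = partial_deriv i u x / ?s x - 2 * u x * x $ i / (?s x)\<^sup>2" for i x
  proof -
    have "partial_deriv i (\<lambda>x. inverse (?s x)) x = - (inverse (?s x) * 1 * inverse (?s x)) * (2 * x $ i)"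
      by (rule partial_deriv_radial[OF DERIV_inverse'[OF DERIV_ident]]) (use s0[of x] in simp)
    then show ?thesis
      using partial_deriv_mult[OF smooth_differentiable[OF su] smooth_differentiable[OF si], of i x]
      unfolding w_def[abs_def] divide_inverse by (simp add: power2_eq_square mult_ac)
  qed
  have dv: "partial_deriv i v x = ?s x powr (-1/2) * (partial_deriv i u x - u x * x $ i / ?s x)" for i x
  proof -
    have "((\<lambda>s. s powr (-1/2)) has_real_derivative (-1/2) * ?s x powr (-1/2 - 1)) (at (?s x))"
      using has_real_derivative_powr[OF s0[of x], of "-1/2"] by simp
    from partial_deriv_radial[OF this, of i]
    have "partial_deriv i (\<lambda>x. ?s x powr (-1/2)) x = - (?s x powr (-1/2) / ?s x * x $ i)"
      using s0[of x] powr_diff[of "?s x" "-1/2" 1] by simp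
    then show ?thesis
      using partial_deriv_mult[OF smooth_differentiable[OF su] smooth_differentiable[OF sp], of i x]
      unfolding v_def[abs_def] by (simp add: algebra_simps)
  qed
  \<comment> \<open>The first sum is the one that \<open>L_by_parts\<close> evaluates; in each
    component the two products differ by the square w^2 x_i^2 / s.\<close>
  have gv: "(norm (grad v x))\<^sup>2 = (\<Sum>i\<in>UNIV. partial_deriv i w x * partial_deriv i u x) + (w x)\<^sup>2 * ((norm x)\<^sup>2 / ?s x)" for x
  proof -
    have n: "(norm x)\<^sup>2 = (\<Sum>i\<in>UNIV. (x $ i)\<^sup>2)" by (simp add: norm_vec_def L2_set_def sum_nonneg)
    have "(partial_deriv i v x)\<^sup>2 = partial_deriv i w x * partial_deriv i u x + (w x)\<^sup>2 / ?s x * (x $ i)\<^sup>2" for i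
    proof -
      have "(partial_deriv i v x)\<^sup>2 = (1 / ?s x) * (partial_deriv i u x - u x * x $ i / ?s x)\<^sup>2"
        unfolding dv power_mult_distrib power2_eq_square[of "_ powr _"] rr ..
      also have "\<dots> = partial_deriv i w x * partial_deriv i u x + (w x)\<^sup>2 / ?s x * (x $ i)\<^sup>2"
      proof -
        have "(1 / s) * (p - q * y / s)\<^sup>2 = (p / s - 2 * q * y / s\<^sup>2) * p + (q / s)\<^sup>2 / s * y\<^sup>2" if "s > 0" for s p q y :: real
          using that by (simp add: field_simps power2_eq_square)
        from this[OF s0] show ?thesis unfolding dw w_def .
      qed
      finally show ?thesis .
    qed
    then have "(norm (grad v x))\<^sup>2 = (\<Sum>i\<in>UNIV. partial_deriv i w x * partial_deriv i u x) + (w x)\<^sup>2 / ?s x * (\<Sum>i\<in>UNIV. (x $ i)\<^sup>2)"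
      by (simp add: norm_grad_sq sum.distrib sum_distrib_left)
    then show ?thesis by (simp add: n)
  qed
  have sw: "(\<lambda>x. \<Sum>i\<in>UNIV. partial_deriv i w x * partial_deriv i u x) \<in> Cc_infty"
    by (intro Cc_infty_sum Cc_infty_mult Cc_infty_partial_deriv w smooth_partial_deriv su)
  have g2: "(\<lambda>x. (norm (grad v x))\<^sup>2) \<in> Cc_infty"
    by (rule grad_sq_Cc_infty[OF v])
  note iw2 = m_mult_integrable[OF w2]
  then show "integrable lebesgue (\<lambda>x. m x * (u x / ?s x)\<^sup>2)" by (simp add: w_def)
  note H = hardy[OF v a PC]
  have "a\<^sup>2 * (LINT x|lebesgue. m x * (w x)\<^sup>2) \<le> a\<^sup>2 * (LINT x|lebesgue. m x * ((v x)\<^sup>2 / (norm x)\<^sup>2))"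
  proof (rule mult_left_mono[OF integral_mono_AE[OF iw2 H(1)]])
    show "AE x in lebesgue. m x * (w x)\<^sup>2 \<le> m x * ((v x)\<^sup>2 / (norm x)\<^sup>2)"
      using m_nonneg AE_lebesgue_neq[of 0]
    proof eventually_elim
      case (elim x)
      have "(w x)\<^sup>2 = (u x)\<^sup>2 / ?s x / ?s x" by (simp add: w_def power2_eq_square)
      also have "\<dots> \<le> (u x)\<^sup>2 / ?s x / (norm x)\<^sup>2"
        using elim \<delta> s0[of x] by (intro divide_left_mono mult_pos_pos) (auto simp: divide_nonneg_pos)
      finally show ?case using elim by (intro mult_left_mono) (auto simp: v_sq)
    qed
  qed simp
  also have "\<dots> \<le> (LINT x|lebesgue. m x * (norm (grad v x))\<^sup>2) + C * (LINT x|lebesgue. m x * (v x)\<^sup>2)" by (rule H(2))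
  finally have h1: "a\<^sup>2 * (LINT x|lebesgue. m x * (w x)\<^sup>2)
      \<le> (LINT x|lebesgue. m x * (norm (grad v x))\<^sup>2) + C * (LINT x|lebesgue. m x * (v x)\<^sup>2)" .
  have "(LINT x|lebesgue. m x * (norm (grad v x))\<^sup>2) \<le>
     (LINT x|lebesgue. m x * (\<Sum>i\<in>UNIV. partial_deriv i w x * partial_deriv i u x) + m x * (w x)\<^sup>2)"
  proof (rule integral_mono_AE)
    show "AE x in lebesgue. m x * (norm (grad v x))\<^sup>2 \<le> m x * (\<Sum>i\<in>UNIV. partial_deriv i w x * partial_deriv i u x) + m x * (w x)\<^sup>2"
      using m_nonneg
    proof eventually_elim
      case (elim x)
      \<comment> \<open>This estimate of the remainder is where the 1 in C_0 - 1 comes from.\<close>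
      have "(norm x)\<^sup>2 / ?s x \<le> 1" using \<delta> s0[of x] by simp
      then have "(w x)\<^sup>2 * ((norm x)\<^sup>2 / ?s x) \<le> (w x)\<^sup>2 * 1" by (intro mult_left_mono) auto
      then have "m x * (norm (grad v x))\<^sup>2 \<le> m x * ((\<Sum>i\<in>UNIV. partial_deriv i w x * partial_deriv i u x) + (w x)\<^sup>2)"
        using elim unfolding gv by (intro mult_left_mono) auto
      then show ?case by (simp only: distrib_left)
    qed
  qed (intro Bochner_Integration.integrable_add m_mult_integrable g2 sw w2)+
  also have "\<dots> = - (LINT x|lebesgue. m x * (w x * L u x)) + (LINT x|lebesgue. m x * (w x)\<^sup>2)"
    by (subst Bochner_Integration.integral_add[OF m_mult_integrable[OF sw] iw2]) (simp only: L_by_parts(2)[OF u w])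
  finally show "(a\<^sup>2 - 1) * (LINT x|lebesgue. m x * (u x / ?s x)\<^sup>2)
      \<le> - (LINT x|lebesgue. m x * (u x / ?s x * L u x)) + C * (LINT x|lebesgue. m x * ((u x)\<^sup>2 / ?s x))"
    using h1 unfolding v_sq w_def left_diff_distrib mult_1 by linarith
qed

text \<open>The regularised inequality is multiplied by k = a^2 - 1 > 0, and the term with L u is
  split so that half of k^2 times the integral of w^2, with w the regularised u/|x|^2, can be
  absorbed on the left. That integral is finite for \<delta> > 0, and the resulting bound does not
  depend on \<delta>, so Fatou's lemma applies.\<close>

lemma rellich:
  assumes u: "u \<in> Cc_infty" and a: "a > 1" "2 * a + 2 = real CARD('n)"
    and PC: "AE x in lebesgue. P x \<le> log_potential ((norm x)\<^sup>2) + C" and C: "C > 0"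
  shows "integrable lebesgue (\<lambda>x. m x * ((u x)\<^sup>2 / norm x ^ 4))"
    and "(a\<^sup>2 - 1)\<^sup>2 * (LINT x|lebesgue. m x * ((u x)\<^sup>2 / norm x ^ 4))
      \<le> (LINT x|lebesgue. m x * (L u x)\<^sup>2) + 2 * (a\<^sup>2 - 1) * C * (LINT x|lebesgue. m x * ((u x)\<^sup>2 / (norm x)\<^sup>2))"
proof -
  define k where "k = a\<^sup>2 - 1"
  have k: "k > 0" using a(1) by (simp add: k_def one_less_power)
  have a0: "a > 0" using a(1) by simp
  let ?\<delta> = "\<lambda>n. 1 / (real n + 1)"
  let ?K = "(LINT x|lebesgue. m x * (L u x)\<^sup>2) + 2 * k * C * (LINT x|lebesgue. m x * ((u x)\<^sup>2 / (norm x)\<^sup>2))"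
  let ?f = "\<lambda>n x. m x * (u x / ((norm x)\<^sup>2 + ?\<delta> n))\<^sup>2"
  note H = hardy[OF u a0 a(2) PC]
  have su: "smooth u" by (rule Cc_infty_smooth[OF u])
  have bd: "k\<^sup>2 * integral\<^sup>L lebesgue (?f n) \<le> ?K" for n
  proof -
    let ?s = "\<lambda>x::real^'n. (norm x)\<^sup>2 + ?\<delta> n"
    have \<delta>: "?\<delta> n > 0" by (rule inverse_Suc_seq(2))
    have s0: "?s x > 0" for x :: "real^'n" by (rule radial_pos[OF \<delta>])
    note R = rellich_regularised[OF u a0 a(2) PC \<delta>]
    have w: "(\<lambda>x. u x / ?s x) \<in> Cc_infty"
      unfolding divide_inverse[of "u _"] by (rule Cc_infty_mult[OF u smooth_inverse[OF smooth_radial[OF \<delta>] s0]])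
    have u2: "(\<lambda>x. (u x)\<^sup>2 / ?s x) \<in> Cc_infty"
      using Cc_infty_mult[OF w su] by (simp add: power2_eq_square)
    have "- k * (LINT x|lebesgue. m x * (u x / ?s x * L u x)) = (LINT x|lebesgue. - k * (m x * (u x / ?s x * L u x)))"
      by (rule integral_mult_right_zero[symmetric])
    also have "\<dots> \<le> (LINT x|lebesgue. k\<^sup>2 / 2 * (m x * (u x / ?s x)\<^sup>2) + 1/2 * (m x * (L u x)\<^sup>2))"
    proof (rule integral_mono_AE)
      show "AE x in lebesgue. - k * (m x * (u x / ?s x * L u x)) \<le> k\<^sup>2 / 2 * (m x * (u x / ?s x)\<^sup>2) + 1/2 * (m x * (L u x)\<^sup>2)"
        using m_nonneg
      proof eventually_elim
        case (elim x)
        \<comment> \<open>This weight in Young's inequality gives |Lu|^2 the coefficient 1/2, which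
          becomes exactly 1 after the absorption.\<close>
        have "0 \<le> m x * (k * (u x / ?s x) + L u x)\<^sup>2" using elim by simp
        also have "\<dots> = 2 * (k\<^sup>2 / 2 * (m x * (u x / ?s x)\<^sup>2) + 1/2 * (m x * (L u x)\<^sup>2) + k * (m x * (u x / ?s x * L u x)))"
        proof -
          have "M * (k * W + l)\<^sup>2 = 2 * (k\<^sup>2 / 2 * (M * W\<^sup>2) + 1/2 * (M * l\<^sup>2) + k * (M * (W * l)))" for M W l
            by (simp add: power2_eq_square algebra_simps)
          then show ?thesis .
        qed
        finally show ?case by simp
      qed
    qed (intro integrable_mult_right Bochner_Integration.integrable_add R(1) L_by_parts(1)[OF u w] L_square_integrable[OF u])+
    also have "\<dots> = k\<^sup>2 / 2 * integral\<^sup>L lebesgue (?f n) + 1/2 * (LINT x|lebesgue. m x * (L u x)\<^sup>2)"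
      by (subst Bochner_Integration.integral_add[OF integrable_mult_right[OF R(1)] integrable_mult_right[OF L_square_integrable[OF u]]])
        (simp only: integral_mult_right_zero)
    finally have 1: "- k * (LINT x|lebesgue. m x * (u x / ?s x * L u x)) \<le> k\<^sup>2 / 2 * integral\<^sup>L lebesgue (?f n) + 1/2 * (LINT x|lebesgue. m x * (L u x)\<^sup>2)" .
    have "k * (k * integral\<^sup>L lebesgue (?f n)) \<le> k * (- (LINT x|lebesgue. m x * (u x / ?s x * L u x)) + C * (LINT x|lebesgue. m x * ((u x)\<^sup>2 / ?s x)))"
      using R(2) k by (intro mult_left_mono) (auto simp: k_def)
    then have 2: "k\<^sup>2 * integral\<^sup>L lebesgue (?f n) \<le> - k * (LINT x|lebesgue. m x * (u x / ?s x * L u x)) + k * C * (LINT x|lebesgue. m x * ((u x)\<^sup>2 / ?s x))"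
      by (simp add: power2_eq_square algebra_simps)
    have "(LINT x|lebesgue. m x * ((u x)\<^sup>2 / ?s x)) \<le> (LINT x|lebesgue. m x * ((u x)\<^sup>2 / (norm x)\<^sup>2))"
    proof (rule integral_mono_AE[OF m_mult_integrable[OF u2] H(1)])
      show "AE x in lebesgue. m x * ((u x)\<^sup>2 / ?s x) \<le> m x * ((u x)\<^sup>2 / (norm x)\<^sup>2)"
        using m_nonneg AE_lebesgue_neq[of 0]
        by eventually_elim (use \<delta> s0 in \<open>auto intro!: mult_left_mono divide_left_mono mult_pos_pos\<close>)
    qed
    then have "k * C * (LINT x|lebesgue. m x * ((u x)\<^sup>2 / ?s x)) \<le> k * C * (LINT x|lebesgue. m x * ((u x)\<^sup>2 / (norm x)\<^sup>2))"
      using k C by (intro mult_left_mono) auto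
    with 1 2 show ?thesis by linarith
  qed
  have bd': "integral\<^sup>L lebesgue (?f n) \<le> ?K / k\<^sup>2" for n
    using bd[of n] k by (simp add: pos_le_divide_eq mult.commute)
  have lim: "AE x in lebesgue. (\<lambda>n. ?f n x) \<longlonglongrightarrow> m x * ((u x)\<^sup>2 / norm x ^ 4)"
    using AE_lebesgue_neq[of 0]
  proof eventually_elim
    case (elim x)
    have "(\<lambda>n. ?f n x) \<longlonglongrightarrow> m x * (u x / ((norm x)\<^sup>2 + 0))\<^sup>2"
      by (intro tendsto_intros inverse_Suc_seq(1)) (use elim in simp)
    then show ?case by (simp add: power_divide flip: power_mult)
  qed
  have nm: "(\<lambda>x. norm x) \<in> borel_measurable (lebesgue :: (real^'n) measure)"
    by (rule borel_measurable_lebesgueI) simp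
  have gm: "(\<lambda>x. m x * ((u x)\<^sup>2 / norm x ^ 4)) \<in> borel_measurable lebesgue"
    using nm Cc_infty_borel[OF u] m_borel by measurable
  have nn: "AE x in lebesgue. 0 \<le> ?f n x" for n using m_nonneg by eventually_elim simp
  note fat = Fatou_bound[OF rellich_regularised(1)[OF u a0 a(2) PC inverse_Suc_seq(2)] nn bd' lim gm]
  show "integrable lebesgue (\<lambda>x. m x * ((u x)\<^sup>2 / norm x ^ 4))" by (rule fat(1))
  show "(a\<^sup>2 - 1)\<^sup>2 * (LINT x|lebesgue. m x * ((u x)\<^sup>2 / norm x ^ 4))
      \<le> (LINT x|lebesgue. m x * (L u x)\<^sup>2) + 2 * (a\<^sup>2 - 1) * C * (LINT x|lebesgue. m x * ((u x)\<^sup>2 / (norm x)\<^sup>2))"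
    using fat(2) k by (simp add: pos_le_divide_eq mult.commute flip: k_def)
qed

end

section \<open>From the hypotheses on the density to the Hardy and Rellich inequalities\<close>

lemma has_weak_grad_cong_AE:
  assumes f: "has_weak_grad f G" and eq: "AE x in lebesgue. f x = g x" and g: "g \<in> L1_loc"
  shows "has_weak_grad g G"
  unfolding has_weak_grad_def
proof (intro conjI ballI allI g)
  have fL: "f \<in> L1_loc" using f unfolding has_weak_grad_def by blast
  show "G \<in> L1_loc" using f unfolding has_weak_grad_def by blast
  fix \<eta> :: "real^'a \<Rightarrow> real" and i assume \<eta>: "\<eta> \<in> Cc_infty"
  have "(LINT x|lebesgue. g x * partial_deriv i \<eta> x) = (LINT x|lebesgue. f x * partial_deriv i \<eta> x)"
  proof (rule integral_cong_AE)
    show "AE x in lebesgue. g x * partial_deriv i \<eta> x = f x * partial_deriv i \<eta> x"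
      using eq by eventually_elim simp
  qed (intro borel_measurable_times L1_loc_borel fL g Cc_infty_borel Cc_infty_partial_deriv \<eta>)+
  also have "\<dots> = - (LINT x|lebesgue. G x $ i * \<eta> x)" using f \<eta> unfolding has_weak_grad_def by blast
  finally show "(LINT x|lebesgue. g x * partial_deriv i \<eta> x) = - (LINT x|lebesgue. G x $ i * \<eta> x)" .
qed

lemma has_weak_laplacian_cong_AE:
  assumes f: "has_weak_laplacian f D" and eq: "AE x in lebesgue. f x = g x" and g: "g \<in> L1_loc"
  shows "has_weak_laplacian g D"
  unfolding has_weak_laplacian_def
proof (intro conjI ballI allI g)
  have fL: "f \<in> L1_loc" using f unfolding has_weak_laplacian_def by blast
  show "D \<in> L1_loc" using f unfolding has_weak_laplacian_def by blast
  fix \<eta> :: "real^'a \<Rightarrow> real" assume \<eta>: "\<eta> \<in> Cc_infty"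
  have l: "laplacian \<eta> \<in> borel_measurable lebesgue" by (rule laplacian_borel[OF Cc_infty_smooth[OF \<eta>]])
  have "(LINT x|lebesgue. g x * laplacian \<eta> x) = (LINT x|lebesgue. f x * laplacian \<eta> x)"
  proof (rule integral_cong_AE)
    show "AE x in lebesgue. g x * laplacian \<eta> x = f x * laplacian \<eta> x"
      using eq by eventually_elim simp
  qed (intro borel_measurable_times L1_loc_borel fL g l)+
  also have "\<dots> = (LINT x|lebesgue. D x * \<eta> x)" using f \<eta> unfolding has_weak_laplacian_def by blast
  finally show "(LINT x|lebesgue. g x * laplacian \<eta> x) = (LINT x|lebesgue. D x * \<eta> x)" .
qed

text \<open>If G is the weak gradient of \<phi> = sqrt \<mu>, then 2 \<phi> G is one of \<mu>. This
  gives at once the existence of \<open>weak_grad \<mu>\<close>, its vanishing on the zero set, and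
  |grad \<mu>|^2/\<mu> <= 4 |G|^2, which is locally integrable.\<close>

lemma weak_density_of_sqrt_H1_loc:
  fixes \<mu> :: "real^'n \<Rightarrow> real"
  assumes \<mu>0: "AE x in lebesgue. 0 \<le> \<mu> x" and int: "integrable lebesgue \<mu>"
    and H1: "(\<lambda>x. sqrt (\<mu> x)) \<in> H1_loc" and lap: "\<exists>g. has_weak_laplacian \<mu> g"
  shows "weak_density \<mu> (weak_grad \<mu>) (weak_laplacian \<mu>)"
proof -
  let ?\<phi> = "\<lambda>x. sqrt (\<mu> x)"
  obtain G where \<phi>2: "?\<phi> \<in> L2_loc" and G: "has_weak_grad ?\<phi> G" "G \<in> L2_loc"
    using H1 unfolding H1_loc_def by blast
  have eq: "AE x in lebesgue. (?\<phi> x)\<^sup>2 = \<mu> x" using \<mu>0 by eventually_elim simp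
  have \<mu>L: "\<mu> \<in> L1_loc" by (rule integrable_imp_L1_loc[OF int])
  have w: "has_weak_grad \<mu> (\<lambda>x. (2 * ?\<phi> x) *\<^sub>R G x)"
    by (rule has_weak_grad_cong_AE[OF has_weak_grad_square[OF G(1) \<phi>2 G(2)] eq \<mu>L])
  have V: "has_weak_grad \<mu> (weak_grad \<mu>)"
    unfolding weak_grad_def by (rule someI[of "has_weak_grad \<mu>", OF w])
  have D: "has_weak_laplacian \<mu> (weak_laplacian \<mu>)"
    unfolding weak_laplacian_def using lap by (rule someI_ex)
  have VG: "AE x in lebesgue. weak_grad \<mu> x = (2 * ?\<phi> x) *\<^sub>R G x"
    by (rule has_weak_grad_unique[OF V w])
  have Vm: "weak_grad \<mu> \<in> borel_measurable lebesgue"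
    using V L1_loc_borel unfolding has_weak_grad_def by blast
  have \<mu>m: "\<mu> \<in> borel_measurable lebesgue" using int by auto
  show ?thesis
  proof
    show "AE x in lebesgue. \<mu> x = 0 \<longrightarrow> weak_grad \<mu> x = 0"
      using VG by eventually_elim auto
    \<comment> \<open>The result on the zero set asks for nonnegativity at every point, so it is
      applied to \<bar>\<mu>\<bar>, which has the same zeros and differs from \<mu> on a null set
      only.\<close>
    have aeq: "AE x in lebesgue. \<mu> x = \<bar>\<mu> x\<bar>" using \<mu>0 by eventually_elim simp
    have "has_weak_laplacian (\<lambda>x. \<bar>\<mu> x\<bar>) (weak_laplacian \<mu>)"
      by (rule has_weak_laplacian_cong_AE[OF D aeq]) (intro integrable_imp_L1_loc integrable_abs int)
    from weak_laplacian_nonneg_on_zeros[OF this]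
    show "AE x in lebesgue. \<mu> x = 0 \<longrightarrow> 0 \<le> weak_laplacian \<mu> x" by simp
    show "(\<lambda>x. (norm (weak_grad \<mu> x))\<^sup>2 / \<mu> x) \<in> L1_loc"
    proof (rule L1_locI)
      fix R
      show "integrable lebesgue (\<lambda>x. indicator (cball 0 R) x *\<^sub>R ((norm (weak_grad \<mu> x))\<^sup>2 / \<mu> x))"
      proof (rule Bochner_Integration.integrable_bound[OF integrable_mult_right[OF L2_loc_cball[OF G(2), of R], of 4]])
        show "(\<lambda>x. indicator (cball 0 R) x *\<^sub>R ((norm (weak_grad \<mu> x))\<^sup>2 / \<mu> x)) \<in> borel_measurable lebesgue"
          using Vm \<mu>m by (intro borel_measurable_scaleR indicator_cball_borel) measurable
        show "AE x in lebesgue. norm (indicator (cball 0 R) x *\<^sub>R ((norm (weak_grad \<mu> x))\<^sup>2 / \<mu> x))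
           \<le> norm (4 * (indicator (cball 0 R) x * (norm (G x))\<^sup>2))"
          using VG \<mu>0
        proof eventually_elim
          case (elim x)
          have "(norm (weak_grad \<mu> x))\<^sup>2 / \<mu> x \<le> 4 * (norm (G x))\<^sup>2 \<and> 0 \<le> (norm (weak_grad \<mu> x))\<^sup>2 / \<mu> x"
          proof (cases "\<mu> x = 0")
            case False
            have "(norm (weak_grad \<mu> x))\<^sup>2 = \<mu> x * (4 * (norm (G x))\<^sup>2)"
              unfolding elim(1) using elim(2) by (simp add: power_mult_distrib)
            then show ?thesis using False elim(2) by simp
          qed simp
          then show ?case using elim(2) by (simp add: indicator_def)
        qed
      qed
    qed
  qed (use \<mu>0 V D in auto)
qed

text \<open>Near 0 the hypothesis on the potential matches the logarithmic gain with no constant to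
  spare; elsewhere both sides are controlled by constants.\<close>

lemma potential_bound_log_potential:
  fixes p :: "real^'n \<Rightarrow> real"
  assumes near: "\<exists>R\<^sub>0>0. AE x in lebesgue. x \<in> ball 0 R\<^sub>0 \<longrightarrow>
           (norm x)\<^sup>2 * p x \<le> 1/4 * (1 / \<bar>ln (norm x)\<bar>\<^sup>2)"
    and far: "\<forall>R>0. \<exists>M. AE x in lebesgue. x \<notin> ball 0 R \<longrightarrow> p x \<le> M"
  shows "\<exists>C>0. AE x in lebesgue. p x \<le> log_potential ((norm x)\<^sup>2) + C"
proof -
  obtain R0 where R0: "R0 > 0" "AE x in lebesgue. x \<in> ball 0 R0 \<longrightarrow>
           (norm x)\<^sup>2 * p x \<le> 1/4 * (1 / \<bar>ln (norm x)\<bar>\<^sup>2)" using near by blast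
  \<comment> \<open>For |x| < exp (-1) one has |x|^2 <= exp (-1), the range of
    \<open>log_potential_near_0\<close>.\<close>
  define R where "R = min R0 (exp (- 1))"
  have R: "R > 0" "R \<le> R0" "R \<le> exp (- 1)" using R0 by (auto simp: R_def)
  obtain M where M: "AE x in lebesgue. x \<notin> ball 0 R \<longrightarrow> p x \<le> M" using far R(1) by blast
  \<comment> \<open>\<open>\<bar>M\<bar>\<close> serves outside the ball and
    \<open>4 * exp 1\<close> inside; outside, the latter also outweighs the lower bound
    \<open>- exp 1\<close> of \<open>log_potential\<close>.\<close>
  define C where "C = \<bar>M\<bar> + 4 * exp (1::real)"
  have "C > 0" by (simp add: C_def add_nonneg_pos)
  moreover have "AE x in lebesgue. p x \<le> log_potential ((norm x)\<^sup>2) + C"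
    using R0(2) M AE_lebesgue_neq[of 0]
  proof eventually_elim
    case (elim x)
    have s: "(norm x)\<^sup>2 > 0" using elim(3) by simp
    show ?case
    proof (cases "norm x < R")
      case True
      have "(norm x)\<^sup>2 \<le> (exp (- 1))\<^sup>2" using True R by (intro power_mono) auto
      also have "\<dots> \<le> exp (- 1) * 1" unfolding power2_eq_square by (intro mult_left_mono) auto
      finally have le: "(norm x)\<^sup>2 \<le> exp (- 1)" by simp
      \<comment> \<open>Squaring ln (|x|^2) = 2 ln |x| produces a factor 4 that uses up the 1/4 of
        the hypothesis.\<close>
      have "ln ((norm x)\<^sup>2) = 2 * ln (norm x)" using elim(3) by (simp add: ln_realpow)
      then have "1/4 * (1 / \<bar>ln (norm x)\<bar>\<^sup>2) = 1 / (ln ((norm x)\<^sup>2))\<^sup>2" by (simp add: power_mult_distrib)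
      then have "(norm x)\<^sup>2 * p x \<le> 1 / (ln ((norm x)\<^sup>2))\<^sup>2" using elim(1) True R by simp
      then have "p x \<le> 1 / (ln ((norm x)\<^sup>2))\<^sup>2 / (norm x)\<^sup>2"
        by (subst pos_le_divide_eq[OF s]) (simp only: mult.commute)
      also have "\<dots> = 1 / ((norm x)\<^sup>2 * (ln ((norm x)\<^sup>2))\<^sup>2)" by (simp add: mult.commute)
      also have "\<dots> \<le> log_potential ((norm x)\<^sup>2) + 4 * exp 1" by (rule log_potential_near_0[OF s le])
      finally show ?thesis by (simp add: C_def)
    next
      case False
      then have "p x \<le> M" using elim(2) by simp
      then show ?thesis using log_potential_ge[OF s] exp_gt_zero[of "1::real"] unfolding C_def by linarith
    qed
  qed
  ultimately show ?thesis by blast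
qed

text \<open>The integrability clause ensures that the singular integrals are finite and not the
  default value 0. The witness for C_1 is a constant by which the potential may exceed
  \<open>log_potential\<close>; it depends on the density alone.\<close>

theorem theorem4p1:
  fixes \<mu> :: "real^'n \<Rightarrow> real" and C\<^sub>0 :: real
  assumes "CARD('n) \<ge> 5"
    and "AE x in lebesgue. 0 \<le> \<mu> x"
    and "integrable lebesgue \<mu>"
    and "prob_space (density_measure \<mu>)"
    and "(\<lambda>x. sqrt (\<mu> x)) \<in> H1_loc"
    and "\<exists>g. has_weak_laplacian \<mu> g"
    and "\<exists>R\<^sub>0>0. AE x in lebesgue. x \<in> ball 0 R\<^sub>0 \<longrightarrow>
           (norm x)\<^sup>2 * potential \<mu> x \<le> 1/4 * (1 / \<bar>ln (norm x)\<bar>\<^sup>2)"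
    and "\<forall>R>0. \<exists>M. AE x in lebesgue. x \<notin> ball 0 R \<longrightarrow> potential \<mu> x \<le> M"
    and "C\<^sub>0 = ((real CARD('n) - 2) / 2)\<^sup>2"
  shows "(\<forall>u\<in>Cc_infty. integrable (density_measure \<mu>) (\<lambda>x. \<bar>u x\<bar>\<^sup>2 / norm x ^ 4)) \<and>
    (\<exists>C\<^sub>1>0.
      (\<forall>\<epsilon>>0. \<forall>u\<in>Cc_infty.
        ((C\<^sub>0 - 1)\<^sup>2 - \<epsilon>) * (LINT x|density_measure \<mu>. \<bar>u x\<bar>\<^sup>2 / norm x ^ 4)
        \<le> (LINT x|density_measure \<mu>. \<bar>kolmogorov \<mu> u x\<bar>\<^sup>2)
          + ((C\<^sub>0 - 1) * C\<^sub>1)\<^sup>2 / \<epsilon> * (LINT x|density_measure \<mu>. \<bar>u x\<bar>\<^sup>2)) \<and>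
      (\<forall>u\<in>Cc_infty.
        (C\<^sub>0 - 1)\<^sup>2 * (LINT x|density_measure \<mu>. \<bar>u x\<bar>\<^sup>2 / norm x ^ 4)
        \<le> (LINT x|density_measure \<mu>. \<bar>kolmogorov \<mu> u x\<bar>\<^sup>2)
          + 2 * (C\<^sub>0 - 1) * C\<^sub>1 / C\<^sub>0 * (LINT x|density_measure \<mu>. (norm (grad u x))\<^sup>2)
          + 2 * (C\<^sub>0 - 1) * C\<^sub>1\<^sup>2 / C\<^sub>0 * (LINT x|density_measure \<mu>. \<bar>u x\<bar>\<^sup>2)))"
proof -
  interpret weak_density \<mu> "weak_grad \<mu>" "weak_laplacian \<mu>"
    by (rule weak_density_of_sqrt_H1_loc[OF assms(2,3,5,6)])
  have P: "P = potential \<mu>"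
    by (rule ext) (simp add: P_def potential_def log_grad_def)
  have L: "L u = kolmogorov \<mu> u" for u
    by (rule ext) (simp add: L_def kolmogorov_def log_grad_def)
  obtain C where C: "C > 0" and PC: "AE x in lebesgue. P x \<le> log_potential ((norm x)\<^sup>2) + C"
    using potential_bound_log_potential[OF assms(7,8)] unfolding P by blast
  define a where "a = (real CARD('n) - 2) / 2"
  \<comment> \<open>The dimension enters here: N >= 5 gives a >= 3/2, so that C_0 - 1 = a^2 - 1 is
    positive.\<close>
  have a: "a > 1" "2 * a + 2 = real CARD('n)" using assms(1) by (auto simp: a_def field_simps)
  have a0: "a > 0" and C\<^sub>0: "C\<^sub>0 = a\<^sup>2" using a(1) assms(9) by (auto simp: a_def)
  have C\<^sub>0_gt: "C\<^sub>0 > 1" using a(1) by (simp add: C\<^sub>0 one_less_power)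
  have dens: "integrable (density_measure \<mu>) f \<longleftrightarrow> integrable lebesgue (\<lambda>x. \<mu> x * f x)"
    "(LINT x|density_measure \<mu>. f x) = (LINT x|lebesgue. \<mu> x * f x)"
    if "f \<in> borel_measurable lebesgue" for f :: "real^'n \<Rightarrow> real"
    using integrable_density[OF that m_borel assms(2)] integral_density[OF that m_borel assms(2)]
    by (simp_all add: density_measure_def)
  have nm: "(\<lambda>x. norm x) \<in> borel_measurable (lebesgue :: (real^'n) measure)"
    by (rule borel_measurable_lebesgueI) simp
  have d4: "(LINT x|density_measure \<mu>. \<bar>u x\<bar>\<^sup>2 / norm x ^ 4) = (LINT x|lebesgue. \<mu> x * ((u x)\<^sup>2 / norm x ^ 4))"
    and i4: "integrable (density_measure \<mu>) (\<lambda>x. \<bar>u x\<bar>\<^sup>2 / norm x ^ 4)"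
    and dL: "(LINT x|density_measure \<mu>. \<bar>kolmogorov \<mu> u x\<bar>\<^sup>2) = (LINT x|lebesgue. \<mu> x * (kolmogorov \<mu> u x)\<^sup>2)"
    and dg: "(LINT x|density_measure \<mu>. (norm (grad u x))\<^sup>2) = (LINT x|lebesgue. \<mu> x * (norm (grad u x))\<^sup>2)"
    and du: "(LINT x|density_measure \<mu>. \<bar>u x\<bar>\<^sup>2) = (LINT x|lebesgue. \<mu> x * (u x)\<^sup>2)"
    if u: "u \<in> Cc_infty" for u
  proof -
    have su: "smooth u" by (rule Cc_infty_smooth[OF u])
    have um: "u \<in> borel_measurable lebesgue" by (rule Cc_infty_borel[OF u])
    have "(\<lambda>x. (u x)\<^sup>2 / norm x ^ 4) \<in> borel_measurable lebesgue" using um nm by measurable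
    from dens[OF this] rellich(1)[OF u a PC C]
    show "(LINT x|density_measure \<mu>. \<bar>u x\<bar>\<^sup>2 / norm x ^ 4) = (LINT x|lebesgue. \<mu> x * ((u x)\<^sup>2 / norm x ^ 4))"
      "integrable (density_measure \<mu>) (\<lambda>x. \<bar>u x\<bar>\<^sup>2 / norm x ^ 4)" by simp_all
    have "(\<lambda>x. (kolmogorov \<mu> u x)\<^sup>2) \<in> borel_measurable lebesgue" using L_borel[OF su] unfolding L by measurable
    from dens(2)[OF this] show "(LINT x|density_measure \<mu>. \<bar>kolmogorov \<mu> u x\<bar>\<^sup>2) = (LINT x|lebesgue. \<mu> x * (kolmogorov \<mu> u x)\<^sup>2)" by simp
    have "(\<lambda>x. (norm (grad u x))\<^sup>2) \<in> borel_measurable lebesgue" using grad_borel[OF su] by measurable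
    from dens(2)[OF this] show "(LINT x|density_measure \<mu>. (norm (grad u x))\<^sup>2) = (LINT x|lebesgue. \<mu> x * (norm (grad u x))\<^sup>2)" .
    have "(\<lambda>x. (u x)\<^sup>2) \<in> borel_measurable lebesgue" using um by measurable
    from dens(2)[OF this] show "(LINT x|density_measure \<mu>. \<bar>u x\<bar>\<^sup>2) = (LINT x|lebesgue. \<mu> x * (u x)\<^sup>2)" by simp
  qed
  define k where "k = C\<^sub>0 - 1"
  have k: "k > 0" using C\<^sub>0_gt by (simp add: k_def)
  \<comment> \<open>Both parts only have to estimate the last integral, with weight |x|^-2.\<close>
  have core: "k\<^sup>2 * (LINT x|lebesgue. \<mu> x * ((u x)\<^sup>2 / norm x ^ 4))
      \<le> (LINT x|lebesgue. \<mu> x * (kolmogorov \<mu> u x)\<^sup>2) + 2 * k * C * (LINT x|lebesgue. \<mu> x * ((u x)\<^sup>2 / (norm x)\<^sup>2))"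
    if "u \<in> Cc_infty" for u
    using rellich(2)[OF that a PC C] unfolding L k_def C\<^sub>0 .
  have part_i: "(k\<^sup>2 - \<epsilon>) * (LINT x|density_measure \<mu>. \<bar>u x\<bar>\<^sup>2 / norm x ^ 4)
        \<le> (LINT x|density_measure \<mu>. \<bar>kolmogorov \<mu> u x\<bar>\<^sup>2)
          + (k * C)\<^sup>2 / \<epsilon> * (LINT x|density_measure \<mu>. \<bar>u x\<bar>\<^sup>2)"
    if \<epsilon>: "\<epsilon> > 0" and u: "u \<in> Cc_infty" for \<epsilon> u
  proof -
    note i4' = rellich(1)[OF u a PC C]
    have u2: "(\<lambda>x. (u x)\<^sup>2) \<in> Cc_infty"
      using Cc_infty_mult[OF u Cc_infty_smooth[OF u]] by (simp add: power2_eq_square)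
    note iu = m_mult_integrable[OF u2]
    have "2 * k * C * (LINT x|lebesgue. \<mu> x * ((u x)\<^sup>2 / (norm x)\<^sup>2)) = (LINT x|lebesgue. 2 * k * C * (\<mu> x * ((u x)\<^sup>2 / (norm x)\<^sup>2)))"
      by (rule integral_mult_right_zero[symmetric])
    also have "\<dots> \<le> (LINT x|lebesgue. \<epsilon> * (\<mu> x * ((u x)\<^sup>2 / norm x ^ 4)) + (k * C)\<^sup>2 / \<epsilon> * (\<mu> x * (u x)\<^sup>2))"
    proof (rule integral_mono_AE)
      show "AE x in lebesgue. 2 * k * C * (\<mu> x * ((u x)\<^sup>2 / (norm x)\<^sup>2)) \<le> \<epsilon> * (\<mu> x * ((u x)\<^sup>2 / norm x ^ 4)) + (k * C)\<^sup>2 / \<epsilon> * (\<mu> x * (u x)\<^sup>2)"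
        using m_nonneg
      proof eventually_elim
        case (elim x)
        \<comment> \<open>Young's inequality with weight \<epsilon> for the factors u/|x|^2 and k C
          u, whose product is k C u^2/|x|^2.\<close>
        define w where "w = u x / (norm x)\<^sup>2"
        have "\<bar>w * (k * C * u x)\<bar> \<le> (\<epsilon> * w\<^sup>2 + (k * C * u x)\<^sup>2 / \<epsilon>) / 2" by (rule AM_GM_weighted[OF \<epsilon>])
        from abs_le_D1[OF this] have "2 * (w * (k * C * u x)) \<le> \<epsilon> * w\<^sup>2 + (k * C * u x)\<^sup>2 / \<epsilon>"
          by simp
        then have "\<mu> x * (2 * (w * (k * C * u x))) \<le> \<mu> x * (\<epsilon> * w\<^sup>2 + (k * C * u x)\<^sup>2 / \<epsilon>)"
          using elim by (rule mult_left_mono)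
        moreover have "w\<^sup>2 = (u x)\<^sup>2 / norm x ^ 4" by (simp add: w_def power_divide flip: power_mult)
        moreover have "(u x)\<^sup>2 / (norm x)\<^sup>2 = w * u x" by (simp add: w_def power2_eq_square)
        ultimately show ?case by (simp add: power_mult_distrib algebra_simps)
      qed
    qed (intro integrable_mult_right Bochner_Integration.integrable_add i4' iu hardy(1)[OF u a0 a(2) PC])+
    also have "\<dots> = \<epsilon> * (LINT x|lebesgue. \<mu> x * ((u x)\<^sup>2 / norm x ^ 4)) + (k * C)\<^sup>2 / \<epsilon> * (LINT x|lebesgue. \<mu> x * (u x)\<^sup>2)"
      unfolding Bochner_Integration.integral_add[OF integrable_mult_right[OF i4'] integrable_mult_right[OF iu]] integral_mult_right_zero ..
    finally show ?thesis
      using core[OF u] unfolding d4[OF u] dL[OF u] du[OF u] left_diff_distrib by linarith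
  qed
  have part_ii: "k\<^sup>2 * (LINT x|density_measure \<mu>. \<bar>u x\<bar>\<^sup>2 / norm x ^ 4)
        \<le> (LINT x|density_measure \<mu>. \<bar>kolmogorov \<mu> u x\<bar>\<^sup>2)
          + 2 * k * C / C\<^sub>0 * (LINT x|density_measure \<mu>. (norm (grad u x))\<^sup>2)
          + 2 * k * C\<^sup>2 / C\<^sub>0 * (LINT x|density_measure \<mu>. \<bar>u x\<bar>\<^sup>2)"
    if u: "u \<in> Cc_infty" for u
  proof -
    \<comment> \<open>\<open>?B\<close> is bounded by Hardy's inequality for u itself; its constant
      C_0 is the denominator in the statement.\<close>
    let ?B = "LINT x|lebesgue. \<mu> x * ((u x)\<^sup>2 / (norm x)\<^sup>2)"
    let ?G = "LINT x|lebesgue. \<mu> x * (norm (grad u x))\<^sup>2"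
    let ?M = "LINT x|lebesgue. \<mu> x * (u x)\<^sup>2"
    have "C\<^sub>0 * ?B \<le> ?G + C * ?M" using hardy(2)[OF u a0 a(2) PC] unfolding C\<^sub>0 .
    then have "?B \<le> (?G + C * ?M) / C\<^sub>0" using C\<^sub>0_gt by (simp add: pos_le_divide_eq mult.commute)
    then have "2 * k * C * ?B \<le> 2 * k * C * ((?G + C * ?M) / C\<^sub>0)" using k C by (intro mult_left_mono) auto
    also have "\<dots> = 2 * k * C / C\<^sub>0 * ?G + 2 * k * C\<^sup>2 / C\<^sub>0 * ?M"
      by (simp add: power2_eq_square algebra_simps add_divide_distrib)
    finally show ?thesis using core[OF u] unfolding d4[OF u] dL[OF u] du[OF u] dg[OF u] by linarith
  qed
  show ?thesis
    using i4 C part_i part_ii unfolding k_def by blast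
qed

end
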